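(* Let $\mathcal{A}$ be an AB5 abelian category. The following assertions hold: (1) $\operatorname{fp}(\mathcal{A})$ is closed under taking cokernels and, when $\mathcal{A}$ is a Grothendieck category, $\operatorname{fp}(\mathcal{A})$ is skeletally small and closed under taking extensions. (2) There is an equality of subcategories $\operatorname{Pres}(\operatorname{fp}(\mathcal{A}))=\varinjlim\operatorname{fp}(\mathcal{A})$. (3) When $\mathcal{A}$ is a Grothendieck category, the subcategory $\varinjlim\operatorname{fp}(\mathcal{A})$ is a coreflective subcategory, which is finitely accessible.
   Context: AB5 means cocomplete with exact directed colimits (= direct limits); a Grothendieck category is an AB5 abelian category with a generator. Subcategories are full and closed under isomorphisms. An object $F$ of an additive category $\mathcal{A}$ with direct limits is finitely presented if $\mathcal{A}(F,-)$ preserves direct limits; $\operatorname{fp}(\mathcal{A})$ is the subcategory of finitely presented objects. $\varinjlim\operatorname{fp}(\mathcal{A})$ is the subcategory of objects isomorphic to direct limits in $\mathcal{A}$ of direct systems of objects of $\operatorname{fp}(\mathcal{A})$. $\operatorname{Pres}(\operatorname{fp}(\mathcal{A}))$ is the subcategory of objects isomorphic to cokernels of morphisms between (set-indexed) coproducts of objects of $\operatorname{fp}(\mathcal{A})$. A subcategory is coreflective if its inclusion has a right adjoint. An additive category $\mathcal{C}$ with direct limits is finitely accessible if $\operatorname{fp}(\mathcal{C})$ is skeletally small and each object of $\mathcal{C}$ is a direct limit of objects of $\operatorname{fp}(\mathcal{C})$. *)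

theory Defs
  imports "HOL-Algebra.Group" "HOL-Library.Equipollence" "HOL-Library.FuncSet"
begin

section \<open>Size\<close>

text \<open>
  HOL has no distinction between sets and proper classes. It is modelled relative to a set U of
  inaccessible cardinality, which stands for the universe of sets: a collection counts as a
  set (is small) iff its cardinality is below that of U. The condition on U only involves
  its cardinality. Since every small collection is in bijection with a set of elements of the
  type of U, index sets of that type suffice wherever one quantifies over all
  small index sets. Object collections of categories carry no size restriction.
\<close>

definition inaccessible :: "'u set \<Rightarrow> bool" where
  "inaccessible U \<longleftrightarrow>
     (UNIV :: nat set) \<prec> U \<and>
     (\<forall>X :: 'u set. X \<prec> U \<longrightarrow> Pow X \<prec> U) \<and>
     (\<forall>\<X> :: 'u set set. \<X> \<prec> U \<and> (\<forall>X\<in>\<X>. X \<prec> U) \<longrightarrow> \<Union>\<X> \<prec> U)"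


section \<open>Categories, functors, colimits\<close>

record ('o, 'm) precat =
  Obj :: "'o set"
  Arr :: "'m set"
  Dom :: "'m \<Rightarrow> 'o"
  Cod :: "'m \<Rightarrow> 'o"
  Ide :: "'o \<Rightarrow> 'm"
  Comp :: "'m \<Rightarrow> 'm \<Rightarrow> 'm"  (infixl \<open>\<cdot>\<index>\<close> 70)

definition Hom :: "('o, 'm, 'x) precat_scheme \<Rightarrow> 'o \<Rightarrow> 'o \<Rightarrow> 'm set" where
  "Hom C X Y = {f \<in> Arr C. Dom C f = X \<and> Cod C f = Y}"

definition category :: "('o, 'm, 'x) precat_scheme \<Rightarrow> bool" where
  "category C \<longleftrightarrow>
     (\<forall>f\<in>Arr C. Dom C f \<in> Obj C \<and> Cod C f \<in> Obj C) \<and>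
     (\<forall>X\<in>Obj C. Ide C X \<in> Hom C X X) \<and>
     (\<forall>f\<in>Arr C. \<forall>g\<in>Arr C. Cod C f = Dom C g \<longrightarrow> g \<cdot>\<^bsub>C\<^esub> f \<in> Hom C (Dom C f) (Cod C g)) \<and>
     (\<forall>f\<in>Arr C. f \<cdot>\<^bsub>C\<^esub> Ide C (Dom C f) = f \<and> Ide C (Cod C f) \<cdot>\<^bsub>C\<^esub> f = f) \<and>
     (\<forall>f\<in>Arr C. \<forall>g\<in>Arr C. \<forall>h\<in>Arr C. Cod C f = Dom C g \<and> Cod C g = Dom C h \<longrightarrow>
        h \<cdot>\<^bsub>C\<^esub> (g \<cdot>\<^bsub>C\<^esub> f) = (h \<cdot>\<^bsub>C\<^esub> g) \<cdot>\<^bsub>C\<^esub> f)"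

definition locally_small :: "'u set \<Rightarrow> ('o, 'm, 'x) precat_scheme \<Rightarrow> bool" where
  "locally_small U C \<longleftrightarrow> (\<forall>X\<in>Obj C. \<forall>Y\<in>Obj C. Hom C X Y \<prec> U)"

definition isomorphic :: "('o, 'm, 'x) precat_scheme \<Rightarrow> 'o \<Rightarrow> 'o \<Rightarrow> bool" where
  "isomorphic C X Y \<longleftrightarrow> X \<in> Obj C \<and> Y \<in> Obj C \<and>
     (\<exists>f\<in>Hom C X Y. \<exists>g\<in>Hom C Y X. g \<cdot>\<^bsub>C\<^esub> f = Ide C X \<and> f \<cdot>\<^bsub>C\<^esub> g = Ide C Y)"

definition mono_arr :: "('o, 'm, 'x) precat_scheme \<Rightarrow> 'm \<Rightarrow> bool" where
  "mono_arr C f \<longleftrightarrow> f \<in> Arr C \<and>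
     (\<forall>g\<in>Arr C. \<forall>h\<in>Arr C. Dom C g = Dom C h \<and> Cod C g = Dom C f \<and> Cod C h = Dom C f \<and>
        f \<cdot>\<^bsub>C\<^esub> g = f \<cdot>\<^bsub>C\<^esub> h \<longrightarrow> g = h)"

definition epi_arr :: "('o, 'm, 'x) precat_scheme \<Rightarrow> 'm \<Rightarrow> bool" where
  "epi_arr C f \<longleftrightarrow> f \<in> Arr C \<and>
     (\<forall>g\<in>Arr C. \<forall>h\<in>Arr C. Cod C g = Cod C h \<and> Dom C g = Cod C f \<and> Dom C h = Cod C f \<and>
        g \<cdot>\<^bsub>C\<^esub> f = h \<cdot>\<^bsub>C\<^esub> f \<longrightarrow> g = h)"

record ('o, 'm, 'p, 'n) cfunctor =
  omap :: "'o \<Rightarrow> 'p"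
  amap :: "'m \<Rightarrow> 'n"

definition is_functor ::
  "('o, 'm, 'x) precat_scheme \<Rightarrow> ('p, 'n, 'y) precat_scheme \<Rightarrow> ('o, 'm, 'p, 'n) cfunctor \<Rightarrow> bool" where
  "is_functor C D F \<longleftrightarrow>
     (\<forall>X\<in>Obj C. omap F X \<in> Obj D) \<and>
     (\<forall>f\<in>Arr C. amap F f \<in> Hom D (omap F (Dom C f)) (omap F (Cod C f))) \<and>
     (\<forall>X\<in>Obj C. amap F (Ide C X) = Ide D (omap F X)) \<and>
     (\<forall>f\<in>Arr C. \<forall>g\<in>Arr C. Cod C f = Dom C g \<longrightarrow>
        amap F (g \<cdot>\<^bsub>C\<^esub> f) = amap F g \<cdot>\<^bsub>D\<^esub> amap F f)"

definition nat_trans ::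
  "('o, 'm, 'x) precat_scheme \<Rightarrow> ('p, 'n, 'y) precat_scheme \<Rightarrow> ('o, 'm, 'p, 'n) cfunctor \<Rightarrow>
   ('o, 'm, 'p, 'n) cfunctor \<Rightarrow> ('o \<Rightarrow> 'n) \<Rightarrow> bool" where
  "nat_trans C D F G \<tau> \<longleftrightarrow>
     (\<forall>X\<in>Obj C. \<tau> X \<in> Hom D (omap F X) (omap G X)) \<and>
     (\<forall>f\<in>Arr C. amap G f \<cdot>\<^bsub>D\<^esub> \<tau> (Dom C f) = \<tau> (Cod C f) \<cdot>\<^bsub>D\<^esub> amap F f)"

definition is_cocone ::
  "('j, 'k, 'x) precat_scheme \<Rightarrow> ('o, 'm, 'y) precat_scheme \<Rightarrow> ('j, 'k, 'o, 'm) cfunctor \<Rightarrow>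
   'o \<Rightarrow> ('j \<Rightarrow> 'm) \<Rightarrow> bool" where
  "is_cocone J C D L \<iota> \<longleftrightarrow> L \<in> Obj C \<and>
     (\<forall>j\<in>Obj J. \<iota> j \<in> Hom C (omap D j) L) \<and>
     (\<forall>k\<in>Arr J. \<iota> (Cod J k) \<cdot>\<^bsub>C\<^esub> amap D k = \<iota> (Dom J k))"

definition is_colimit ::
  "('j, 'k, 'x) precat_scheme \<Rightarrow> ('o, 'm, 'y) precat_scheme \<Rightarrow> ('j, 'k, 'o, 'm) cfunctor \<Rightarrow>
   'o \<Rightarrow> ('j \<Rightarrow> 'm) \<Rightarrow> bool" where
  "is_colimit J C D L \<iota> \<longleftrightarrow> is_cocone J C D L \<iota> \<and>
     (\<forall>M \<mu>. is_cocone J C D M \<mu> \<longrightarrow>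
        (\<exists>!h. h \<in> Hom C L M \<and> (\<forall>j\<in>Obj J. h \<cdot>\<^bsub>C\<^esub> \<iota> j = \<mu> j)))"

text \<open>
  Every small category is isomorphic to one whose objects and arrows are elements of the type
  of U.
\<close>
definition cocomplete :: "'u set \<Rightarrow> ('o, 'm, 'x) precat_scheme \<Rightarrow> bool" where
  "cocomplete U C \<longleftrightarrow>
     (\<forall>(J :: ('u, 'u) precat) D. category J \<and> Obj J \<prec> U \<and> Arr J \<prec> U \<and> is_functor J C D \<longrightarrow>
        (\<exists>L \<iota>. is_colimit J C D L \<iota>))"

definition is_coproduct ::
  "('o, 'm, 'x) precat_scheme \<Rightarrow> 'i set \<Rightarrow> ('i \<Rightarrow> 'o) \<Rightarrow> 'o \<Rightarrow> ('i \<Rightarrow> 'm) \<Rightarrow> bool" where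
  "is_coproduct C I F P \<iota> \<longleftrightarrow> P \<in> Obj C \<and> (\<forall>i\<in>I. \<iota> i \<in> Hom C (F i) P) \<and>
     (\<forall>Q\<in>Obj C. \<forall>\<mu>. (\<forall>i\<in>I. \<mu> i \<in> Hom C (F i) Q) \<longrightarrow>
        (\<exists>!h. h \<in> Hom C P Q \<and> (\<forall>i\<in>I. h \<cdot>\<^bsub>C\<^esub> \<iota> i = \<mu> i)))"


section \<open>Direct limits\<close>

definition directed_poset :: "'u set \<Rightarrow> 'u set \<Rightarrow> 'u rel \<Rightarrow> bool" where
  "directed_poset U I r \<longleftrightarrow> I \<prec> U \<and> partial_order_on I r \<and> I \<noteq> {} \<and>
     (\<forall>i\<in>I. \<forall>j\<in>I. \<exists>k\<in>I. (i, k) \<in> r \<and> (j, k) \<in> r)"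

definition poset_category :: "'i set \<Rightarrow> 'i rel \<Rightarrow> ('i, 'i \<times> 'i) precat" where
  "poset_category I r =
     \<lparr>Obj = I, Arr = r, Dom = fst, Cod = snd, Ide = (\<lambda>i. (i, i)), Comp = (\<lambda>g f. (fst f, snd g))\<rparr>"

definition direct_system ::
  "'u set \<Rightarrow> ('o, 'm, 'x) precat_scheme \<Rightarrow> 'u set \<Rightarrow> 'u rel \<Rightarrow> ('u, 'u \<times> 'u, 'o, 'm) cfunctor \<Rightarrow> bool" where
  "direct_system U C I r D \<longleftrightarrow> directed_poset U I r \<and> is_functor (poset_category I r) C D"

definition is_direct_limit ::
  "('o, 'm, 'x) precat_scheme \<Rightarrow> 'u set \<Rightarrow> 'u rel \<Rightarrow> ('u, 'u \<times> 'u, 'o, 'm) cfunctor \<Rightarrow>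
   'o \<Rightarrow> ('u \<Rightarrow> 'm) \<Rightarrow> bool" where
  "is_direct_limit C I r D L \<iota> \<longleftrightarrow> is_colimit (poset_category I r) C D L \<iota>"

definition has_direct_limits :: "'u set \<Rightarrow> ('o, 'm, 'x) precat_scheme \<Rightarrow> bool" where
  "has_direct_limits U C \<longleftrightarrow>
     (\<forall>I r D. direct_system U C I r D \<longrightarrow> (\<exists>L \<iota>. is_direct_limit C I r D L \<iota>))"

definition direct_limits_of :: "'u set \<Rightarrow> ('o, 'm, 'x) precat_scheme \<Rightarrow> 'o set \<Rightarrow> 'o set" where
  "direct_limits_of U C S =
     {X. \<exists>I r D L \<iota>. direct_system U C I r D \<and> (\<forall>i\<in>I. omap D i \<in> S) \<and>
           is_direct_limit C I r D L \<iota> \<and> isomorphic C X L}"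


section \<open>Additive and abelian categories\<close>

record ('o, 'm) addcat = "('o, 'm) precat" +
  Add :: "'m \<Rightarrow> 'm \<Rightarrow> 'm"  (infixl \<open>\<boxplus>\<index>\<close> 65)
  Zero :: "'o \<Rightarrow> 'o \<Rightarrow> 'm"

definition hom_group :: "('o, 'm, 'x) addcat_scheme \<Rightarrow> 'o \<Rightarrow> 'o \<Rightarrow> 'm monoid" where
  "hom_group C X Y = \<lparr>carrier = Hom C X Y, mult = Add C, one = Zero C X Y\<rparr>"

definition preadditive_category :: "'u set \<Rightarrow> ('o, 'm, 'x) addcat_scheme \<Rightarrow> bool" where
  "preadditive_category U C \<longleftrightarrow> category C \<and> locally_small U C \<and>
     (\<forall>X\<in>Obj C. \<forall>Y\<in>Obj C. comm_group (hom_group C X Y)) \<and>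
     (\<forall>X\<in>Obj C. \<forall>Y\<in>Obj C. \<forall>Z\<in>Obj C.
        (\<forall>f\<in>Hom C X Y. \<forall>g\<in>Hom C Y Z. \<forall>g'\<in>Hom C Y Z.
           (g \<boxplus>\<^bsub>C\<^esub> g') \<cdot>\<^bsub>C\<^esub> f = (g \<cdot>\<^bsub>C\<^esub> f) \<boxplus>\<^bsub>C\<^esub> (g' \<cdot>\<^bsub>C\<^esub> f)) \<and>
        (\<forall>f\<in>Hom C X Y. \<forall>f'\<in>Hom C X Y. \<forall>g\<in>Hom C Y Z.
           g \<cdot>\<^bsub>C\<^esub> (f \<boxplus>\<^bsub>C\<^esub> f') = (g \<cdot>\<^bsub>C\<^esub> f) \<boxplus>\<^bsub>C\<^esub> (g \<cdot>\<^bsub>C\<^esub> f')))"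

definition zero_object :: "('o, 'm, 'x) precat_scheme \<Rightarrow> 'o \<Rightarrow> bool" where
  "zero_object C Z \<longleftrightarrow> Z \<in> Obj C \<and>
     (\<forall>X\<in>Obj C. (\<exists>!f. f \<in> Hom C X Z) \<and> (\<exists>!f. f \<in> Hom C Z X))"

definition is_biproduct ::
  "('o, 'm, 'x) addcat_scheme \<Rightarrow> 'o \<Rightarrow> 'o \<Rightarrow> 'o \<Rightarrow> 'm \<Rightarrow> 'm \<Rightarrow> 'm \<Rightarrow> 'm \<Rightarrow> bool" where
  "is_biproduct C X Y P i j p q \<longleftrightarrow> P \<in> Obj C \<and>
     i \<in> Hom C X P \<and> j \<in> Hom C Y P \<and> p \<in> Hom C P X \<and> q \<in> Hom C P Y \<and>
     p \<cdot>\<^bsub>C\<^esub> i = Ide C X \<and> q \<cdot>\<^bsub>C\<^esub> j = Ide C Y \<and>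
     q \<cdot>\<^bsub>C\<^esub> i = Zero C X Y \<and> p \<cdot>\<^bsub>C\<^esub> j = Zero C Y X \<and>
     (i \<cdot>\<^bsub>C\<^esub> p) \<boxplus>\<^bsub>C\<^esub> (j \<cdot>\<^bsub>C\<^esub> q) = Ide C P"

definition additive_category :: "'u set \<Rightarrow> ('o, 'm, 'x) addcat_scheme \<Rightarrow> bool" where
  "additive_category U C \<longleftrightarrow> preadditive_category U C \<and> (\<exists>Z. zero_object C Z) \<and>
     (\<forall>X\<in>Obj C. \<forall>Y\<in>Obj C. \<exists>P i j p q. is_biproduct C X Y P i j p q)"

definition is_kernel :: "('o, 'm, 'x) addcat_scheme \<Rightarrow> 'm \<Rightarrow> 'm \<Rightarrow> bool" where
  "is_kernel C k f \<longleftrightarrow> f \<in> Arr C \<and> k \<in> Arr C \<and> Cod C k = Dom C f \<and>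
     f \<cdot>\<^bsub>C\<^esub> k = Zero C (Dom C k) (Cod C f) \<and>
     (\<forall>h\<in>Arr C. Cod C h = Dom C f \<and> f \<cdot>\<^bsub>C\<^esub> h = Zero C (Dom C h) (Cod C f) \<longrightarrow>
        (\<exists>!u. u \<in> Hom C (Dom C h) (Dom C k) \<and> k \<cdot>\<^bsub>C\<^esub> u = h))"

definition is_cokernel :: "('o, 'm, 'x) addcat_scheme \<Rightarrow> 'm \<Rightarrow> 'm \<Rightarrow> bool" where
  "is_cokernel C c f \<longleftrightarrow> f \<in> Arr C \<and> c \<in> Arr C \<and> Dom C c = Cod C f \<and>
     c \<cdot>\<^bsub>C\<^esub> f = Zero C (Dom C f) (Cod C c) \<and>
     (\<forall>h\<in>Arr C. Dom C h = Cod C f \<and> h \<cdot>\<^bsub>C\<^esub> f = Zero C (Dom C f) (Cod C h) \<longrightarrow>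
        (\<exists>!u. u \<in> Hom C (Cod C c) (Cod C h) \<and> u \<cdot>\<^bsub>C\<^esub> c = h))"

definition abelian_category :: "'u set \<Rightarrow> ('o, 'm, 'x) addcat_scheme \<Rightarrow> bool" where
  "abelian_category U C \<longleftrightarrow> additive_category U C \<and>
     (\<forall>f\<in>Arr C. (\<exists>k. is_kernel C k f) \<and> (\<exists>c. is_cokernel C c f)) \<and>
     (\<forall>f. mono_arr C f \<longrightarrow> (\<exists>g. is_kernel C f g)) \<and>
     (\<forall>f. epi_arr C f \<longrightarrow> (\<exists>g. is_cokernel C f g))"

text \<open>Exactness of the sequence with maps f and g, with zeros at both ends.\<close>
definition short_exact :: "('o, 'm, 'x) addcat_scheme \<Rightarrow> 'm \<Rightarrow> 'm \<Rightarrow> bool" where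
  "short_exact C f g \<longleftrightarrow> is_kernel C f g \<and> is_cokernel C g f"

text \<open>
  Direct limits over any fixed directed set, as a functor on direct systems, preserve short
  exact sequences (exactness of a sequence of direct systems being pointwise).
\<close>
definition exact_direct_limits :: "'u set \<Rightarrow> ('o, 'm, 'x) addcat_scheme \<Rightarrow> bool" where
  "exact_direct_limits U C \<longleftrightarrow>
     (\<forall>I r D E F \<sigma> \<tau> L M N \<iota> \<kappa> \<nu> f g.
        direct_system U C I r D \<and> direct_system U C I r E \<and> direct_system U C I r F \<and>
        nat_trans (poset_category I r) C D E \<sigma> \<and> nat_trans (poset_category I r) C E F \<tau> \<and>
        (\<forall>i\<in>I. short_exact C (\<sigma> i) (\<tau> i)) \<and>
        is_direct_limit C I r D L \<iota> \<and> is_direct_limit C I r E M \<kappa> \<and> is_direct_limit C I r F N \<nu> \<and>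
        f \<in> Hom C L M \<and> (\<forall>i\<in>I. f \<cdot>\<^bsub>C\<^esub> \<iota> i = \<kappa> i \<cdot>\<^bsub>C\<^esub> \<sigma> i) \<and>
        g \<in> Hom C M N \<and> (\<forall>i\<in>I. g \<cdot>\<^bsub>C\<^esub> \<kappa> i = \<nu> i \<cdot>\<^bsub>C\<^esub> \<tau> i) \<longrightarrow>
        short_exact C f g)"

definition AB5_abelian :: "'u set \<Rightarrow> ('o, 'm, 'x) addcat_scheme \<Rightarrow> bool" where
  "AB5_abelian U C \<longleftrightarrow> abelian_category U C \<and> cocomplete U C \<and> exact_direct_limits U C"

definition is_generator :: "('o, 'm, 'x) precat_scheme \<Rightarrow> 'o \<Rightarrow> bool" where
  "is_generator C G \<longleftrightarrow> G \<in> Obj C \<and>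
     (\<forall>X\<in>Obj C. \<forall>Y\<in>Obj C. \<forall>f\<in>Hom C X Y. \<forall>g\<in>Hom C X Y.
        (\<forall>h\<in>Hom C G X. f \<cdot>\<^bsub>C\<^esub> h = g \<cdot>\<^bsub>C\<^esub> h) \<longrightarrow> f = g)"

definition grothendieck_category :: "'u set \<Rightarrow> ('o, 'm, 'x) addcat_scheme \<Rightarrow> bool" where
  "grothendieck_category U C \<longleftrightarrow> AB5_abelian U C \<and> (\<exists>G. is_generator C G)"


section \<open>Finitely presented objects\<close>

definition ab_cocone ::
  "'u set \<Rightarrow> 'u rel \<Rightarrow> ('u \<Rightarrow> 'a monoid) \<Rightarrow> ('u \<times> 'u \<Rightarrow> 'a \<Rightarrow> 'a) \<Rightarrow> 'b monoid \<Rightarrow> ('u \<Rightarrow> 'a \<Rightarrow> 'b) \<Rightarrow> bool" where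
  "ab_cocone I r G t H \<mu> \<longleftrightarrow> (\<forall>i\<in>I. \<mu> i \<in> hom (G i) H) \<and>
     (\<forall>(i, j)\<in>r. \<forall>x\<in>carrier (G i). \<mu> j (t (i, j) x) = \<mu> i x)"

text \<open>
  (K, lam) is the direct limit of the direct system (G, t) in the category of (small) abelian
  groups. Up to isomorphism the small abelian groups are those with a small carrier in the type
  of U, so these suffice as test objects H. Intersecting with extensional makes group
  homomorphisms, which are total functions in HOL, determined by their restriction to the carrier.
\<close>
definition is_ab_direct_limit ::
  "'u set \<Rightarrow> 'u set \<Rightarrow> 'u rel \<Rightarrow> ('u \<Rightarrow> 'a monoid) \<Rightarrow> ('u \<times> 'u \<Rightarrow> 'a \<Rightarrow> 'a) \<Rightarrow>
   'a monoid \<Rightarrow> ('u \<Rightarrow> 'a \<Rightarrow> 'a) \<Rightarrow> bool" where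
  "is_ab_direct_limit U I r G t K lam \<longleftrightarrow> comm_group K \<and> ab_cocone I r G t K lam \<and>
     (\<forall>(H :: 'u monoid) \<mu>. comm_group H \<and> carrier H \<prec> U \<and> ab_cocone I r G t H \<mu> \<longrightarrow>
        (\<exists>!h. h \<in> hom K H \<inter> extensional (carrier K) \<and>
              (\<forall>i\<in>I. \<forall>x\<in>carrier (G i). h (lam i x) = \<mu> i x)))"

text \<open>The functor C(F, -) from C to abelian groups preserves direct limits.\<close>
definition finitely_presented :: "'u set \<Rightarrow> ('o, 'm, 'x) addcat_scheme \<Rightarrow> 'o \<Rightarrow> bool" where
  "finitely_presented U C F \<longleftrightarrow>
     (\<forall>I r D L \<iota>. direct_system U C I r D \<and> is_direct_limit C I r D L \<iota> \<longrightarrow>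
        is_ab_direct_limit U I r
          (\<lambda>i. hom_group C F (omap D i)) (\<lambda>k x. amap D k \<cdot>\<^bsub>C\<^esub> x)
          (hom_group C F L) (\<lambda>i x. \<iota> i \<cdot>\<^bsub>C\<^esub> x))"

definition fp :: "'u set \<Rightarrow> ('o, 'm, 'x) addcat_scheme \<Rightarrow> 'o set" where
  "fp U C = {F \<in> Obj C. finitely_presented U C F}"

definition Pres :: "'u set \<Rightarrow> ('o, 'm, 'x) addcat_scheme \<Rightarrow> 'o set \<Rightarrow> 'o set" where
  "Pres U C S =
     {X. \<exists>(I :: 'u set) (J :: 'u set) F G P Q \<iota> \<kappa> f c.
           I \<prec> U \<and> J \<prec> U \<and> (\<forall>i\<in>I. F i \<in> S) \<and> (\<forall>j\<in>J. G j \<in> S) \<and>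
           is_coproduct C I F P \<iota> \<and> is_coproduct C J G Q \<kappa> \<and>
           f \<in> Hom C P Q \<and> is_cokernel C c f \<and> isomorphic C X (Cod C c)}"


section \<open>Subcategories\<close>

text \<open>Full subcategories are given by their sets of objects.\<close>

definition full_subcategory ::
  "('o, 'm, 'x) precat_scheme \<Rightarrow> 'o set \<Rightarrow> ('o, 'm, 'x) precat_scheme" where
  "full_subcategory C S = C\<lparr>Obj := S, Arr := {f \<in> Arr C. Dom C f \<in> S \<and> Cod C f \<in> S}\<rparr>"

definition iso_closed :: "('o, 'm, 'x) precat_scheme \<Rightarrow> 'o set \<Rightarrow> bool" where
  "iso_closed C S \<longleftrightarrow> S \<subseteq> Obj C \<and> (\<forall>X Y. X \<in> S \<and> isomorphic C X Y \<longrightarrow> Y \<in> S)"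

definition skeletally_small :: "'u set \<Rightarrow> ('o, 'm, 'x) precat_scheme \<Rightarrow> 'o set \<Rightarrow> bool" where
  "skeletally_small U C S \<longleftrightarrow> (\<exists>T\<subseteq>S. T \<prec> U \<and> (\<forall>X\<in>S. \<exists>Y\<in>T. isomorphic C X Y))"

definition closed_under_cokernels :: "('o, 'm, 'x) addcat_scheme \<Rightarrow> 'o set \<Rightarrow> bool" where
  "closed_under_cokernels C S \<longleftrightarrow>
     (\<forall>f c. is_cokernel C c f \<and> Dom C f \<in> S \<and> Cod C f \<in> S \<longrightarrow> Cod C c \<in> S)"

definition closed_under_extensions :: "('o, 'm, 'x) addcat_scheme \<Rightarrow> 'o set \<Rightarrow> bool" where
  "closed_under_extensions C S \<longleftrightarrow>
     (\<forall>f g. short_exact C f g \<and> Dom C f \<in> S \<and> Cod C g \<in> S \<longrightarrow> Cod C f \<in> S)"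

definition is_right_adjoint ::
  "('o, 'm, 'x) precat_scheme \<Rightarrow> ('p, 'n, 'y) precat_scheme \<Rightarrow>
   ('o, 'm, 'p, 'n) cfunctor \<Rightarrow> ('p, 'n, 'o, 'm) cfunctor \<Rightarrow> bool" where
  "is_right_adjoint C D F G \<longleftrightarrow> is_functor C D F \<and> is_functor D C G \<and>
     (\<exists>\<phi>. (\<forall>X\<in>Obj C. \<forall>Y\<in>Obj D. bij_betw (\<phi> X Y) (Hom D (omap F X) Y) (Hom C X (omap G Y))) \<and>
          (\<forall>X\<in>Obj C. \<forall>X'\<in>Obj C. \<forall>Y\<in>Obj D. \<forall>Y'\<in>Obj D.
             \<forall>f\<in>Hom C X' X. \<forall>g\<in>Hom D Y Y'. \<forall>h\<in>Hom D (omap F X) Y.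
               \<phi> X' Y' (g \<cdot>\<^bsub>D\<^esub> h \<cdot>\<^bsub>D\<^esub> amap F f) = amap G g \<cdot>\<^bsub>C\<^esub> \<phi> X Y h \<cdot>\<^bsub>C\<^esub> f))"

definition coreflective :: "('o, 'm, 'x) precat_scheme \<Rightarrow> 'o set \<Rightarrow> bool" where
  "coreflective C S \<longleftrightarrow> iso_closed C S \<and>
     (\<exists>R. is_right_adjoint (full_subcategory C S) C \<lparr>omap = (\<lambda>X. X), amap = (\<lambda>f. f)\<rparr> R)"

definition finitely_accessible :: "'u set \<Rightarrow> ('o, 'm, 'x) addcat_scheme \<Rightarrow> bool" where
  "finitely_accessible U C \<longleftrightarrow> additive_category U C \<and> has_direct_limits U C \<and>
     skeletally_small U C (fp U C) \<and> Obj C \<subseteq> direct_limits_of U C (fp U C)"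

end

theory Submission
  imports Defs "HOL-Algebra.Product_Groups"
begin

text \<open>
  An object F is finitely presented iff every map from F to a direct limit factors through some stage
  and every map from F to a stage that vanishes in the limit vanishes at a later stage. Closure under
  cokernels is a direct diagram chase. A cokernel of coproducts of finitely presented objects is the direct limit of the
  quotients of finite subcoproducts by finitely many relations, and conversely a direct limit is a
  cokernel of coproducts of its stages. For a generator G, exactness of direct limits shows that each finitely
  presented object is a quotient of a finite power of G, hence of the coproduct of countably many copies of G, and such a
  quotient is determined by the set of maps from G that it kills; so there is only a small set of them up to
  isomorphism. The coreflection of X is then a quotient of the coproduct of all maps from representatives to X.
  A coreflective subcategory is closed under colimits, and direct limits in it agree with those
  in the ambient category, so it is finitely accessible with the same finitely presented objects.
\<close>

section \<open>Small sets\<close>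

text \<open>The universe shapes the development. Index sets of direct systems and the test groups in
  the definition of finitely presented objects live in the type \<open>'u\<close>, whereas the
  natural index sets here consist of finite subsets, pairs of finite subsets, or maps. All of these
  are coded into \<open>'u\<close>, and tests against groups on other types pass through an
  embedding. Relations are kept as a set of maps with a common codomain and not as one map out of a
  coproduct. Finite subsets of relations then make sense at once, and a stage of a cokernel consists
  of finitely many generators with finitely many relations that already live on them. For the
  coreflection the danger is that a quotient of a coproduct acquires new maps from finitely
  presented objects that vanish in X. Killing relations once is enough: the cokernel of such a map
  at a stage is again finitely presented, so its map to X lifts back to the coproduct.\<close>

lemma small_encode:
  fixes U :: "'u set"
  assumes "A \<prec> U"
  obtains I :: "'u set" and d where "I \<prec> U" "bij_betw d I A"
proof -
  obtain e where e: "inj_on e A" "e ` A \<subseteq> U"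
    using assms by (meson lepoll_def lesspoll_def)
  have "e ` A \<prec> U" using assms e(1) by simp
  moreover have "bij_betw (inv_into A e) (e ` A) A"
    using e(1) by (simp add: bij_betw_inv_into inj_on_imp_bij_betw)
  ultimately show ?thesis using that by blast
qed

lemma small_image: "A \<prec> U \<Longrightarrow> f ` A \<prec> U"
  using image_lepoll lesspoll_trans1 by blast

lemma small_subset: "A \<prec> U \<Longrightarrow> B \<subseteq> A \<Longrightarrow> B \<prec> U"
  using subset_imp_lepoll lesspoll_trans1 by blast

locale universe =
  fixes U :: "'u set"
  assumes inaccessible: "inaccessible U"
begin

lemma infinite_U: "infinite U"
  using inaccessible unfolding inaccessible_def
  by (simp add: infinite_le_lepoll lesspoll_def)

lemma small_nat: "(UNIV :: nat set) \<prec> U"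
  using inaccessible unfolding inaccessible_def by blast

lemma small_finite: "finite A \<Longrightarrow> A \<prec> U"
  using infinite_U finite_lesspoll_infinite by blast

lemma small_Pow:
  assumes "A \<prec> U" shows "Pow A \<prec> U"
proof -
  obtain I :: "'u set" and d where d: "I \<prec> U" "bij_betw d I A"
    using small_encode[OF assms] by blast
  have "Pow I \<prec> U" using inaccessible d(1) unfolding inaccessible_def by blast
  moreover have "Pow A = (image d) ` Pow I"
    using d(2) by (metis bij_betw_def bij_betw_imp_surj_on image_Pow_surj)
  ultimately show ?thesis using small_image by metis
qed

text \<open>The closure conditions in \<open>inaccessible\<close> concern sets of elements of
  \<open>'u\<close>. The pairs are therefore coded there first, by an injection \<open>p\<close> of
  \<open>U \<times> U\<close> into \<open>U\<close>, and then form a small union of small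
  fibres.\<close>

lemma small_Sigma:
  assumes "A \<prec> U" and "\<And>a. a \<in> A \<Longrightarrow> B a \<prec> U"
  shows "Sigma A B \<prec> U"
proof -
  have "U \<times> U \<lesssim> U"
    using infinite_U card_of_Times_same_infinite
    by (metis eqpoll_iff_card_of_ordIso eqpoll_imp_lepoll)
  then obtain p where p: "inj_on p (U \<times> U)" "p ` (U \<times> U) \<subseteq> U"
    by (meson lepoll_def)
  obtain e where e: "inj_on e A" "e ` A \<subseteq> U"
    using assms by (meson lepoll_def lesspoll_def)
  have "\<exists>f. inj_on f (B a) \<and> f ` B a \<subseteq> U" if "a \<in> A" for a
    using assms(2)[OF that] by (meson lepoll_def lesspoll_def)
  then obtain f where f: "\<And>a. a \<in> A \<Longrightarrow> inj_on (f a) (B a) \<and> f a ` B a \<subseteq> U"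
    by metis
  define g where "g = (\<lambda>(a, b). p (e a, f a b))"
  define X where "X a = g ` ({a} \<times> B a)" for a
  have inj: "inj_on g (Sigma A B)"
  proof (rule inj_onI, clarify)
    fix a b a' b' assume h: "a \<in> A" "b \<in> B a" "a' \<in> A" "b' \<in> B a'" "g (a, b) = g (a', b')"
    have "(e a, f a b) \<in> U \<times> U" "(e a', f a' b') \<in> U \<times> U" using e f h by auto
    then have "e a = e a' \<and> f a b = f a' b'"
      using h(5) p(1) by (auto simp: g_def dest: inj_onD)
    then show "a = a' \<and> b = b'" using h e f by (metis inj_onD)
  qed
  have "X a \<prec> U" if "a \<in> A" for a
  proof -
    have "X a = (\<lambda>b. g (a, b)) ` B a" by (auto simp: X_def)
    then show ?thesis using assms(2)[OF that] small_image by metis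
  qed
  moreover have "X ` A \<prec> U" using assms(1) small_image by blast
  ultimately have "\<Union>(X ` A) \<prec> U"
    using inaccessible unfolding inaccessible_def by (metis imageE)
  moreover have "\<Union>(X ` A) = g ` Sigma A B" by (auto simp: X_def)
  ultimately show ?thesis using inj by simp
qed

lemma small_Times: "A \<prec> U \<Longrightarrow> B \<prec> U \<Longrightarrow> A \<times> B \<prec> U"
  by (rule small_Sigma)

lemma small_UN:
  assumes "A \<prec> U" and "\<And>a. a \<in> A \<Longrightarrow> B a \<prec> U"
  shows "(\<Union>a\<in>A. B a) \<prec> U"
proof -
  have "(\<Union>a\<in>A. B a) = snd ` Sigma A B" by force
  moreover have "snd ` Sigma A B \<prec> U"
    by (intro small_image small_Sigma assms)
  ultimately show ?thesis by simp
qed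

text \<open>An extensional function is determined by its graph, a subset of
  \<open>Sigma A B\<close>, so the bound for power sets applies.\<close>

lemma small_PiE:
  assumes "A \<prec> U" and "\<And>a. a \<in> A \<Longrightarrow> B a \<prec> U"
  shows "(\<Pi>\<^sub>E a\<in>A. B a) \<prec> U"
proof -
  have inj: "inj_on (\<lambda>f. (\<lambda>a. (a, f a)) ` A) (\<Pi>\<^sub>E a\<in>A. B a)"
  proof (rule inj_onI)
    fix f g assume fg: "f \<in> (\<Pi>\<^sub>E a\<in>A. B a)" "g \<in> (\<Pi>\<^sub>E a\<in>A. B a)"
      and eq: "(\<lambda>a. (a, f a)) ` A = (\<lambda>a. (a, g a)) ` A"
    have "f a = g a" if "a \<in> A" for a
    proof -
      have "(a, f a) \<in> (\<lambda>a. (a, g a)) ` A" using that eq by blast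
      then show ?thesis by auto
    qed
    then show "f = g" using fg by (meson PiE_ext)
  qed
  have "(\<lambda>f. (\<lambda>a. (a, f a)) ` A) ` (\<Pi>\<^sub>E a\<in>A. B a) \<subseteq> Pow (Sigma A B)"
    by auto
  then have "(\<lambda>f. (\<lambda>a. (a, f a)) ` A) ` (\<Pi>\<^sub>E a\<in>A. B a) \<prec> U"
    by (rule small_subset[OF small_Pow[OF small_Sigma[OF assms(1)]], rotated]) (rule assms(2))
  then show ?thesis using inj by simp
qed

lemma small_Fpow: "A \<prec> U \<Longrightarrow> Fpow A \<prec> U"
  by (rule small_subset[OF small_Pow]) (auto simp: Fpow_def)

text \<open>Direct systems are indexed by elements of \<open>'u\<close>, so an order on another type
  is pulled back along a coding \<open>d\<close>. Injectivity of \<open>d\<close> is what preserves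
  antisymmetry.\<close>

lemma directed_poset_pullback:
  fixes I :: "'u set"
  assumes "I \<prec> U" "bij_betw d I S" "S \<noteq> {}"
    and refl: "\<And>x. x \<in> S \<Longrightarrow> leq x x"
    and trans: "\<And>x y z. x \<in> S \<Longrightarrow> y \<in> S \<Longrightarrow> z \<in> S \<Longrightarrow> leq x y \<Longrightarrow> leq y z \<Longrightarrow> leq x z"
    and antisym: "\<And>x y. x \<in> S \<Longrightarrow> y \<in> S \<Longrightarrow> leq x y \<Longrightarrow> leq y x \<Longrightarrow> x = y"
    and directed: "\<And>x y. x \<in> S \<Longrightarrow> y \<in> S \<Longrightarrow> \<exists>z\<in>S. leq x z \<and> leq y z"
  shows "directed_poset U I {(i, j). i \<in> I \<and> j \<in> I \<and> leq (d i) (d j)}"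
proof -
  have S: "d ` I = S" and inj: "inj_on d I" using assms(2) by (auto simp: bij_betw_def)
  have mem: "d i \<in> S" if "i \<in> I" for i using S that by blast
  have "\<exists>k\<in>I. leq (d i) (d k) \<and> leq (d j) (d k)" if "i \<in> I" "j \<in> I" for i j
    using directed[OF mem mem, OF that] S by auto
  moreover have "I \<noteq> {}" using S assms(3) by blast
  moreover have "partial_order_on I {(i, j). i \<in> I \<and> j \<in> I \<and> leq (d i) (d j)}"
    unfolding partial_order_on_def preorder_on_def
  proof (intro conjI)
    show "refl_on I {(i, j). i \<in> I \<and> j \<in> I \<and> leq (d i) (d j)}"
      using refl mem by (auto simp: refl_on_def)
    show "trans {(i, j). i \<in> I \<and> j \<in> I \<and> leq (d i) (d j)}"
      using trans mem unfolding trans_def by blast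
    show "antisym {(i, j). i \<in> I \<and> j \<in> I \<and> leq (d i) (d j)}"
      using antisym mem inj unfolding antisym_def by (metis (mono_tags, lifting) case_prodD inj_onD mem_Collect_eq)
  qed auto
  ultimately show ?thesis using assms(1) unfolding directed_poset_def by auto
qed

end

section \<open>Elementary properties of directed posets\<close>

context
  fixes U :: "'u set" and I r
  assumes dir: "directed_poset U I r"
begin

lemma directed_poset_small: "I \<prec> U"
  using dir by (simp add: directed_poset_def)

lemma directed_poset_subset: "r \<subseteq> I \<times> I"
  using dir by (simp add: directed_poset_def order_on_defs)

lemma directed_poset_refl: "i \<in> I \<Longrightarrow> (i, i) \<in> r"
  using dir by (simp add: directed_poset_def order_on_defs refl_on_def)

lemma directed_poset_trans: "(i, j) \<in> r \<Longrightarrow> (j, k) \<in> r \<Longrightarrow> (i, k) \<in> r"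
  using dir by (meson directed_poset_def order_on_defs(1,2) transD)

lemma directed_poset_bound2:
  assumes "i \<in> I" "j \<in> I"
  obtains k where "k \<in> I" "(i, k) \<in> r" "(j, k) \<in> r"
  using assms dir by (auto simp: directed_poset_def)

lemma directed_poset_bound:
  assumes "finite A" "A \<subseteq> I"
  obtains k where "k \<in> I" "\<And>i. i \<in> A \<Longrightarrow> (i, k) \<in> r"
proof -
  have "\<exists>k\<in>I. \<forall>i\<in>A. (i, k) \<in> r"
    using assms
  proof (induction A)
    case empty
    then show ?case using dir by (auto simp: directed_poset_def)
  next
    case (insert a A)
    then obtain k where k: "k \<in> I" "\<forall>i\<in>A. (i, k) \<in> r" by auto
    obtain l where "l \<in> I" "(a, l) \<in> r" "(k, l) \<in> r"
      using directed_poset_bound2[of a k] insert.prems k(1) by auto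
    then show ?case using k directed_poset_trans by blast
  qed
  then show ?thesis using that by blast
qed

end

section \<open>Direct limits of abelian groups\<close>

text \<open>The universal property in \<open>is_ab_direct_limit\<close> only tests against groups on
  \<open>'u\<close>. The copy makes quotient groups, whose elements are cosets, available as test
  objects.\<close>

lemma iso_group_on_small_set:
  fixes U :: "'u set"
  assumes "comm_group G" and "carrier G \<prec> U"
  obtains H :: "'u monoid" and h where "comm_group H" "carrier H \<prec> U" "h \<in> hom G H"
    "inj_on h (carrier G)"
proof -
  interpret G: comm_group G by fact
  obtain e where e: "inj_on e (carrier G)" "e ` carrier G \<subseteq> U"
    using assms by (meson lepoll_def lesspoll_def)
  define q where "q = inv_into (carrier G) e"
  have q: "q (e x) = x" if "x \<in> carrier G" for x using e that by (simp add: q_def)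
  define H where "H = \<lparr>carrier = e ` carrier G, mult = \<lambda>x y. e (q x \<otimes>\<^bsub>G\<^esub> q y), one = e \<one>\<^bsub>G\<^esub>\<rparr>"
  have "comm_group H"
  proof (rule comm_groupI)
    fix x assume "x \<in> carrier H"
    then obtain a where a: "a \<in> carrier G" "x = e a" by (auto simp: H_def)
    show "\<exists>y\<in>carrier H. y \<otimes>\<^bsub>H\<^esub> x = \<one>\<^bsub>H\<^esub>"
      using a by (intro bexI[of _ "e (inv\<^bsub>G\<^esub> a)"]) (auto simp: H_def q)
  qed (auto simp: H_def q G.m_ac)
  moreover have "carrier H \<prec> U" using assms(2) e(1) by (simp add: H_def)
  moreover have "e \<in> hom G H" by (auto simp: hom_def H_def q)
  ultimately show ?thesis using that e(1) by blast
qed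

locale ab_direct_system = universe U for U :: "'u set" +
  fixes I r and G :: "'u \<Rightarrow> 'a monoid" and t
  assumes directed: "directed_poset U I r"
    and comm_group_G: "i \<in> I \<Longrightarrow> comm_group (G i)"
    and small_G: "i \<in> I \<Longrightarrow> carrier (G i) \<prec> U"
    and t_hom: "(i, j) \<in> r \<Longrightarrow> t (i, j) \<in> hom (G i) (G j)"
    and t_comp: "(i, j) \<in> r \<Longrightarrow> (j, k) \<in> r \<Longrightarrow> x \<in> carrier (G i) \<Longrightarrow> t (j, k) (t (i, j) x) = t (i, k) x"
begin

lemma group_G: "i \<in> I \<Longrightarrow> group (G i)"
  using comm_group_G comm_group_def by blast

lemma t_carrier: "(i, j) \<in> r \<Longrightarrow> x \<in> carrier (G i) \<Longrightarrow> t (i, j) x \<in> carrier (G j)"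
  using t_hom by (rule hom_in_carrier)

text \<open>Uniqueness of induced maps, freed from the type of the test group: both maps are
  composed with an embedding into a group on \<open>'u\<close>, and restricted to the carrier
  because uniqueness is only asserted among extensional maps.\<close>

lemma unique_extension:
  assumes lim: "is_ab_direct_limit U I r G t K lam"
    and H: "comm_group H" "carrier H \<prec> U"
    and f: "f \<in> hom K H" and g: "g \<in> hom K H"
    and eq: "\<And>i x. i \<in> I \<Longrightarrow> x \<in> carrier (G i) \<Longrightarrow> f (lam i x) = g (lam i x)"
    and x: "x \<in> carrier K"
  shows "f x = g x"
proof -
  obtain H' :: "'u monoid" and h where H': "comm_group H'" "carrier H' \<prec> U" and h: "h \<in> hom H H'"
      "inj_on h (carrier H)"
    using iso_group_on_small_set[OF H] by blast
  have coc: "ab_cocone I r G t K lam" and K: "comm_group K"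
    using lim by (auto simp: is_ab_direct_limit_def)
  have lam: "lam i \<in> hom (G i) K" if "i \<in> I" for i
    using coc that by (simp add: ab_cocone_def)
  let ?f = "restrict (h \<circ> f) (carrier K)" and ?g = "restrict (h \<circ> g) (carrier K)"
  have hom: "?f \<in> hom K H' \<inter> extensional (carrier K)" "?g \<in> hom K H' \<inter> extensional (carrier K)"
    using hom_compose[OF f h(1)] hom_compose[OF g h(1)] K
    by (auto simp: hom_def comm_group_def group_def monoid.m_closed)
  have lamC: "lam i x \<in> carrier K" if "i \<in> I" "x \<in> carrier (G i)" for i x
    using lam that by (meson hom_in_carrier)
  define \<mu> where "\<mu> i x = h (f (lam i x))" for i x
  have "ab_cocone I r G t H' \<mu>"
  proof -
    have "\<mu> i \<in> hom (G i) H'" if "i \<in> I" for i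
      using hom_compose[OF hom_compose[OF lam[OF that] f] h(1)] by (simp add: \<mu>_def[abs_def] comp_def)
    then show ?thesis using coc by (force simp: ab_cocone_def \<mu>_def)
  qed
  then have "\<exists>!k. k \<in> hom K H' \<inter> extensional (carrier K) \<and>
      (\<forall>i\<in>I. \<forall>x\<in>carrier (G i). k (lam i x) = \<mu> i x)"
    using lim H' unfolding is_ab_direct_limit_def by blast
  moreover have "\<forall>i\<in>I. \<forall>x\<in>carrier (G i). ?f (lam i x) = \<mu> i x"
    "\<forall>i\<in>I. \<forall>x\<in>carrier (G i). ?g (lam i x) = \<mu> i x"
    using eq lamC by (auto simp: \<mu>_def)
  ultimately have "?f = ?g" using hom by blast
  then have "h (f x) = h (g x)" using x by (metis comp_apply restrict_apply')
  then show ?thesis using h(2) f g x by (meson hom_in_carrier inj_onD)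
qed

text \<open>By directedness the images of the stages form a subgroup \<open>S\<close>. The
  projection onto \<open>K Mod S\<close> and the trivial map agree on all stages, hence on
  \<open>K\<close> by uniqueness, which puts every element of \<open>K\<close> into
  \<open>S\<close>.\<close>

lemma ab_direct_limit_surj:
  assumes lim: "is_ab_direct_limit U I r G t K lam" and small: "carrier K \<prec> U"
    and x: "x \<in> carrier K"
  obtains i y where "i \<in> I" "y \<in> carrier (G i)" "x = lam i y"
proof -
  have coc: "ab_cocone I r G t K lam" using lim by (simp add: is_ab_direct_limit_def)
  interpret K: comm_group K using lim by (simp add: is_ab_direct_limit_def)
  have lam: "lam i \<in> hom (G i) K" if "i \<in> I" for i
    using coc that by (simp add: ab_cocone_def)
  have lam_t: "lam j (t (i, j) x) = lam i x" if "(i, j) \<in> r" "x \<in> carrier (G i)" for i j x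
    using coc that by (auto simp: ab_cocone_def)
  define S where "S = (\<Union>i\<in>I. lam i ` carrier (G i))"
  have sub: "subgroup S K"
  proof (rule K.subgroupI)
    show "S \<subseteq> carrier K" using lam by (auto simp: S_def hom_def)
    obtain i where i: "i \<in> I" using directed by (auto simp: directed_poset_def)
    interpret group "G i" using group_G i by simp
    show "S \<noteq> {}" using i by (auto simp: S_def)
  next
    fix a assume "a \<in> S"
    then obtain i x where ix: "i \<in> I" "x \<in> carrier (G i)" "a = lam i x" by (auto simp: S_def)
    interpret h: group_hom "G i" K "lam i"
      using ix lam group_G by (simp add: group_hom.intro group_hom_axioms_def)
    have "inv\<^bsub>K\<^esub> a = lam i (inv\<^bsub>G i\<^esub> x)" using ix by simp
    moreover have "inv\<^bsub>G i\<^esub> x \<in> carrier (G i)" using ix by simp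
    ultimately show "inv\<^bsub>K\<^esub> a \<in> S" using ix(1) unfolding S_def by blast
  next
    fix a b assume "a \<in> S" "b \<in> S"
    then obtain i x j y where xy: "i \<in> I" "x \<in> carrier (G i)" "a = lam i x"
        "j \<in> I" "y \<in> carrier (G j)" "b = lam j y" by (auto simp: S_def)
    obtain k where k: "k \<in> I" "(i, k) \<in> r" "(j, k) \<in> r"
      using directed_poset_bound2[OF directed] xy by metis
    interpret h: group_hom "G k" K "lam k"
      using k lam group_G by (simp add: group_hom.intro group_hom_axioms_def)
    have "a \<otimes>\<^bsub>K\<^esub> b = lam k (t (i, k) x \<otimes>\<^bsub>G k\<^esub> t (j, k) y)"
      using xy k lam_t t_carrier by simp
    moreover have "t (i, k) x \<otimes>\<^bsub>G k\<^esub> t (j, k) y \<in> carrier (G k)"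
      using xy k t_carrier by simp
    ultimately show "a \<otimes>\<^bsub>K\<^esub> b \<in> S" using k(1) unfolding S_def by blast
  qed
  interpret N: normal S K using K.subgroup_imp_normal[OF sub] .
  have Q: "comm_group (K Mod S)" using K.abelian_FactGroup sub by simp
  have smallQ: "carrier (K Mod S) \<prec> U" using small small_image by (metis carrier_FactGroup)
  have hom1: "(\<lambda>a. S #>\<^bsub>K\<^esub> a) \<in> hom K (K Mod S)" by (rule N.r_coset_hom_Mod)
  have hom2: "(\<lambda>a. \<one>\<^bsub>K Mod S\<^esub>) \<in> hom K (K Mod S)"
    using Q by (auto simp: hom_def comm_group_def group.is_monoid monoid.one_closed simp del: one_FactGroup mult_FactGroup)
  have "S #>\<^bsub>K\<^esub> x = \<one>\<^bsub>K Mod S\<^esub>"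
  proof (rule unique_extension[OF lim Q smallQ hom1 hom2 _ x])
    fix i y assume iy: "i \<in> I" "y \<in> carrier (G i)"
    then have "lam i y \<in> S" by (auto simp: S_def)
    then show "S #>\<^bsub>K\<^esub> lam i y = \<one>\<^bsub>K Mod S\<^esub>"
      using sub by (simp add: subgroup.rcos_const K.is_group)
  qed
  then have "x \<in> S" using x sub K.rcos_self by fastforce
  then show ?thesis using that by (auto simp: S_def)
qed

text \<open>An element that never dies has nonzero image in the group of germs at infinity, that is
  the product of all groups modulo the families that are eventually trivial.\<close>
lemma ab_direct_limit_kernel:
  assumes lim: "is_ab_direct_limit U I r G t K lam"
    and i: "i \<in> I" and x: "x \<in> carrier (G i)" and zero: "lam i x = \<one>\<^bsub>K\<^esub>"
  obtains j where "(i, j) \<in> r" "t (i, j) x = \<one>\<^bsub>G j\<^esub>"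
proof -
  have t_one: "t (i, j) \<one>\<^bsub>G i\<^esub> = \<one>\<^bsub>G j\<^esub>" if "(i, j) \<in> r" for i j
    using that t_hom group_G directed_poset_subset[OF directed] by (meson hom_one mem_Sigma_iff subsetD)
  interpret K: comm_group K using lim by (simp add: is_ab_direct_limit_def)
  define P where "P = product_group I G"
  interpret P: group P unfolding P_def by (simp add: group_G)
  have Pcomm: "comm_group P"
  proof (rule P.group_comm_groupI)
    fix x y assume xy: "x \<in> carrier P" "y \<in> carrier P"
    have "x i \<otimes>\<^bsub>G i\<^esub> y i = y i \<otimes>\<^bsub>G i\<^esub> x i" if "i \<in> I" for i
      using xy that comm_groupE(4)[OF comm_group_G[OF that]] by (auto simp: P_def)
    then show "x \<otimes>\<^bsub>P\<^esub> y = y \<otimes>\<^bsub>P\<^esub> x" by (auto simp: P_def intro: restrict_ext)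
  qed
  interpret P: comm_group P by fact
  define E where "E = {f \<in> carrier P. \<exists>k\<in>I. \<forall>l. (k, l) \<in> r \<longrightarrow> f l = \<one>\<^bsub>G l\<^esub>}"
  have rI: "l \<in> I" if "(k, l) \<in> r" for k l using that directed_poset_subset[OF directed] by blast
  have sub: "subgroup E P"
  proof (rule P.subgroupI)
    show "E \<subseteq> carrier P" by (auto simp: E_def)
    have "\<one>\<^bsub>P\<^esub> \<in> E" using i rI P.one_closed unfolding E_def by (auto simp: P_def)
    then show "E \<noteq> {}" by blast
  next
    fix a assume a: "a \<in> E"
    then obtain k where k: "k \<in> I" "\<forall>m. (k, m) \<in> r \<longrightarrow> a m = \<one>\<^bsub>G m\<^esub>" and aP: "a \<in> carrier P"
      by (auto simp: E_def)
    have "(inv\<^bsub>P\<^esub> a) m = \<one>\<^bsub>G m\<^esub>" if "(k, m) \<in> r" for m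
      using k that aP rI[OF that] group_G monoid.inv_one[OF group.is_monoid[OF group_G]]
      by (simp add: P_def)
    then show "inv\<^bsub>P\<^esub> a \<in> E" using k(1) aP by (auto simp: E_def)
  next
    fix a b assume a: "a \<in> E" and b: "b \<in> E"
    then obtain k l where k: "k \<in> I" "\<forall>m. (k, m) \<in> r \<longrightarrow> a m = \<one>\<^bsub>G m\<^esub>"
      and l: "l \<in> I" "\<forall>m. (l, m) \<in> r \<longrightarrow> b m = \<one>\<^bsub>G m\<^esub>" by (auto simp: E_def)
    obtain n where n: "n \<in> I" "(k, n) \<in> r" "(l, n) \<in> r"
      using directed_poset_bound2[OF directed] k l by metis
    have "(a \<otimes>\<^bsub>P\<^esub> b) m = \<one>\<^bsub>G m\<^esub>" if "(n, m) \<in> r" for m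
    proof -
      have m: "m \<in> I" using rI that .
      then interpret group "G m" using group_G by simp
      have "a m = \<one>\<^bsub>G m\<^esub>" "b m = \<one>\<^bsub>G m\<^esub>"
        using k l n that directed_poset_trans[OF directed] by blast+
      then show ?thesis using m by (simp add: P_def)
    qed
    then show "a \<otimes>\<^bsub>P\<^esub> b \<in> E" using a b n(1) by (auto simp: E_def)
  qed
  interpret N: normal E P using P.subgroup_imp_normal[OF sub] .
  have Q: "comm_group (P Mod E)" using P.abelian_FactGroup sub by simp
  have "carrier P \<prec> U" unfolding P_def carrier_product_group
    by (rule small_PiE[OF directed_poset_small[OF directed] small_G])
  then have smallQ: "carrier (P Mod E) \<prec> U" using small_image by (metis carrier_FactGroup)
  obtain H :: "'u monoid" and h where H: "comm_group H" "carrier H \<prec> U" and h: "h \<in> hom (P Mod E) H"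
      "inj_on h (carrier (P Mod E))"
    using iso_group_on_small_set[OF Q smallQ] by blast
  interpret h: group_hom "P Mod E" H h
    using h Q H by (simp add: group_hom.intro group_hom_axioms_def comm_group_def)
  \<comment> \<open>The element \<open>x\<close> is carried to all stages above \<open>i\<close> and
    replaced by the unit elsewhere. Modulo \<open>E\<close> only the tail of the family counts, so
    this becomes a cocone.\<close>
  define s where "s i x = (\<lambda>j\<in>I. if (i, j) \<in> r then t (i, j) x else \<one>\<^bsub>G j\<^esub>)" for i x
  have s_carrier: "s i x \<in> carrier P" if "x \<in> carrier (G i)" for i x
    using that t_carrier group_G group.is_monoid monoid.one_closed by (force simp: s_def P_def)
  have s_hom: "s i \<in> hom (G i) P" if "i \<in> I" for i
  proof (rule homI)
    fix x y assume xy: "x \<in> carrier (G i)" "y \<in> carrier (G i)"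
    show "s i (x \<otimes>\<^bsub>G i\<^esub> y) = s i x \<otimes>\<^bsub>P\<^esub> s i y"
    proof -
      have "(if (i, j) \<in> r then t (i, j) (x \<otimes>\<^bsub>G i\<^esub> y) else \<one>\<^bsub>G j\<^esub>) =
          (if (i, j) \<in> r then t (i, j) x else \<one>\<^bsub>G j\<^esub>) \<otimes>\<^bsub>G j\<^esub> (if (i, j) \<in> r then t (i, j) y else \<one>\<^bsub>G j\<^esub>)"
        if "j \<in> I" for j
        using hom_mult[OF t_hom xy] group.is_monoid[OF group_G[OF that]]
        by (auto simp: monoid.l_one monoid.one_closed)
      then show ?thesis by (auto simp: s_def P_def intro!: restrict_ext)
    qed
  qed (rule s_carrier)
  define \<mu> where "\<mu> i x = h (E #>\<^bsub>P\<^esub> s i x)" for i x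
  have mu_hom: "\<mu> i \<in> hom (G i) H" if "i \<in> I" for i
    using hom_compose[OF hom_compose[OF s_hom[OF that] N.r_coset_hom_Mod] h(1)]
    by (simp add: \<mu>_def[abs_def] comp_def)
  have mu_t: "\<mu> j (t (i, j) x) = \<mu> i x" if ij: "(i, j) \<in> r" and x: "x \<in> carrier (G i)" for i j x
  proof -
    \<comment> \<open>From stage \<open>j\<close> on, both families consist of the images of
      \<open>x\<close>, so their quotient is eventually trivial.\<close>
    have "s i x \<otimes>\<^bsub>P\<^esub> inv\<^bsub>P\<^esub> (s j (t (i, j) x)) \<in> E"
    proof -
      have jI: "j \<in> I" using rI ij by blast
      have c: "s i x \<in> carrier P" "s j (t (i, j) x) \<in> carrier P"
        using s_carrier t_carrier[OF ij x] x by auto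
      have "(s i x \<otimes>\<^bsub>P\<^esub> inv\<^bsub>P\<^esub> (s j (t (i, j) x))) k = \<one>\<^bsub>G k\<^esub>" if jk: "(j, k) \<in> r" for k
      proof -
        have k: "k \<in> I" using rI jk by blast
        have ik: "(i, k) \<in> r" using directed_poset_trans[OF directed ij jk] .
        show ?thesis
          using c k ik jk t_carrier[OF ik x] group.r_inv[OF group_G[OF k]] t_comp[OF ij jk x] group_G
          by (simp add: P_def s_def)
      qed
      moreover have "s i x \<otimes>\<^bsub>P\<^esub> inv\<^bsub>P\<^esub> (s j (t (i, j) x)) \<in> carrier P" using c by simp
      ultimately show ?thesis using jI unfolding E_def by blast
    qed
    then have "s i x \<in> E #>\<^bsub>P\<^esub> s j (t (i, j) x)"
      using s_carrier t_carrier[OF ij x] x N.rcos_module[OF P.is_group] by blast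
    then have "E #>\<^bsub>P\<^esub> s i x = E #>\<^bsub>P\<^esub> s j (t (i, j) x)"
      using P.repr_independence s_carrier t_carrier[OF ij x] sub by metis
    then show ?thesis by (simp add: \<mu>_def)
  qed
  have "ab_cocone I r G t H \<mu>"
    using mu_hom mu_t by (auto simp: ab_cocone_def)
  then obtain k where k: "k \<in> hom K H" "\<And>i x. i \<in> I \<Longrightarrow> x \<in> carrier (G i) \<Longrightarrow> k (lam i x) = \<mu> i x"
    using lim H unfolding is_ab_direct_limit_def by blast
  have "h (E #>\<^bsub>P\<^esub> s i x) = \<one>\<^bsub>H\<^esub>"
    using k(2)[OF i x] zero k(1) H K.is_group by (simp add: \<mu>_def hom_one comm_group_def)
  moreover have "E #>\<^bsub>P\<^esub> s i x \<in> carrier (P Mod E)"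
    using s_carrier[OF x] by (simp add: carrier_FactGroup)
  moreover have "h \<one>\<^bsub>P Mod E\<^esub> = \<one>\<^bsub>H\<^esub>" using h.hom_one .
  ultimately have "E #>\<^bsub>P\<^esub> s i x = E"
    using h(2) by (metis h.G.one_closed inj_onD one_FactGroup)
  then have "s i x \<in> E" using s_carrier[OF x] sub P.rcos_self by fastforce
  then obtain k where k: "k \<in> I" "\<And>l. (k, l) \<in> r \<Longrightarrow> s i x l = \<one>\<^bsub>G l\<^esub>"
    unfolding E_def by blast
  obtain l where l: "l \<in> I" "(i, l) \<in> r" "(k, l) \<in> r"
    using directed_poset_bound2[OF directed] k(1) i by metis
  then have "t (i, l) x = \<one>\<^bsub>G l\<^esub>" using k(2)[of l] by (simp add: s_def)
  then show ?thesis using that l(2) by blast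
qed

text \<open>The induced map is forced, since every element of \<open>K\<close> comes from a stage.
  It is well defined: two representatives can be compared at a common stage, where their quotient
  lies in the kernel of \<open>lam\<close> and so dies further on, whence \<open>\<mu>\<close>
  cannot separate them.\<close>

lemma ab_direct_limitI:
  assumes K: "comm_group K" and coc: "ab_cocone I r G t K lam"
    and surj: "\<And>x. x \<in> carrier K \<Longrightarrow> \<exists>i\<in>I. \<exists>y\<in>carrier (G i). x = lam i y"
    and ker: "\<And>i x. i \<in> I \<Longrightarrow> x \<in> carrier (G i) \<Longrightarrow> lam i x = \<one>\<^bsub>K\<^esub> \<Longrightarrow> \<exists>j. (i, j) \<in> r \<and> t (i, j) x = \<one>\<^bsub>G j\<^esub>"
  shows "is_ab_direct_limit U I r G t K lam"
  unfolding is_ab_direct_limit_def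
proof (intro conjI allI impI K coc)
  fix H :: "'u monoid" and \<mu>
  assume as: "comm_group H \<and> carrier H \<prec> U \<and> ab_cocone I r G t H \<mu>"
  interpret K: comm_group K by fact
  interpret H: comm_group H using as by simp
  have lam: "lam i \<in> hom (G i) K" if "i \<in> I" for i
    using coc that by (simp add: ab_cocone_def)
  have lam_t: "lam j (t (i, j) x) = lam i x" if "(i, j) \<in> r" "x \<in> carrier (G i)" for i j x
    using coc that by (auto simp: ab_cocone_def)
  have mu: "\<mu> i \<in> hom (G i) H" if "i \<in> I" for i
    using as that by (simp add: ab_cocone_def)
  have mu_t: "\<mu> j (t (i, j) x) = \<mu> i x" if "(i, j) \<in> r" "x \<in> carrier (G i)" for i j x
    using as that by (auto simp: ab_cocone_def)
  have rI: "k \<in> I" if "(j, k) \<in> r" for j k using that directed_poset_subset[OF directed] by blast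
  have gh: "group_hom (G i) K (lam i)" "group_hom (G i) H (\<mu> i)" if "i \<in> I" for i
    using that lam mu group_G by (auto simp: group_hom.intro group_hom_axioms_def)
  have same: "\<mu> i x = \<mu> i y" if i: "i \<in> I" and xy: "x \<in> carrier (G i)" "y \<in> carrier (G i)"
    and eq: "lam i x = lam i y" for i x y
  proof -
    interpret l: group_hom "G i" K "lam i" using gh i by simp
    interpret m: group_hom "G i" H "\<mu> i" using gh i by simp
    let ?z = "x \<otimes>\<^bsub>G i\<^esub> inv\<^bsub>G i\<^esub> y"
    have "lam i ?z = \<one>\<^bsub>K\<^esub>" using xy eq by simp
    moreover have z: "?z \<in> carrier (G i)" using xy by simp
    ultimately obtain j where j: "(i, j) \<in> r" "t (i, j) ?z = \<one>\<^bsub>G j\<^esub>" using ker i by blast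
    interpret mj: group_hom "G j" H "\<mu> j" using gh j rI by blast
    have "\<mu> i ?z = \<one>\<^bsub>H\<^esub>" using mu_t[OF j(1) z] j(2) by simp
    then have "\<mu> i x \<otimes>\<^bsub>H\<^esub> inv\<^bsub>H\<^esub> (\<mu> i y) = \<one>\<^bsub>H\<^esub>" using xy by simp
    then have "inv\<^bsub>H\<^esub> (inv\<^bsub>H\<^esub> (\<mu> i y)) = \<mu> i x" using xy by (intro H.inv_equality) auto
    then show ?thesis using xy by simp
  qed
  have same2: "\<mu> i x = \<mu> j y" if ij: "i \<in> I" "x \<in> carrier (G i)" "j \<in> I" "y \<in> carrier (G j)"
    and eq: "lam i x = lam j y" for i x j y
  proof -
    obtain k where k: "k \<in> I" "(i, k) \<in> r" "(j, k) \<in> r"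
      using directed_poset_bound2[OF directed] ij by metis
    have "lam k (t (i, k) x) = lam k (t (j, k) y)" using that k lam_t by simp
    then have "\<mu> k (t (i, k) x) = \<mu> k (t (j, k) y)" using same k that t_carrier by blast
    then show ?thesis using mu_t that k by simp
  qed
  have "\<forall>x. \<exists>v. x \<in> carrier K \<longrightarrow> (\<forall>i\<in>I. \<forall>y\<in>carrier (G i). x = lam i y \<longrightarrow> \<mu> i y = v)"
    using surj same2 by metis
  then obtain h0 where h0: "\<And>x i y. x \<in> carrier K \<Longrightarrow> i \<in> I \<Longrightarrow> y \<in> carrier (G i) \<Longrightarrow> x = lam i y \<Longrightarrow> \<mu> i y = h0 x"
    by metis
  have lamC: "lam i x \<in> carrier K" if "i \<in> I" "x \<in> carrier (G i)" for i x
    using lam that by (meson hom_in_carrier)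
  define h where "h = restrict h0 (carrier K)"
  have h: "h (lam i x) = \<mu> i x" if "i \<in> I" "x \<in> carrier (G i)" for i x
    using h0 lamC that by (simp add: h_def)
  have "h \<in> hom K H"
  proof (rule homI)
    fix x assume "x \<in> carrier K"
    then obtain i y where "i \<in> I" "y \<in> carrier (G i)" "x = lam i y" using surj by blast
    then show "h x \<in> carrier H" using h mu by (metis hom_in_carrier)
  next
    fix x y assume "x \<in> carrier K" "y \<in> carrier K"
    then obtain i a j b where ab: "i \<in> I" "a \<in> carrier (G i)" "x = lam i a"
      "j \<in> I" "b \<in> carrier (G j)" "y = lam j b" using surj by metis
    obtain k where k: "k \<in> I" "(i, k) \<in> r" "(j, k) \<in> r"
      using directed_poset_bound2[OF directed] ab by metis
    interpret l: group_hom "G k" K "lam k" using gh k by simp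
    interpret m: group_hom "G k" H "\<mu> k" using gh k by simp
    have xy: "x = lam k (t (i, k) a)" "y = lam k (t (j, k) b)" using ab k lam_t by auto
    have c: "t (i, k) a \<in> carrier (G k)" "t (j, k) b \<in> carrier (G k)" using ab k t_carrier by auto
    have "h (x \<otimes>\<^bsub>K\<^esub> y) = h (lam k (t (i, k) a \<otimes>\<^bsub>G k\<^esub> t (j, k) b))" using xy c by simp
    also have "\<dots> = h x \<otimes>\<^bsub>H\<^esub> h y" using xy c k by (simp add: h del: l.hom_mult)
    finally show "h (x \<otimes>\<^bsub>K\<^esub> y) = h x \<otimes>\<^bsub>H\<^esub> h y" .
  qed
  then have hK: "h \<in> hom K H \<inter> extensional (carrier K)" by (simp add: h_def)
  have uniq: "k = h" if "k \<in> hom K H \<inter> extensional (carrier K)"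
      "\<forall>i\<in>I. \<forall>x\<in>carrier (G i). k (lam i x) = \<mu> i x" for k
  proof (rule extensionalityI)
    show "k x = h x" if "x \<in> carrier K" for x
      using surj[OF that] h \<open>\<forall>i\<in>I. \<forall>x\<in>carrier (G i). k (lam i x) = \<mu> i x\<close> by auto
  qed (use that in \<open>auto simp: h_def\<close>)
  show "\<exists>!h. h \<in> hom K H \<inter> extensional (carrier K) \<and>
      (\<forall>i\<in>I. \<forall>x\<in>carrier (G i). h (lam i x) = \<mu> i x)"
    using hK h by (intro ex1I[of _ h] conjI ballI) (simp_all add: uniq)
qed

end

section \<open>Direct systems and their limits\<close>

lemma ex1_eqI: "\<exists>!x. P x \<Longrightarrow> P a \<Longrightarrow> P b \<Longrightarrow> a = b"
  by blast

lemma direct_systemI: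
  assumes "directed_poset U I r"
    and "\<And>i. i \<in> I \<Longrightarrow> omap D i \<in> Obj C"
    and "\<And>i j. (i, j) \<in> r \<Longrightarrow> amap D (i, j) \<in> Hom C (omap D i) (omap D j)"
    and "\<And>i. i \<in> I \<Longrightarrow> amap D (i, i) = Ide C (omap D i)"
    and "\<And>i j k. (i, j) \<in> r \<Longrightarrow> (j, k) \<in> r \<Longrightarrow> amap D (i, k) = amap D (j, k) \<cdot>\<^bsub>C\<^esub> amap D (i, j)"
  shows "direct_system U C I r D"
  using assms by (auto simp: direct_system_def is_functor_def poset_category_def)

context
  fixes U :: "'u set" and C :: "('o, 'm, 'x) precat_scheme" and I r D
  assumes ds: "direct_system U C I r D"
begin

lemma direct_system_directed: "directed_poset U I r"
  using ds by (simp add: direct_system_def)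

lemma direct_system_Obj: "i \<in> I \<Longrightarrow> omap D i \<in> Obj C"
  using ds by (simp add: direct_system_def is_functor_def poset_category_def)

lemma direct_system_map: "(i, j) \<in> r \<Longrightarrow> amap D (i, j) \<in> Hom C (omap D i) (omap D j)"
  using ds by (auto simp: direct_system_def is_functor_def poset_category_def)

lemma direct_system_Ide: "i \<in> I \<Longrightarrow> amap D (i, i) = Ide C (omap D i)"
  using ds by (simp add: direct_system_def is_functor_def poset_category_def)

lemma direct_system_comp:
  "(i, j) \<in> r \<Longrightarrow> (j, k) \<in> r \<Longrightarrow> amap D (j, k) \<cdot>\<^bsub>C\<^esub> amap D (i, j) = amap D (i, k)"
  using ds by (force simp: direct_system_def is_functor_def poset_category_def)

end

text \<open>This is \<open>is_cocone\<close> with the poset category unfolded, so that transition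
  maps are addressed by pairs of indices.\<close>

definition is_limit_cocone ::
  "('o, 'm, 'x) precat_scheme \<Rightarrow> 'u set \<Rightarrow> 'u rel \<Rightarrow> ('u, 'u \<times> 'u, 'o, 'm) cfunctor \<Rightarrow> 'o \<Rightarrow> ('u \<Rightarrow> 'm) \<Rightarrow> bool"
  where "is_limit_cocone C I r D L \<iota> \<longleftrightarrow> L \<in> Obj C \<and> (\<forall>i\<in>I. \<iota> i \<in> Hom C (omap D i) L) \<and>
    (\<forall>i j. (i, j) \<in> r \<longrightarrow> \<iota> j \<cdot>\<^bsub>C\<^esub> amap D (i, j) = \<iota> i)"

lemma is_cocone_poset: "is_cocone (poset_category I r) C D L \<iota> \<longleftrightarrow> is_limit_cocone C I r D L \<iota>"
  by (auto simp: is_cocone_def is_limit_cocone_def poset_category_def)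

lemma direct_limitI:
  assumes "is_limit_cocone C I r D L \<iota>"
    and "\<And>M \<mu>. is_limit_cocone C I r D M \<mu> \<Longrightarrow> \<exists>h. h \<in> Hom C L M \<and> (\<forall>i\<in>I. h \<cdot>\<^bsub>C\<^esub> \<iota> i = \<mu> i)"
    and "\<And>M h k. M \<in> Obj C \<Longrightarrow> h \<in> Hom C L M \<Longrightarrow> k \<in> Hom C L M \<Longrightarrow>
      (\<And>i. i \<in> I \<Longrightarrow> h \<cdot>\<^bsub>C\<^esub> \<iota> i = k \<cdot>\<^bsub>C\<^esub> \<iota> i) \<Longrightarrow> h = k"
  shows "is_direct_limit C I r D L \<iota>"
proof -
  have "\<exists>!h. h \<in> Hom C L M \<and> (\<forall>i\<in>I. h \<cdot>\<^bsub>C\<^esub> \<iota> i = \<mu> i)" if \<mu>: "is_limit_cocone C I r D M \<mu>" for M \<mu>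
  proof -
    obtain h where h: "h \<in> Hom C L M" "\<forall>i\<in>I. h \<cdot>\<^bsub>C\<^esub> \<iota> i = \<mu> i" using assms(2)[OF \<mu>] by blast
    have M: "M \<in> Obj C" using \<mu> by (simp add: is_limit_cocone_def)
    show ?thesis
    proof (rule ex1I[of _ h])
      show "k = h" if "k \<in> Hom C L M \<and> (\<forall>i\<in>I. k \<cdot>\<^bsub>C\<^esub> \<iota> i = \<mu> i)" for k
        using assms(3)[OF M, of k h] h that by simp
    qed (use h in blast)
  qed
  then show ?thesis using assms(1)
    by (simp add: is_direct_limit_def is_colimit_def is_cocone_poset) (simp add: poset_category_def)
qed

context
  fixes C :: "('o, 'm, 'x) precat_scheme" and I r D L \<iota>
  assumes dl: "is_direct_limit C I r D L \<iota>"
begin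

lemma direct_limit_cocone: "is_limit_cocone C I r D L \<iota>"
  using dl by (simp add: is_direct_limit_def is_colimit_def is_cocone_poset)

lemma direct_limit_Obj: "L \<in> Obj C"
  using direct_limit_cocone by (simp add: is_limit_cocone_def)

lemma direct_limit_map: "i \<in> I \<Longrightarrow> \<iota> i \<in> Hom C (omap D i) L"
  using direct_limit_cocone by (simp add: is_limit_cocone_def)

lemma direct_limit_comp: "(i, j) \<in> r \<Longrightarrow> \<iota> j \<cdot>\<^bsub>C\<^esub> amap D (i, j) = \<iota> i"
  using direct_limit_cocone by (simp add: is_limit_cocone_def)

lemma direct_limit_factor:
  assumes "is_limit_cocone C I r D M \<mu>"
  obtains h where "h \<in> Hom C L M" "\<And>i. i \<in> I \<Longrightarrow> h \<cdot>\<^bsub>C\<^esub> \<iota> i = \<mu> i"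
proof -
  have "\<exists>!h. h \<in> Hom C L M \<and> (\<forall>i\<in>Obj (poset_category I r). h \<cdot>\<^bsub>C\<^esub> \<iota> i = \<mu> i)"
    using dl assms unfolding is_direct_limit_def is_colimit_def is_cocone_poset by blast
  then show ?thesis using that by (auto simp: poset_category_def)
qed

end

section \<open>Calculus of arrows in a preadditive category\<close>

locale preadditive = universe U for U :: "'u set" +
  fixes C :: "('o, 'm, 'x) addcat_scheme" (structure)
  assumes preadditive: "preadditive_category U C"
begin

lemma category: "category C"
  using preadditive by (simp add: preadditive_category_def)

lemma Dom_Obj [simp]: "f \<in> Arr C \<Longrightarrow> Dom C f \<in> Obj C"
  and Cod_Obj [simp]: "f \<in> Arr C \<Longrightarrow> Cod C f \<in> Obj C"
  using category by (auto simp: category_def)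

lemma Ide_Hom: "X \<in> Obj C \<Longrightarrow> Ide C X \<in> Hom C X X"
  using category by (auto simp: category_def)

lemma Ide_simps [simp]:
  assumes "X \<in> Obj C"
  shows "Ide C X \<in> Arr C" "Dom C (Ide C X) = X" "Cod C (Ide C X) = X"
  using Ide_Hom[OF assms] by (auto simp: Hom_def)

lemma comp_simps [simp]:
  assumes "f \<in> Arr C" "g \<in> Arr C" "Cod C f = Dom C g"
  shows "g \<cdot> f \<in> Arr C" "Dom C (g \<cdot> f) = Dom C f" "Cod C (g \<cdot> f) = Cod C g"
proof -
  have "g \<cdot> f \<in> Hom C (Dom C f) (Cod C g)" using category assms unfolding category_def by blast
  then show "g \<cdot> f \<in> Arr C" "Dom C (g \<cdot> f) = Dom C f" "Cod C (g \<cdot> f) = Cod C g"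
    by (auto simp: Hom_def)
qed

lemma comp_Ide [simp]: "f \<in> Arr C \<Longrightarrow> Dom C f = X \<Longrightarrow> f \<cdot> Ide C X = f"
  and Ide_comp [simp]: "f \<in> Arr C \<Longrightarrow> Cod C f = X \<Longrightarrow> Ide C X \<cdot> f = f"
  using category by (auto simp: category_def)

lemma comp_assoc [simp]:
  assumes "f \<in> Arr C" "g \<in> Arr C" "h \<in> Arr C" "Cod C f = Dom C g" "Cod C g = Dom C h"
  shows "(h \<cdot> g) \<cdot> f = h \<cdot> (g \<cdot> f)"
  using category assms unfolding category_def by (metis (no_types, lifting))

lemma HomD:
  assumes "f \<in> Hom C X Y" shows "f \<in> Arr C" "Dom C f = X" "Cod C f = Y" "X \<in> Obj C" "Y \<in> Obj C"
  using assms by (auto simp: Hom_def)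

lemma comp_Hom [intro]: "f \<in> Hom C X Y \<Longrightarrow> g \<in> Hom C Y Z \<Longrightarrow> g \<cdot> f \<in> Hom C X Z"
  by (auto simp: Hom_def)

lemma assoc: "f \<in> Hom C W X \<Longrightarrow> g \<in> Hom C X Y \<Longrightarrow> h \<in> Hom C Y Z \<Longrightarrow> (h \<cdot> g) \<cdot> f = h \<cdot> (g \<cdot> f)"
  by (auto simp: Hom_def)

lemma Hom_Ide: "f \<in> Hom C X Y \<Longrightarrow> f \<cdot> Ide C X = f" "f \<in> Hom C X Y \<Longrightarrow> Ide C Y \<cdot> f = f"
  by (auto simp: Hom_def)

text \<open>Applies a known equation \<open>g \<cdot> f = k\<close> at the head of a composite that
  is associated to the right. This is how commuting triangles are used in the diagram chases
  below.\<close>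

lemma comp_reduce:
  assumes "g \<cdot> f = k" "f \<in> Hom C X Y" "g \<in> Hom C Y Z" "x \<in> Hom C W X"
  shows "g \<cdot> (f \<cdot> x) = k \<cdot> x"
  using assms(1) assoc[OF assms(4,2,3)] by simp

lemma small_Hom: "X \<in> Obj C \<Longrightarrow> Y \<in> Obj C \<Longrightarrow> Hom C X Y \<prec> U"
  using preadditive by (simp add: preadditive_category_def locally_small_def)

lemma hom_comm_group: "X \<in> Obj C \<Longrightarrow> Y \<in> Obj C \<Longrightarrow> comm_group (hom_group C X Y)"
  using preadditive by (simp add: preadditive_category_def)

lemma hom_group_simps [simp]:
  "carrier (hom_group C X Y) = Hom C X Y" "\<one>\<^bsub>hom_group C X Y\<^esub> = Zero C X Y"
  "f \<otimes>\<^bsub>hom_group C X Y\<^esub> g = f \<boxplus> g"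
  by (auto simp: hom_group_def)

lemma Add_Hom: "f \<in> Hom C X Y \<Longrightarrow> g \<in> Hom C X Y \<Longrightarrow> f \<boxplus> g \<in> Hom C X Y"
  using hom_comm_group[of X Y, THEN comm_groupE(1), of f g] by (auto dest: HomD)

lemma Zero_Hom: "X \<in> Obj C \<Longrightarrow> Y \<in> Obj C \<Longrightarrow> Zero C X Y \<in> Hom C X Y"
  using hom_comm_group[of X Y, THEN comm_groupE(2)] by (auto dest: HomD)

lemma Zero_simps [simp]:
  assumes "X \<in> Obj C" "Y \<in> Obj C"
  shows "Zero C X Y \<in> Arr C" "Dom C (Zero C X Y) = X" "Cod C (Zero C X Y) = Y"
  using Zero_Hom[OF assms] by (auto simp: Hom_def)

lemma Add_comp:
  "f \<in> Hom C X Y \<Longrightarrow> g \<in> Hom C Y Z \<Longrightarrow> h \<in> Hom C Y Z \<Longrightarrow> (g \<boxplus> h) \<cdot> f = g \<cdot> f \<boxplus> h \<cdot> f"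
  using preadditive unfolding preadditive_category_def by (meson HomD)

lemma comp_Add:
  "f \<in> Hom C X Y \<Longrightarrow> g \<in> Hom C X Y \<Longrightarrow> h \<in> Hom C Y Z \<Longrightarrow> h \<cdot> (f \<boxplus> g) = h \<cdot> f \<boxplus> h \<cdot> g"
  using preadditive unfolding preadditive_category_def by (meson HomD)

lemma comp_hom_group:
  assumes "f \<in> Hom C X Y" "Z \<in> Obj C"
  shows "(\<lambda>g. g \<cdot> f) \<in> hom (hom_group C Y Z) (hom_group C X Z)"
    and "(\<lambda>g. f \<cdot> g) \<in> hom (hom_group C Z X) (hom_group C Z Y)"
  using assms comp_Hom[OF assms(1)] by (auto simp: hom_def Add_comp comp_Add)

lemma comp_group_hom:
  assumes "f \<in> Hom C X Y" "Z \<in> Obj C"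
  shows "group_hom (hom_group C Y Z) (hom_group C X Z) (\<lambda>g. g \<cdot> f)"
    and "group_hom (hom_group C Z X) (hom_group C Z Y) (\<lambda>g. f \<cdot> g)"
  using comp_hom_group[OF assms] hom_comm_group HomD[OF assms(1)] assms(2)
  by (auto simp: group_hom.intro group_hom_axioms_def comm_group_def)

lemma Zero_comp: "f \<in> Hom C X Y \<Longrightarrow> Z \<in> Obj C \<Longrightarrow> Zero C Y Z \<cdot> f = Zero C X Z"
  using group_hom.hom_one[OF comp_group_hom(1)] by simp

lemma comp_Zero: "f \<in> Hom C X Y \<Longrightarrow> Z \<in> Obj C \<Longrightarrow> f \<cdot> Zero C Z X = Zero C Z Y"
  using group_hom.hom_one[OF comp_group_hom(2)] by simp

text \<open>The inverse depends on the hom group. Reading that group off the first argument lets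
  subtraction be an infix without objects as parameters.\<close>

definition diff :: "'m \<Rightarrow> 'm \<Rightarrow> 'm" (infixl \<open>\<boxminus>\<close> 65)
  where "f \<boxminus> g = f \<boxplus> inv\<^bsub>hom_group C (Dom C f) (Cod C f)\<^esub> g"

lemma diff_eq: "f \<in> Hom C X Y \<Longrightarrow> f \<boxminus> g = f \<boxplus> inv\<^bsub>hom_group C X Y\<^esub> g"
  by (simp add: diff_def Hom_def)

lemma neg_Hom: "g \<in> Hom C X Y \<Longrightarrow> inv\<^bsub>hom_group C X Y\<^esub> g \<in> Hom C X Y"
  using group.inv_closed[OF comm_group.axioms(2)[OF hom_comm_group]] HomD by (metis hom_group_simps(1))

lemma diff_Hom: "f \<in> Hom C X Y \<Longrightarrow> g \<in> Hom C X Y \<Longrightarrow> f \<boxminus> g \<in> Hom C X Y"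
  by (simp add: diff_eq Add_Hom neg_Hom)

lemma diff_comp:
  assumes "f \<in> Hom C X Y" "g \<in> Hom C Y Z" "h \<in> Hom C Y Z"
  shows "(g \<boxminus> h) \<cdot> f = g \<cdot> f \<boxminus> h \<cdot> f"
proof -
  have "inv\<^bsub>hom_group C Y Z\<^esub> h \<cdot> f = inv\<^bsub>hom_group C X Z\<^esub> (h \<cdot> f)"
    using group_hom.hom_inv[OF comp_group_hom(1)[OF assms(1)], of Z h] assms by (auto dest: HomD)
  then show ?thesis
    using assms by (simp add: diff_eq[of _ Y Z] diff_eq[OF comp_Hom] Add_comp neg_Hom)
qed

lemma comp_diff:
  assumes "f \<in> Hom C X Y" "g \<in> Hom C X Y" "h \<in> Hom C Y Z"
  shows "h \<cdot> (f \<boxminus> g) = h \<cdot> f \<boxminus> h \<cdot> g"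
proof -
  have "h \<cdot> inv\<^bsub>hom_group C X Y\<^esub> g = inv\<^bsub>hom_group C X Z\<^esub> (h \<cdot> g)"
    using group_hom.hom_inv[OF comp_group_hom(2)[OF assms(3)], of X g] assms by (auto dest: HomD)
  then show ?thesis
    using assms by (simp add: diff_eq[of _ X Y] diff_eq[OF comp_Hom] comp_Add neg_Hom)
qed

lemma diff_eq_iff:
  assumes "f \<in> Hom C X Y" "g \<in> Hom C X Y" "h \<in> Hom C X Y"
  shows "f \<boxminus> g = h \<longleftrightarrow> f = h \<boxplus> g"
proof -
  interpret comm_group "hom_group C X Y" using hom_comm_group HomD[OF assms(1)] by simp
  show ?thesis using assms inv_solve_right[of h f g] by (auto simp: diff_eq)
qed

lemma Add_Zero:
  assumes "f \<in> Hom C X Y" shows "f \<boxplus> Zero C X Y = f" "Zero C X Y \<boxplus> f = f"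
proof -
  interpret comm_group "hom_group C X Y" using hom_comm_group HomD[OF assms(1)] by simp
  show "f \<boxplus> Zero C X Y = f" "Zero C X Y \<boxplus> f = f"
    using r_one[of f] l_one[of f] assms by simp_all
qed

lemma diff_eq_Zero:
  "f \<in> Hom C X Y \<Longrightarrow> g \<in> Hom C X Y \<Longrightarrow> f \<boxminus> g = Zero C X Y \<longleftrightarrow> f = g"
  by (simp add: diff_eq_iff Zero_Hom Add_Zero HomD)

lemma diff_self: "f \<in> Hom C X Y \<Longrightarrow> f \<boxminus> f = Zero C X Y"
  by (simp add: diff_eq_Zero)

lemma diff_Zero: "f \<in> Hom C X Y \<Longrightarrow> f \<boxminus> Zero C X Y = f"
  by (simp add: diff_eq_iff Zero_Hom Add_Zero HomD)

lemma isomorphicE: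
  assumes "isomorphic C X Y"
  obtains f g where "f \<in> Hom C X Y" "g \<in> Hom C Y X" "g \<cdot> f = Ide C X" "f \<cdot> g = Ide C Y"
  using assms by (auto simp: isomorphic_def)

lemma isomorphicI:
  "f \<in> Hom C X Y \<Longrightarrow> g \<in> Hom C Y X \<Longrightarrow> g \<cdot> f = Ide C X \<Longrightarrow> f \<cdot> g = Ide C Y \<Longrightarrow> isomorphic C X Y"
  by (auto simp: isomorphic_def dest: HomD)

lemma isomorphic_refl: "X \<in> Obj C \<Longrightarrow> isomorphic C X X"
  by (rule isomorphicI[OF Ide_Hom Ide_Hom]) auto

lemma isomorphic_sym: "isomorphic C X Y \<Longrightarrow> isomorphic C Y X"
  by (auto simp: isomorphic_def)

lemma isomorphic_trans:
  assumes "isomorphic C X Y" "isomorphic C Y Z" shows "isomorphic C X Z"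
proof -
  obtain f g where f: "f \<in> Hom C X Y" "g \<in> Hom C Y X" "g \<cdot> f = Ide C X" "f \<cdot> g = Ide C Y"
    using assms(1) by (rule isomorphicE)
  obtain h k where h: "h \<in> Hom C Y Z" "k \<in> Hom C Z Y" "k \<cdot> h = Ide C Y" "h \<cdot> k = Ide C Z"
    using assms(2) by (rule isomorphicE)
  have "k \<cdot> (h \<cdot> f) = f" "g \<cdot> (k \<cdot> h) = g"
    using comp_reduce[OF h(3) h(1) h(2) f(1)] h(3) f by (simp_all add: Hom_Ide)
  then have "(g \<cdot> k) \<cdot> (h \<cdot> f) = Ide C X"
    using f h assoc[OF comp_Hom[OF f(1) h(1)] h(2) f(2)] by simp
  moreover have "f \<cdot> (g \<cdot> k) = k"
    using comp_reduce[OF f(4) f(2) f(1) h(2)] h by (simp add: Hom_Ide)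
  then have "(h \<cdot> f) \<cdot> (g \<cdot> k) = Ide C Z"
    using f h assoc[OF comp_Hom[OF h(2) f(2)] f(1) h(1)] by simp
  ultimately show ?thesis using f h by (meson comp_Hom isomorphicI)
qed

lemma epi_cancel:
  assumes "epi_arr C e" "e \<in> Hom C X Y" "f \<in> Hom C Y Z" "g \<in> Hom C Y Z" "f \<cdot> e = g \<cdot> e"
  shows "f = g"
  using assms by (auto simp: epi_arr_def Hom_def)

lemma epi_arrI:
  assumes e: "e \<in> Hom C X Y"
    and *: "\<And>Z f g. f \<in> Hom C Y Z \<Longrightarrow> g \<in> Hom C Y Z \<Longrightarrow> f \<cdot> e = g \<cdot> e \<Longrightarrow> f = g"
  shows "epi_arr C e"
  using e by (auto simp: epi_arr_def Hom_def intro: *)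

lemma epi_arr_zeroI:
  assumes e: "e \<in> Hom C X Y"
    and *: "\<And>Z f. f \<in> Hom C Y Z \<Longrightarrow> f \<cdot> e = Zero C X Z \<Longrightarrow> f = Zero C Y Z"
  shows "epi_arr C e"
proof (rule epi_arrI[OF e])
  fix Z f g assume fg: "f \<in> Hom C Y Z" "g \<in> Hom C Y Z" "f \<cdot> e = g \<cdot> e"
  have "(f \<boxminus> g) \<cdot> e = Zero C X Z"
    using fg e by (simp add: diff_comp diff_self[OF comp_Hom])
  then show "f = g" using * fg by (metis diff_Hom diff_eq_Zero)
qed

lemma mono_arr_zeroI:
  assumes e: "e \<in> Hom C X Y"
    and *: "\<And>Z f. f \<in> Hom C Z X \<Longrightarrow> e \<cdot> f = Zero C Z Y \<Longrightarrow> f = Zero C Z X"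
  shows "mono_arr C e"
proof -
  have "f = g" if fg: "f \<in> Hom C Z X" "g \<in> Hom C Z X" "e \<cdot> f = e \<cdot> g" for Z f g
  proof -
    have "e \<cdot> (f \<boxminus> g) = Zero C Z Y"
      using fg e by (simp add: comp_diff diff_self[OF comp_Hom])
    then show ?thesis using * fg by (metis diff_Hom diff_eq_Zero)
  qed
  then show ?thesis using e by (auto simp: mono_arr_def Hom_def)
qed

section \<open>Universal properties of coproducts, cokernels, kernels and direct limits\<close>

lemma coproduct_universal:
  "is_coproduct C I F P \<iota> \<Longrightarrow> Q \<in> Obj C \<Longrightarrow> \<forall>i\<in>I. \<mu> i \<in> Hom C (F i) Q \<Longrightarrow>
    \<exists>!h. h \<in> Hom C P Q \<and> (\<forall>i\<in>I. h \<cdot> \<iota> i = \<mu> i)"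
  by (simp add: is_coproduct_def)

lemma coproduct_eqI:
  assumes "is_coproduct C I F P \<iota>" "f \<in> Hom C P Q" "g \<in> Hom C P Q"
    and "\<And>i. i \<in> I \<Longrightarrow> f \<cdot> \<iota> i = g \<cdot> \<iota> i"
  shows "f = g"
proof -
  have Q: "Q \<in> Obj C" using HomD(5)[OF assms(2)] .
  have \<iota>: "\<iota> i \<in> Hom C (F i) P" if "i \<in> I" for i using assms(1) that by (simp add: is_coproduct_def)
  have "\<forall>i\<in>I. g \<cdot> \<iota> i \<in> Hom C (F i) Q" using comp_Hom[OF \<iota> assms(3)] by blast
  then have "\<exists>!h. h \<in> Hom C P Q \<and> (\<forall>i\<in>I. h \<cdot> \<iota> i = g \<cdot> \<iota> i)"
    using coproduct_universal[OF assms(1) Q, of "\<lambda>i. g \<cdot> \<iota> i"] by simp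
  then show ?thesis by (rule ex1_eqI) (use assms(2-4) in simp_all)
qed

lemma coproduct_factor:
  assumes "is_coproduct C I F P \<iota>" "Q \<in> Obj C" "\<And>i. i \<in> I \<Longrightarrow> \<mu> i \<in> Hom C (F i) Q"
  obtains h where "h \<in> Hom C P Q" "\<And>i. i \<in> I \<Longrightarrow> h \<cdot> \<iota> i = \<mu> i"
proof -
  have "\<exists>!h. h \<in> Hom C P Q \<and> (\<forall>i\<in>I. h \<cdot> \<iota> i = \<mu> i)"
    using coproduct_universal[OF assms(1,2), of \<mu>] assms(3) by simp
  then show ?thesis using that by blast
qed

lemma coproduct_in: "is_coproduct C I F P \<iota> \<Longrightarrow> i \<in> I \<Longrightarrow> \<iota> i \<in> Hom C (F i) P"
  and coproduct_Obj: "is_coproduct C I F P \<iota> \<Longrightarrow> P \<in> Obj C"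
  by (auto simp: is_coproduct_def)

lemma cokernelD:
  assumes "is_cokernel C c f" "f \<in> Hom C X Y"
  shows "c \<in> Hom C Y (Cod C c)" "c \<cdot> f = Zero C X (Cod C c)"
  using assms by (auto simp: is_cokernel_def Hom_def)

lemma cokernel_factor:
  assumes "is_cokernel C c f" "f \<in> Hom C X Y" "h \<in> Hom C Y Z" "h \<cdot> f = Zero C X Z"
  obtains u where "u \<in> Hom C (Cod C c) Z" "u \<cdot> c = h"
proof -
  have "h \<in> Arr C \<and> Dom C h = Cod C f \<and> h \<cdot> f = Zero C (Dom C f) (Cod C h)" "Cod C h = Z"
    using assms by (auto simp: Hom_def)
  then have "\<exists>u. u \<in> Hom C (Cod C c) Z \<and> u \<cdot> c = h"
    using assms(1) unfolding is_cokernel_def by blast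
  then show ?thesis using that by blast
qed

lemma cokernel_epi:
  assumes "is_cokernel C c f" shows "epi_arr C c"
proof -
  have c: "c \<in> Hom C (Dom C c) (Cod C c)" using assms by (auto simp: is_cokernel_def Hom_def)
  show ?thesis
  proof (rule epi_arrI[OF c])
    fix Z g h assume gh: "g \<in> Hom C (Cod C c) Z" "h \<in> Hom C (Cod C c) Z" "g \<cdot> c = h \<cdot> c"
    have f: "f \<in> Hom C (Dom C f) (Dom C c)" and cf: "c \<cdot> f = Zero C (Dom C f) (Cod C c)"
      using assms by (auto simp: is_cokernel_def Hom_def)
    have gc: "g \<cdot> c \<in> Hom C (Dom C c) Z" using comp_Hom[OF c gh(1)] .
    have "(g \<cdot> c) \<cdot> f = Zero C (Dom C f) Z"
      using assoc[OF f c gh(1)] cf comp_Zero[OF gh(1) HomD(4)[OF f]] by simp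
    then have "\<exists>!u. u \<in> Hom C (Cod C c) (Cod C (g \<cdot> c)) \<and> u \<cdot> c = g \<cdot> c"
      using assms HomD[OF gc] HomD[OF f] unfolding is_cokernel_def by metis
    then show "g = h" by (rule ex1_eqI) (use gh HomD(3)[OF gc] in simp_all)
  qed
qed

lemma kernelD:
  assumes "is_kernel C k f" "f \<in> Hom C X Y"
  shows "k \<in> Hom C (Dom C k) X" "f \<cdot> k = Zero C (Dom C k) Y"
  using assms by (auto simp: is_kernel_def Hom_def)

lemma kernel_factor:
  assumes "is_kernel C k f" "f \<in> Hom C X Y" "h \<in> Hom C Z X" "f \<cdot> h = Zero C Z Y"
  obtains u where "u \<in> Hom C Z (Dom C k)" "k \<cdot> u = h"
proof -
  have "h \<in> Arr C \<and> Cod C h = Dom C f \<and> f \<cdot> h = Zero C (Dom C h) (Cod C f)" "Dom C h = Z"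
    using assms by (auto simp: Hom_def)
  then have "\<exists>u. u \<in> Hom C Z (Dom C k) \<and> k \<cdot> u = h"
    using assms(1) unfolding is_kernel_def by blast
  then show ?thesis using that by blast
qed

lemma kernel_cancel:
  assumes "is_kernel C k f" "g \<in> Hom C Z (Dom C k)" "h \<in> Hom C Z (Dom C k)" "k \<cdot> g = k \<cdot> h"
  shows "g = h"
proof -
  have f: "f \<in> Hom C (Dom C f) (Cod C f)" and k: "k \<in> Hom C (Dom C k) (Dom C f)"
    and fk: "f \<cdot> k = Zero C (Dom C k) (Cod C f)"
    using assms(1) by (auto simp: is_kernel_def Hom_def)
  have kg: "k \<cdot> g \<in> Hom C Z (Dom C f)" using comp_Hom[OF assms(2) k] .
  have "f \<cdot> (k \<cdot> g) = Zero C Z (Cod C f)"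
    using assoc[OF assms(2) k f] fk Zero_comp[OF assms(2) HomD(5)[OF f]] by simp
  then have "\<exists>!u. u \<in> Hom C (Dom C (k \<cdot> g)) (Dom C k) \<and> k \<cdot> u = k \<cdot> g"
    using assms(1) HomD[OF kg] unfolding is_kernel_def by metis
  then show ?thesis by (rule ex1_eqI) (use assms(2-4) HomD(2)[OF kg] in simp_all)
qed

lemma direct_limit_eqI:
  assumes "is_direct_limit C I r D L \<iota>" "f \<in> Hom C L M" "g \<in> Hom C L M"
    and "\<And>i. i \<in> I \<Longrightarrow> f \<cdot> \<iota> i = g \<cdot> \<iota> i" and dir: "directed_poset U I r"
    and D: "\<And>i j. (i, j) \<in> r \<Longrightarrow> amap D (i, j) \<in> Hom C (omap D i) (omap D j)"
  shows "f = g"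
proof -
  have "is_limit_cocone C I r D M (\<lambda>i. g \<cdot> \<iota> i)"
    unfolding is_limit_cocone_def
  proof (intro conjI ballI allI impI)
    fix i j assume ij: "(i, j) \<in> r"
    then have "j \<in> I" using directed_poset_subset[OF dir] by blast
    then show "g \<cdot> \<iota> j \<cdot> amap D (i, j) = g \<cdot> \<iota> i"
      using assoc[OF D[OF ij] direct_limit_map[OF assms(1)] assms(3)] ij
      by (simp add: direct_limit_comp[OF assms(1)])
  qed (use comp_Hom[OF direct_limit_map[OF assms(1)] assms(3)] HomD[OF assms(3)] in auto)
  then have "\<exists>!h. h \<in> Hom C L M \<and> (\<forall>i\<in>Obj (poset_category I r). h \<cdot> \<iota> i = g \<cdot> \<iota> i)"
    using assms(1) unfolding is_direct_limit_def is_colimit_def is_cocone_poset by blast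
  then have "\<exists>!h. h \<in> Hom C L M \<and> (\<forall>i\<in>I. h \<cdot> \<iota> i = g \<cdot> \<iota> i)"
    by (simp add: poset_category_def)
  then show ?thesis by (rule ex1_eqI) (use assms(2-4) in simp_all)
qed

lemma direct_limit_unique:
  assumes ds: "direct_system U C I r D"
    and L: "is_direct_limit C I r D L \<iota>" and M: "is_direct_limit C I r D M \<kappa>"
  obtains f g where "f \<in> Hom C L M" "g \<in> Hom C M L" "g \<cdot> f = Ide C L" "f \<cdot> g = Ide C M"
    "\<And>i. i \<in> I \<Longrightarrow> f \<cdot> \<iota> i = \<kappa> i" "\<And>i. i \<in> I \<Longrightarrow> g \<cdot> \<kappa> i = \<iota> i"
proof -
  obtain f where f: "f \<in> Hom C L M" "\<And>i. i \<in> I \<Longrightarrow> f \<cdot> \<iota> i = \<kappa> i"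
    using direct_limit_factor[OF L direct_limit_cocone[OF M]] by blast
  obtain g where g: "g \<in> Hom C M L" "\<And>i. i \<in> I \<Longrightarrow> g \<cdot> \<kappa> i = \<iota> i"
    using direct_limit_factor[OF M direct_limit_cocone[OF L]] by blast
  note eqI = direct_limit_eqI[OF _ _ _ _ direct_system_directed[OF ds] direct_system_map[OF ds]]
  have "g \<cdot> f = Ide C L"
  proof (rule eqI[OF L comp_Hom[OF f(1) g(1)] Ide_Hom])
    fix i assume i: "i \<in> I"
    note h = direct_limit_map[OF L i]
    show "g \<cdot> f \<cdot> \<iota> i = Ide C L \<cdot> \<iota> i"
      using assoc[OF h f(1) g(1)] i h f g by (simp add: Hom_Ide)
  qed (use direct_limit_Obj[OF L] in auto)
  moreover have "f \<cdot> g = Ide C M"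
  proof (rule eqI[OF M comp_Hom[OF g(1) f(1)] Ide_Hom])
    fix i assume i: "i \<in> I"
    note h = direct_limit_map[OF M i]
    show "f \<cdot> g \<cdot> \<kappa> i = Ide C M \<cdot> \<kappa> i"
      using assoc[OF h g(1) f(1)] i h f g by (simp add: Hom_Ide)
  qed (use direct_limit_Obj[OF M] in auto)
  ultimately show ?thesis using that f g by blast
qed

lemma direct_limit_iso:
  assumes ds: "direct_system U C I r D" and L: "is_direct_limit C I r D L \<iota>"
    and f: "f \<in> Hom C L M" "g \<in> Hom C M L" "g \<cdot> f = Ide C L" "f \<cdot> g = Ide C M"
  shows "is_direct_limit C I r D M (\<lambda>i. f \<cdot> \<iota> i)"
proof (rule direct_limitI)
  note rI = directed_poset_subset[OF direct_system_directed[OF ds]]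
  show "is_limit_cocone C I r D M (\<lambda>i. f \<cdot> \<iota> i)"
    unfolding is_limit_cocone_def
  proof (intro conjI ballI allI impI)
    fix i j assume ij: "(i, j) \<in> r"
    then have "j \<in> I" using rI by blast
    then show "f \<cdot> \<iota> j \<cdot> amap D (i, j) = f \<cdot> \<iota> i"
      using assoc[OF direct_system_map[OF ds ij] direct_limit_map[OF L] f(1)] ij
      by (simp add: direct_limit_comp[OF L])
  qed (use f direct_limit_map[OF L] in \<open>auto dest: HomD\<close>)
next
  fix N \<mu> assume "is_limit_cocone C I r D N \<mu>"
  then obtain h where h: "h \<in> Hom C L N" "\<And>i. i \<in> I \<Longrightarrow> h \<cdot> \<iota> i = \<mu> i"
    using direct_limit_factor[OF L] by blast
  have "(h \<cdot> g) \<cdot> (f \<cdot> \<iota> i) = \<mu> i" if i: "i \<in> I" for i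
  proof -
    note a = direct_limit_map[OF L i]
    have "(h \<cdot> g) \<cdot> (f \<cdot> \<iota> i) = h \<cdot> (g \<cdot> (f \<cdot> \<iota> i))" using assoc[OF comp_Hom[OF a f(1)] f(2) h(1)] .
    also have "\<dots> = h \<cdot> \<iota> i" using comp_reduce[OF f(3) f(1) f(2) a] a by (simp add: Hom_Ide)
    finally show ?thesis using h i by simp
  qed
  then show "\<exists>h. h \<in> Hom C M N \<and> (\<forall>i\<in>I. h \<cdot> (f \<cdot> \<iota> i) = \<mu> i)"
    using comp_Hom[OF f(2) h(1)] by blast
next
  fix N h k assume hk: "h \<in> Hom C M N" "k \<in> Hom C M N" and eq: "\<And>i. i \<in> I \<Longrightarrow> h \<cdot> (f \<cdot> \<iota> i) = k \<cdot> (f \<cdot> \<iota> i)"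
  have "h \<cdot> f = k \<cdot> f"
  proof (rule direct_limit_eqI[OF L comp_Hom[OF f(1) hk(1)] comp_Hom[OF f(1) hk(2)] _
        direct_system_directed[OF ds] direct_system_map[OF ds]])
    fix i assume i: "i \<in> I"
    note a = direct_limit_map[OF L i]
    show "h \<cdot> f \<cdot> \<iota> i = k \<cdot> f \<cdot> \<iota> i" using eq[OF i] assoc[OF a f(1)] hk by simp
  qed
  then have "(h \<cdot> f) \<cdot> g = (k \<cdot> f) \<cdot> g" by simp
  then show "h = k" using assoc[OF f(2,1)] hk f by (simp add: Hom_Ide)
qed

subsection \<open>Finitely presented objects\<close>

text \<open>Surjectivity of the comparison map from the direct limit of the groups
  \<open>Hom C F (omap D i)\<close> to \<open>Hom C F L\<close>, in terms of elements.\<close>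

definition factors_through_stage :: "'o \<Rightarrow> 'u set \<Rightarrow> ('u, 'u \<times> 'u, 'o, 'm) cfunctor \<Rightarrow> 'o \<Rightarrow> ('u \<Rightarrow> 'm) \<Rightarrow> bool"
  where "factors_through_stage F I D L \<iota> \<longleftrightarrow>
    (\<forall>f\<in>Hom C F L. \<exists>i\<in>I. \<exists>x\<in>Hom C F (omap D i). f = \<iota> i \<cdot> x)"

text \<open>Injectivity of the same comparison map: whatever becomes zero in the limit is already
  zero at a later stage.\<close>

definition vanishes_at_stage ::
  "'o \<Rightarrow> 'u set \<Rightarrow> 'u rel \<Rightarrow> ('u, 'u \<times> 'u, 'o, 'm) cfunctor \<Rightarrow> 'o \<Rightarrow> ('u \<Rightarrow> 'm) \<Rightarrow> bool"
  where "vanishes_at_stage F I r D L \<iota> \<longleftrightarrow>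
    (\<forall>i\<in>I. \<forall>x\<in>Hom C F (omap D i). \<iota> i \<cdot> x = Zero C F L \<longrightarrow>
       (\<exists>j. (i, j) \<in> r \<and> amap D (i, j) \<cdot> x = Zero C F (omap D j)))"

text \<open>The hom groups form a small directed system, so the elementwise description of direct
  limits of abelian groups applies. Smallness of \<open>Hom C F L\<close> enters because
  surjectivity was obtained by testing against one of its quotients.\<close>

lemma ab_direct_limit_Hom_iff:
  assumes F: "F \<in> Obj C" and ds: "direct_system U C I r D" and L: "is_direct_limit C I r D L \<iota>"
  shows "is_ab_direct_limit U I r (\<lambda>i. hom_group C F (omap D i)) (\<lambda>k x. amap D k \<cdot> x)
      (hom_group C F L) (\<lambda>i x. \<iota> i \<cdot> x) \<longleftrightarrow>
    factors_through_stage F I D L \<iota> \<and> vanishes_at_stage F I r D L \<iota>"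
    (is "?lim \<longleftrightarrow> _")
proof -
  note dir = direct_system_directed[OF ds]
  note LO = direct_limit_Obj[OF L]
  have rI: "i \<in> I" "j \<in> I" if "(i, j) \<in> r" for i j using that directed_poset_subset[OF dir] by auto
  interpret ab_direct_system U I r "\<lambda>i. hom_group C F (omap D i)" "\<lambda>k x. amap D k \<cdot> x"
  proof (rule ab_direct_system.intro[OF universe_axioms ab_direct_system_axioms.intro])
    fix i j assume ij: "(i, j) \<in> r"
    show "(\<lambda>x. amap D (i, j) \<cdot> x) \<in> hom (hom_group C F (omap D i)) (hom_group C F (omap D j))"
      using comp_hom_group(2)[OF direct_system_map[OF ds ij] F] .
    fix k x assume jk: "(j, k) \<in> r" and x: "x \<in> carrier (hom_group C F (omap D i))"
    show "amap D (j, k) \<cdot> (amap D (i, j) \<cdot> x) = amap D (i, k) \<cdot> x"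
      using comp_reduce[OF direct_system_comp[OF ds ij jk] direct_system_map[OF ds ij]
          direct_system_map[OF ds jk]] x by simp
  qed (simp_all add: dir hom_comm_group small_Hom F direct_system_Obj[OF ds])
  show ?thesis
  proof
    assume lim: ?lim
    have small: "carrier (hom_group C F L) \<prec> U" using small_Hom F LO by simp
    have "factors_through_stage F I D L \<iota>"
      unfolding factors_through_stage_def using ab_direct_limit_surj[OF lim small] by (metis hom_group_simps(1))
    moreover have "vanishes_at_stage F I r D L \<iota>"
      unfolding vanishes_at_stage_def using ab_direct_limit_kernel[OF lim] by (metis hom_group_simps(1,2))
    ultimately show "factors_through_stage F I D L \<iota> \<and> vanishes_at_stage F I r D L \<iota>" by blast
  next
    assume h: "factors_through_stage F I D L \<iota> \<and> vanishes_at_stage F I r D L \<iota>"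
    show ?lim
    proof (rule ab_direct_limitI)
      show "comm_group (hom_group C F L)" using hom_comm_group F LO by simp
      have "(\<lambda>x. \<iota> i \<cdot> x) \<in> hom (hom_group C F (omap D i)) (hom_group C F L)" if "i \<in> I" for i
        using comp_hom_group(2)[OF direct_limit_map[OF L that] F] .
      moreover have "\<iota> j \<cdot> (amap D (i, j) \<cdot> x) = \<iota> i \<cdot> x" if "(i, j) \<in> r" "x \<in> Hom C F (omap D i)" for i j x
        using comp_reduce[OF direct_limit_comp[OF L that(1)] direct_system_map[OF ds that(1)]
            direct_limit_map[OF L] that(2)] rI that(1) by blast
      ultimately show "ab_cocone I r (\<lambda>i. hom_group C F (omap D i)) (\<lambda>k x. amap D k \<cdot> x)
          (hom_group C F L) (\<lambda>i x. \<iota> i \<cdot> x)"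
        by (auto simp: ab_cocone_def)
    qed (use h in \<open>auto simp: factors_through_stage_def vanishes_at_stage_def\<close>)
  qed
qed

text \<open>The form of finite presentation that all later arguments use; direct limits of groups do
  not occur again.\<close>

lemma fp_iff:
  "F \<in> fp U C \<longleftrightarrow> F \<in> Obj C \<and>
    (\<forall>I r D L \<iota>. direct_system U C I r D \<longrightarrow> is_direct_limit C I r D L \<iota> \<longrightarrow>
       factors_through_stage F I D L \<iota> \<and> vanishes_at_stage F I r D L \<iota>)"
  unfolding fp_def finitely_presented_def using ab_direct_limit_Hom_iff by blast

lemma fp_Obj: "F \<in> fp U C \<Longrightarrow> F \<in> Obj C"
  by (simp add: fp_def)

lemma fp_factor:
  assumes "F \<in> fp U C" "direct_system U C I r D" "is_direct_limit C I r D L \<iota>" "f \<in> Hom C F L"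
  obtains i x where "i \<in> I" "x \<in> Hom C F (omap D i)" "f = \<iota> i \<cdot> x"
  using assms unfolding fp_iff factors_through_stage_def by blast

lemma fp_vanish:
  assumes "F \<in> fp U C" "direct_system U C I r D" "is_direct_limit C I r D L \<iota>"
    "i \<in> I" "x \<in> Hom C F (omap D i)" "\<iota> i \<cdot> x = Zero C F L"
  obtains j where "(i, j) \<in> r" "amap D (i, j) \<cdot> x = Zero C F (omap D j)"
  using assms unfolding fp_iff vanishes_at_stage_def by blast

lemma fpI:
  assumes "F \<in> Obj C"
    and "\<And>I r D L \<iota> f. direct_system U C I r D \<Longrightarrow> is_direct_limit C I r D L \<iota> \<Longrightarrow> f \<in> Hom C F L \<Longrightarrow>
      \<exists>i\<in>I. \<exists>x\<in>Hom C F (omap D i). f = \<iota> i \<cdot> x"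
    and "\<And>I r D L \<iota> i x. direct_system U C I r D \<Longrightarrow> is_direct_limit C I r D L \<iota> \<Longrightarrow> i \<in> I \<Longrightarrow>
      x \<in> Hom C F (omap D i) \<Longrightarrow> \<iota> i \<cdot> x = Zero C F L \<Longrightarrow>
      \<exists>j. (i, j) \<in> r \<and> amap D (i, j) \<cdot> x = Zero C F (omap D j)"
  shows "F \<in> fp U C"
  unfolding fp_iff factors_through_stage_def vanishes_at_stage_def using assms by blast

end

section \<open>Cocomplete abelian categories\<close>

text \<open>The cokernel of the map that \<open>S\<close> induces on the coproduct of the domains,
  expressed without choosing that coproduct. Being an epimorphism replaces uniqueness of the
  factorization.\<close>

definition is_joint_cokernel :: "('o, 'm, 'x) addcat_scheme \<Rightarrow> 'm set \<Rightarrow> 'm \<Rightarrow> bool" where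
  "is_joint_cokernel C S c \<longleftrightarrow> epi_arr C c \<and> S \<subseteq> Arr C \<and>
     (\<forall>f\<in>S. Cod C f = Dom C c \<and> c \<cdot>\<^bsub>C\<^esub> f = Zero C (Dom C f) (Cod C c)) \<and>
     (\<forall>h\<in>Arr C. Dom C h = Dom C c \<and> (\<forall>f\<in>S. h \<cdot>\<^bsub>C\<^esub> f = Zero C (Dom C f) (Cod C h)) \<longrightarrow>
        (\<exists>u\<in>Hom C (Cod C c) (Cod C h). u \<cdot>\<^bsub>C\<^esub> c = h))"

locale cocomplete_abelian = universe U for U :: "'u set" +
  fixes C :: "('o, 'm, 'x) addcat_scheme" (structure)
  assumes abelian: "abelian_category U C" and cocomplete: "cocomplete U C"
begin

sublocale preadditive U C
  by unfold_locales (use abelian in \<open>simp add: abelian_category_def additive_category_def\<close>)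

text \<open>A coproduct is a colimit over a discrete category, built here on a code of
  \<open>I\<close> in \<open>'u\<close>. Composable arrows of \<open>J\<close> are equal, so
  \<open>Comp\<close> can simply return one of them.\<close>

lemma coproduct_exists:
  fixes I :: "'i set"
  assumes "I \<prec> U" and F: "\<And>i. i \<in> I \<Longrightarrow> F i \<in> Obj C"
  obtains P \<iota> where "is_coproduct C I F P \<iota>"
proof -
  obtain K :: "'u set" and d where K: "K \<prec> U" "bij_betw d K I"
    using small_encode[OF assms(1)] by blast
  have dI: "d k \<in> I" if "k \<in> K" for k using K(2) that by (auto simp: bij_betw_def)
  define J where "J = \<lparr>Obj = K, Arr = K, Dom = \<lambda>k. k, Cod = \<lambda>k. k, Ide = \<lambda>k. k, Comp = \<lambda>g f. f\<rparr>"
  define D where "D = \<lparr>omap = \<lambda>k. F (d k), amap = \<lambda>k. Ide C (F (d k))\<rparr>"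
  have "category J" by (auto simp: category_def J_def Hom_def)
  moreover have "is_functor J C D"
    using F[OF dI] Ide_Hom[OF F[OF dI]] by (auto simp: is_functor_def J_def D_def)
  ultimately obtain P \<kappa> where P: "is_colimit J C D P \<kappa>"
    using cocomplete K(1) unfolding cocomplete_def by (metis J_def precat.select_convs(1,2))
  have cocone: "is_cocone J C D Q \<mu> \<longleftrightarrow> Q \<in> Obj C \<and> (\<forall>k\<in>K. \<mu> k \<in> Hom C (F (d k)) Q)" for Q \<mu>
    by (auto simp: is_cocone_def J_def D_def Hom_Ide)
  define e where "e = inv_into K d"
  have de: "d (e i) = i" and eK: "e i \<in> K" if "i \<in> I" for i
    using K(2) that by (auto simp: e_def bij_betw_def f_inv_into_f inv_into_into)
  have ed: "e (d k) = k" if "k \<in> K" for k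
    using K(2) that by (simp add: e_def bij_betw_def)
  have "is_coproduct C I F P (\<lambda>i. \<kappa> (e i))"
    unfolding is_coproduct_def
  proof (intro conjI ballI allI impI)
    have P': "P \<in> Obj C" "\<forall>k\<in>K. \<kappa> k \<in> Hom C (F (d k)) P"
      using P unfolding is_colimit_def cocone by auto
    show "P \<in> Obj C" by fact
    show "\<kappa> (e i) \<in> Hom C (F i) P" if "i \<in> I" for i
      using P'(2) de eK that by metis
    fix Q \<mu> assume Q: "Q \<in> Obj C" and \<mu>: "\<forall>i\<in>I. \<mu> i \<in> Hom C (F i) Q"
    have "is_cocone J C D Q (\<lambda>k. \<mu> (d k))" using Q \<mu> dI by (simp add: cocone)
    then have "\<exists>!h. h \<in> Hom C P Q \<and> (\<forall>k\<in>K. h \<cdot> \<kappa> k = \<mu> (d k))"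
      using P unfolding is_colimit_def by (simp add: J_def)
    moreover have "(\<forall>k\<in>K. h \<cdot> \<kappa> k = \<mu> (d k)) \<longleftrightarrow> (\<forall>i\<in>I. h \<cdot> \<kappa> (e i) = \<mu> i)" for h
      using de eK ed dI by metis
    ultimately show "\<exists>!h. h \<in> Hom C P Q \<and> (\<forall>i\<in>I. h \<cdot> \<kappa> (e i) = \<mu> i)" by simp
  qed
  then show ?thesis using that by blast
qed

subsection \<open>Joint cokernels\<close>

lemma joint_cokernel_epi: "is_joint_cokernel C S c \<Longrightarrow> epi_arr C c"
  by (simp add: is_joint_cokernel_def)

lemma joint_cokernel_Hom: "is_joint_cokernel C S c \<Longrightarrow> c \<in> Hom C G V \<Longrightarrow> f \<in> S \<Longrightarrow> f \<in> Hom C (Dom C f) G"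
  by (auto simp: is_joint_cokernel_def Hom_def)

lemma joint_cokernel_zero:
  "is_joint_cokernel C S c \<Longrightarrow> c \<in> Hom C G V \<Longrightarrow> f \<in> S \<Longrightarrow> f \<in> Hom C X G \<Longrightarrow> c \<cdot> f = Zero C X V"
  by (auto simp: is_joint_cokernel_def Hom_def)

lemma joint_cokernel_factor:
  assumes "is_joint_cokernel C S c" "c \<in> Hom C G V" "h \<in> Hom C G M"
    and "\<And>f. f \<in> S \<Longrightarrow> h \<cdot> f = Zero C (Dom C f) M"
  obtains u where "u \<in> Hom C V M" "u \<cdot> c = h"
proof -
  have "h \<in> Arr C" "Dom C h = Dom C c" "Cod C h = M" "Cod C c = V"
    using assms by (auto simp: Hom_def)
  then have "\<exists>u\<in>Hom C V M. u \<cdot> c = h"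
    using assms(1,4) unfolding is_joint_cokernel_def by metis
  then show ?thesis using that by blast
qed

lemma joint_cokernelI:
  assumes "epi_arr C c" "c \<in> Hom C G V" "\<And>f. f \<in> S \<Longrightarrow> f \<in> Hom C (Dom C f) G"
    and "\<And>f. f \<in> S \<Longrightarrow> c \<cdot> f = Zero C (Dom C f) V"
    and "\<And>h M. h \<in> Hom C G M \<Longrightarrow> (\<And>f. f \<in> S \<Longrightarrow> h \<cdot> f = Zero C (Dom C f) M) \<Longrightarrow> \<exists>u\<in>Hom C V M. u \<cdot> c = h"
  shows "is_joint_cokernel C S c"
  unfolding is_joint_cokernel_def using assms by (auto simp: Hom_def)

lemma cokernel_exists:
  assumes "f \<in> Hom C X Y" obtains V c where "c \<in> Hom C Y V" "is_cokernel C c f"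
  using assms abelian unfolding abelian_category_def by (metis HomD(1) cokernelD(1))

lemma kernel_exists:
  assumes "f \<in> Hom C X Y" obtains K k where "k \<in> Hom C K X" "is_kernel C k f"
  using assms abelian unfolding abelian_category_def by (metis HomD(1) kernelD(1))

lemma cokernel_joint_cokernel:
  assumes "is_cokernel C c f" "f \<in> Hom C X Y"
  shows "is_joint_cokernel C {f} c"
proof (rule joint_cokernelI[OF cokernel_epi[OF assms(1)] cokernelD(1)[OF assms]])
  show "\<exists>u\<in>Hom C (Cod C c) M. u \<cdot> c = h"
    if "h \<in> Hom C Y M" "\<And>f'. f' \<in> {f} \<Longrightarrow> h \<cdot> f' = Zero C (Dom C f') M" for h M
    using cokernel_factor[OF assms that(1)] that(2)[of f] assms(2) by (auto simp: Hom_def)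
qed (use cokernelD[OF assms] assms(2) in \<open>auto simp: Hom_def\<close>)

text \<open>A map out of a coproduct is zero as soon as its restrictions to all summands are, so
  killing \<open>m\<close> and killing every \<open>m \<cdot> \<iota> i\<close> are the same
  condition.\<close>

lemma cokernel_coproduct:
  assumes P: "is_coproduct C I F P \<iota>" and m: "m \<in> Hom C P G" and c: "is_cokernel C c m"
  shows "is_joint_cokernel C ((\<lambda>i. m \<cdot> \<iota> i) ` I) c"
proof -
  note cH = cokernelD[OF c m]
  have i: "m \<cdot> \<iota> i \<in> Hom C (F i) G" if "i \<in> I" for i
    using coproduct_in[OF P that] m by blast
  show ?thesis
  proof (rule joint_cokernelI[OF cokernel_epi[OF c] cH(1)])
    fix f assume "f \<in> (\<lambda>i. m \<cdot> \<iota> i) ` I"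
    then obtain j where j: "j \<in> I" "f = m \<cdot> \<iota> j" by blast
    show f: "f \<in> Hom C (Dom C f) G" using i[OF j(1)] j(2) by (auto simp: Hom_def)
    show "c \<cdot> f = Zero C (Dom C f) (Cod C c)"
      using comp_reduce[OF cH(2) m cH(1) coproduct_in[OF P j(1)]] i[OF j(1)] j
        Zero_comp[OF coproduct_in[OF P j(1)]] HomD[OF cH(1)] by (simp add: Hom_def)
  next
    fix h M assume h: "h \<in> Hom C G M"
      and z: "\<And>f. f \<in> (\<lambda>i. m \<cdot> \<iota> i) ` I \<Longrightarrow> h \<cdot> f = Zero C (Dom C f) M"
    have "h \<cdot> m = Zero C P M"
    proof (rule coproduct_eqI[OF P comp_Hom[OF m h] Zero_Hom])
      fix j assume j: "j \<in> I"
      note a = coproduct_in[OF P j]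
      show "h \<cdot> m \<cdot> \<iota> j = Zero C P M \<cdot> \<iota> j"
        using z[of "m \<cdot> \<iota> j"] j assoc[OF a m h] Zero_comp[OF a] HomD[OF h] HomD[OF i[OF j]] by simp
    qed (use HomD[OF m] HomD[OF h] in auto)
    then show "\<exists>u\<in>Hom C (Cod C c) M. u \<cdot> c = h"
      using cokernel_factor[OF c m h] by blast
  qed
qed

lemma joint_cokernel_exists:
  assumes "S \<prec> U" "G \<in> Obj C" "\<And>f. f \<in> S \<Longrightarrow> f \<in> Hom C (Dom C f) G"
  obtains V c where "c \<in> Hom C G V" "is_joint_cokernel C S c"
proof -
  \<comment> \<open>The set of relations serves as its own index set: the summand of
    \<open>f\<close> is its domain.\<close>
  obtain P \<iota> where P: "is_coproduct C S (Dom C) P \<iota>"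
    using coproduct_exists[OF assms(1), of "Dom C"] assms(3) HomD by metis
  obtain m where m: "m \<in> Hom C P G" "\<And>f. f \<in> S \<Longrightarrow> m \<cdot> \<iota> f = f"
    using coproduct_factor[OF P assms(2), of "\<lambda>f. f"] assms(3) by blast
  obtain V c where c: "c \<in> Hom C G V" "is_cokernel C c m" using cokernel_exists[OF m(1)] by blast
  have "(\<lambda>f. m \<cdot> \<iota> f) ` S = S" using m(2) by simp
  then show ?thesis using cokernel_coproduct[OF P m(1) c(2)] that c by simp
qed

text \<open>Converts a set of relations into the format of \<open>Pres\<close>, which asks for index
  sets in \<open>'u\<close> and a single morphism between coproducts. Both \<open>S\<close> and
  \<open>J\<close> are recoded for this.\<close>

lemma Pres_joint_cokernel:
  assumes Q: "is_coproduct C J G Q \<kappa>" "J \<prec> U" "\<And>j. j \<in> J \<Longrightarrow> G j \<in> T"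
    and S: "S \<prec> U" "\<And>f. f \<in> S \<Longrightarrow> Dom C f \<in> T" and c: "c \<in> Hom C Q V" "is_joint_cokernel C S c"
    and X: "isomorphic C X V"
  shows "X \<in> Pres U C T"
proof -
  obtain I :: "'u set" and d where I: "I \<prec> U" "bij_betw d I S" using small_encode[OF S(1)] by blast
  have dS: "d ` I = S" using I(2) by (auto simp: bij_betw_def)
  obtain I' :: "'u set" and d' where I': "I' \<prec> U" "bij_betw d' I' J" using small_encode[OF Q(2)] by blast
  have dJ: "d' ` I' = J" using I'(2) by (auto simp: bij_betw_def)
  have dQ: "d i \<in> Hom C (Dom C (d i)) Q" if "i \<in> I" for i
    using joint_cokernel_Hom[OF c(2,1)] that dS by blast
  obtain P \<iota> where P: "is_coproduct C I (\<lambda>i. Dom C (d i)) P \<iota>"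
    using coproduct_exists[OF I(1), of "\<lambda>i. Dom C (d i)"] HomD(4)[OF dQ] by metis
  obtain m where m: "m \<in> Hom C P Q" "\<And>i. i \<in> I \<Longrightarrow> m \<cdot> \<iota> i = d i"
    using coproduct_factor[OF P coproduct_Obj[OF Q(1)] dQ] by blast
  have Q': "is_coproduct C I' (\<lambda>i. G (d' i)) Q (\<lambda>i. \<kappa> (d' i))"
    unfolding is_coproduct_def
  proof (intro conjI ballI allI impI)
    show "Q \<in> Obj C" using coproduct_Obj[OF Q(1)] .
    show "\<kappa> (d' i) \<in> Hom C (G (d' i)) Q" if "i \<in> I'" for i
      using coproduct_in[OF Q(1)] that dJ by blast
    fix M \<mu> assume M: "M \<in> Obj C" and \<mu>: "\<forall>i\<in>I'. \<mu> i \<in> Hom C (G (d' i)) M"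
    define e where "e = inv_into I' d'"
    have e: "d' (e j) = j" "e j \<in> I'" if "j \<in> J" for j
      using I'(2) that by (auto simp: e_def bij_betw_def f_inv_into_f inv_into_into)
    have ed: "e (d' i) = i" if "i \<in> I'" for i using I'(2) that by (simp add: e_def bij_betw_def)
    have "\<forall>j\<in>J. \<mu> (e j) \<in> Hom C (G j) M" using \<mu> e by metis
    then have "\<exists>!h. h \<in> Hom C Q M \<and> (\<forall>j\<in>J. h \<cdot> \<kappa> j = \<mu> (e j))"
      using coproduct_universal[OF Q(1) M, of "\<lambda>j. \<mu> (e j)"] by blast
    moreover have "(\<forall>j\<in>J. h \<cdot> \<kappa> j = \<mu> (e j)) \<longleftrightarrow> (\<forall>i\<in>I'. h \<cdot> \<kappa> (d' i) = \<mu> i)" for h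
      using e ed dJ by (metis imageI)
    ultimately show "\<exists>!h. h \<in> Hom C Q M \<and> (\<forall>i\<in>I'. h \<cdot> \<kappa> (d' i) = \<mu> i)" by simp
  qed
  have cm: "is_cokernel C c m"
    unfolding is_cokernel_def
  proof (intro conjI ballI impI)
    show "m \<in> Arr C" "c \<in> Arr C" "Dom C c = Cod C m" using m(1) c(1) by (auto simp: Hom_def)
    have "c \<cdot> m = Zero C P V"
    proof (rule coproduct_eqI[OF P comp_Hom[OF m(1) c(1)] Zero_Hom])
      fix i assume i: "i \<in> I"
      note a = coproduct_in[OF P i]
      have "c \<cdot> d i = Zero C (Dom C (d i)) V"
        using joint_cokernel_zero[OF c(2,1) _ dQ[OF i]] i dS by blast
      then show "c \<cdot> m \<cdot> \<iota> i = Zero C P V \<cdot> \<iota> i"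
        using assoc[OF a m(1) c(1)] m(2)[OF i] Zero_comp[OF a] HomD[OF c(1)] by simp
    qed (use HomD[OF m(1)] HomD[OF c(1)] in auto)
    then show "c \<cdot> m = Zero C (Dom C m) (Cod C c)" using m(1) c(1) by (simp add: Hom_def)
    fix h assume h: "h \<in> Arr C" "Dom C h = Cod C m \<and> h \<cdot> m = Zero C (Dom C m) (Cod C h)"
    then have hH: "h \<in> Hom C Q (Cod C h)" and hm: "h \<cdot> m = Zero C P (Cod C h)"
      using m(1) by (auto simp: Hom_def)
    have "h \<cdot> f = Zero C (Dom C f) (Cod C h)" if f: "f \<in> S" for f
    proof -
      obtain i where i: "i \<in> I" "f = d i" using f dS by blast
      show ?thesis
        using comp_reduce[OF hm m(1) hH coproduct_in[OF P i(1)]] m(2)[OF i(1)] i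
          Zero_comp[OF coproduct_in[OF P i(1)]] h(1) by simp
    qed
    then obtain u where u: "u \<in> Hom C V (Cod C h)" "u \<cdot> c = h"
      using joint_cokernel_factor[OF c(2,1) hH] by blast
    have V: "V = Cod C c" using c(1) by (simp add: Hom_def)
    show "\<exists>!u. u \<in> Hom C (Cod C c) (Cod C h) \<and> u \<cdot> c = h"
      using u epi_cancel[OF joint_cokernel_epi[OF c(2)] c(1)] unfolding V by (intro ex1I[of _ u]) auto
  qed
  have "Cod C c = V" using c(1) by (simp add: Hom_def)
  then have X': "isomorphic C X (Cod C c)" using X by simp
  have "\<forall>i\<in>I. Dom C (d i) \<in> T" "\<forall>i\<in>I'. G (d' i) \<in> T" using S(2) dS Q(3) dJ by auto
  then show ?thesis
    unfolding Pres_def using I(1) I'(1) P Q' m(1) cm X'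
    by (intro CollectI exI[of _ I] exI[of _ I'] exI[of _ "\<lambda>i. Dom C (d i)"] exI[of _ "\<lambda>i. G (d' i)"]
        exI[of _ P] exI[of _ Q] exI[of _ \<iota>] exI[of _ "\<lambda>i. \<kappa> (d' i)"] exI[of _ m] exI[of _ c] conjI)
qed

subsection \<open>Closure properties of finitely presented objects\<close>

lemma direct_system_zero:
  assumes ds: "direct_system U C I r D" and "(i, j) \<in> r" "(j, k) \<in> r" "x \<in> Hom C F (omap D i)"
    and "amap D (i, j) \<cdot> x = Zero C F (omap D j)"
  shows "amap D (i, k) \<cdot> x = Zero C F (omap D k)"
  using comp_reduce[OF direct_system_comp[OF ds assms(2,3)] direct_system_map[OF ds assms(2)]
      direct_system_map[OF ds assms(3)] assms(4)] assms(5)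
    comp_Zero[OF direct_system_map[OF ds assms(3)] HomD(4)[OF assms(4)]] by simp

text \<open>Each map dies at some stage of its own. Finiteness of \<open>A\<close> provides a common
  upper bound, and a map that is zero stays zero later.\<close>

lemma fp_vanish_finite:
  assumes ds: "direct_system U C I r D" and L: "is_direct_limit C I r D L \<iota>" and i: "i \<in> I"
    and fin: "finite A" and F: "\<And>a. a \<in> A \<Longrightarrow> F a \<in> fp U C"
    and x: "\<And>a. a \<in> A \<Longrightarrow> x a \<in> Hom C (F a) (omap D i)" "\<And>a. a \<in> A \<Longrightarrow> \<iota> i \<cdot> x a = Zero C (F a) L"
  obtains k where "(i, k) \<in> r" "\<And>a. a \<in> A \<Longrightarrow> amap D (i, k) \<cdot> x a = Zero C (F a) (omap D k)"
proof -
  note dir = direct_system_directed[OF ds]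
  have "\<forall>a\<in>A. \<exists>j. (i, j) \<in> r \<and> amap D (i, j) \<cdot> x a = Zero C (F a) (omap D j)"
    using fp_vanish[OF F ds L i x] by metis
  then obtain j where j: "\<And>a. a \<in> A \<Longrightarrow> (i, j a) \<in> r \<and> amap D (i, j a) \<cdot> x a = Zero C (F a) (omap D (j a))"
    by metis
  have "insert i (j ` A) \<subseteq> I" using i j directed_poset_subset[OF dir] by blast
  then obtain k where k: "\<And>l. l \<in> insert i (j ` A) \<Longrightarrow> (l, k) \<in> r"
    using directed_poset_bound[OF dir, of "insert i (j ` A)"] fin by blast
  have "(i, k) \<in> r" using k by blast
  moreover have "amap D (i, k) \<cdot> x a = Zero C (F a) (omap D k)" if a: "a \<in> A" for a
    using direct_system_zero[OF ds _ _ x(1)[OF a]] j[OF a] k a by blast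
  ultimately show ?thesis using that by blast
qed

text \<open>Precomposed with \<open>c\<close>, a map from \<open>V\<close> to the limit lifts to a
  stage because \<open>G\<close> is finitely presented. The finitely many relations vanish in the
  limit on this lift, hence at one later stage, where the lift descends to \<open>V\<close>.
  Cancelling the epimorphism \<open>c\<close> yields the factorization.\<close>

lemma fp_joint_cokernel:
  assumes G: "G \<in> fp U C" and S: "finite S" "\<And>f. f \<in> S \<Longrightarrow> Dom C f \<in> fp U C"
    and c: "c \<in> Hom C G V" "is_joint_cokernel C S c"
  shows "V \<in> fp U C"
proof (rule fpI)
  show "V \<in> Obj C" using HomD(5)[OF c(1)] .
  fix I r D L \<iota>
  assume ds: "direct_system U C I r D" and L: "is_direct_limit C I r D L \<iota>"
  note dir = direct_system_directed[OF ds]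
  have fG: "f \<in> Hom C (Dom C f) G" if "f \<in> S" for f using joint_cokernel_Hom[OF c(2,1) that] .
  {
    fix u assume u: "u \<in> Hom C V L"
    obtain i g where i: "i \<in> I" and g: "g \<in> Hom C G (omap D i)" and ug: "u \<cdot> c = \<iota> i \<cdot> g"
      using fp_factor[OF G ds L comp_Hom[OF c(1) u]] by blast
    have "\<iota> i \<cdot> (g \<cdot> f) = Zero C (Dom C f) L" if f: "f \<in> S" for f
      using assoc[OF fG[OF f] g direct_limit_map[OF L i]] assoc[OF fG[OF f] c(1) u] ug
        joint_cokernel_zero[OF c(2,1) f fG[OF f]] comp_Zero[OF u] HomD[OF fG[OF f]] by simp
    then obtain k where k: "(i, k) \<in> r"
        "\<And>f. f \<in> S \<Longrightarrow> amap D (i, k) \<cdot> (g \<cdot> f) = Zero C (Dom C f) (omap D k)"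
      using fp_vanish_finite[OF ds L i S(1), of "Dom C" "\<lambda>f. g \<cdot> f"] S(2) comp_Hom[OF fG g] by metis
    note t = direct_system_map[OF ds k(1)]
    have kI: "k \<in> I" using k(1) directed_poset_subset[OF dir] by blast
    have "(amap D (i, k) \<cdot> g) \<cdot> f = Zero C (Dom C f) (omap D k)" if f: "f \<in> S" for f
      using assoc[OF fG[OF f] g t] k(2)[OF f] by simp
    then obtain v where v: "v \<in> Hom C V (omap D k)" "v \<cdot> c = amap D (i, k) \<cdot> g"
      using joint_cokernel_factor[OF c(2,1) comp_Hom[OF g t]] by blast
    note \<iota> = direct_limit_map[OF L kI]
    have "(\<iota> k \<cdot> v) \<cdot> c = u \<cdot> c"
      using assoc[OF c(1) v(1) \<iota>] v(2) comp_reduce[OF direct_limit_comp[OF L k(1)] t \<iota> g] ug by simp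
    then have "u = \<iota> k \<cdot> v"
      using epi_cancel[OF joint_cokernel_epi[OF c(2)] c(1) u comp_Hom[OF v(1) \<iota>]] by simp
    then show "\<exists>i\<in>I. \<exists>x\<in>Hom C V (omap D i). u = \<iota> i \<cdot> x" using kI v(1) by blast
  next
    fix i x assume i: "i \<in> I" and x: "x \<in> Hom C V (omap D i)" and z: "\<iota> i \<cdot> x = Zero C V L"
    have "\<iota> i \<cdot> (x \<cdot> c) = Zero C G L"
      using comp_reduce[OF z x direct_limit_map[OF L i] c(1)] Zero_comp[OF c(1) direct_limit_Obj[OF L]] by simp
    then obtain j where j: "(i, j) \<in> r" "amap D (i, j) \<cdot> (x \<cdot> c) = Zero C G (omap D j)"
      using fp_vanish[OF G ds L i comp_Hom[OF c(1) x]] by blast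
    note t = direct_system_map[OF ds j(1)]
    have Dj: "omap D j \<in> Obj C" using HomD(5)[OF t] .
    have V: "V \<in> Obj C" using HomD(5)[OF c(1)] .
    have "(amap D (i, j) \<cdot> x) \<cdot> c = Zero C V (omap D j) \<cdot> c"
      using assoc[OF c(1) x t] j(2) Zero_comp[OF c(1) Dj] by simp
    then have "amap D (i, j) \<cdot> x = Zero C V (omap D j)"
      using epi_cancel[OF joint_cokernel_epi[OF c(2)] c(1) comp_Hom[OF x t] Zero_Hom[OF V Dj]] by simp
    then show "\<exists>j. (i, j) \<in> r \<and> amap D (i, j) \<cdot> x = Zero C V (omap D j)" using j(1) by blast
  }
qed

lemma fp_cokernel:
  assumes "is_cokernel C c f" "f \<in> Hom C X Y" "X \<in> fp U C" "Y \<in> fp U C"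
  shows "Cod C c \<in> fp U C"
proof (rule fp_joint_cokernel[OF assms(4) _ _ _ cokernel_joint_cokernel[OF assms(1,2)]])
  show "c \<in> Hom C Y (Cod C c)" using cokernelD(1)[OF assms(1,2)] .
qed (use assms in \<open>auto simp: Hom_def\<close>)

text \<open>A retract \<open>X\<close> is the cokernel of the idempotent
  \<open>Ide C G \<boxminus> s \<cdot> p\<close> on \<open>G\<close>, which reduces this to the
  preceding closure property.\<close>

lemma fp_retract:
  assumes G: "G \<in> fp U C" and s: "s \<in> Hom C X G" and p: "p \<in> Hom C G X" and ps: "p \<cdot> s = Ide C X"
  shows "X \<in> fp U C"
proof -
  have XG: "X \<in> Obj C" "G \<in> Obj C" using HomD[OF s] by auto
  define e where "e = Ide C G \<boxminus> s \<cdot> p"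
  have sp: "s \<cdot> p \<in> Hom C G G" using s p by blast
  have e: "e \<in> Hom C G G" unfolding e_def using diff_Hom[OF Ide_Hom[OF XG(2)] sp] .
  have "p \<cdot> (s \<cdot> p) = p" using comp_reduce[OF ps s p p] p by (simp add: Hom_Ide)
  then have pe: "p \<cdot> e = Zero C G X"
    unfolding e_def using comp_diff[OF Ide_Hom[OF XG(2)] sp p] p by (simp add: Hom_Ide diff_self)
  have epi: "epi_arr C p"
  proof (rule epi_arrI[OF p])
    fix Z f g assume fg: "f \<in> Hom C X Z" "g \<in> Hom C X Z" "f \<cdot> p = g \<cdot> p"
    have "f \<cdot> (p \<cdot> s) = g \<cdot> (p \<cdot> s)"
      using fg(3) assoc[OF s p fg(1)] assoc[OF s p fg(2)] by argo
    then show "f = g" unfolding ps using fg(1,2) by (simp add: Hom_Ide)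
  qed
  have "is_joint_cokernel C {e} p"
  proof (rule joint_cokernelI[OF epi p])
    fix h M assume h: "h \<in> Hom C G M" and "\<And>f. f \<in> {e} \<Longrightarrow> h \<cdot> f = Zero C (Dom C f) M"
    then have "h \<cdot> e = Zero C G M" using e by (simp add: Hom_def)
    then have "h \<boxminus> h \<cdot> (s \<cdot> p) = Zero C G M"
      unfolding e_def using comp_diff[OF Ide_Hom[OF XG(2)] sp h] h by (simp add: Hom_Ide)
    then have "(h \<cdot> s) \<cdot> p = h"
      using diff_eq_Zero[OF h comp_Hom[OF sp h]] assoc[OF p s h] by simp
    then show "\<exists>u\<in>Hom C X M. u \<cdot> p = h" using comp_Hom[OF s h] by blast
  qed (use e pe in \<open>auto simp: Hom_def\<close>)
  then show ?thesis using fp_joint_cokernel[OF G _ _ p] G e by (auto simp: Hom_def)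
qed

text \<open>The components of a map lift to stages that depend on the summand; finitely many stages
  have a common upper bound, where the lifts assemble.\<close>

lemma fp_finite_coproduct:
  assumes Q: "is_coproduct C J G Q \<kappa>" and fin: "finite J" and G: "\<And>j. j \<in> J \<Longrightarrow> G j \<in> fp U C"
  shows "Q \<in> fp U C"
proof (rule fpI)
  note QO = coproduct_Obj[OF Q]
  show "Q \<in> Obj C" by fact
  fix I r D L \<iota>
  assume ds: "direct_system U C I r D" and L: "is_direct_limit C I r D L \<iota>"
  note dir = direct_system_directed[OF ds]
  note \<kappa> = coproduct_in[OF Q]
  {
    fix u assume u: "u \<in> Hom C Q L"
    have "\<forall>j\<in>J. \<exists>i x. i \<in> I \<and> x \<in> Hom C (G j) (omap D i) \<and> u \<cdot> \<kappa> j = \<iota> i \<cdot> x"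
      using fp_factor[OF G ds L comp_Hom[OF \<kappa> u]] by metis
    then obtain i x where ix: "\<And>j. j \<in> J \<Longrightarrow> i j \<in> I \<and> x j \<in> Hom C (G j) (omap D (i j)) \<and> u \<cdot> \<kappa> j = \<iota> (i j) \<cdot> x j"
      by metis
    have "i ` J \<subseteq> I" using ix by blast
    then obtain k where k: "k \<in> I" "\<And>l. l \<in> i ` J \<Longrightarrow> (l, k) \<in> r"
      using directed_poset_bound[OF dir, of "i ` J"] fin by blast
    note \<iota> = direct_limit_map[OF L k(1)]
    have Dk: "omap D k \<in> Obj C" using direct_system_Obj[OF ds k(1)] .
    have ik: "(i j, k) \<in> r" if "j \<in> J" for j using k(2) that by blast
    have y: "amap D (i j, k) \<cdot> x j \<in> Hom C (G j) (omap D k)" if "j \<in> J" for j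
      using direct_system_map[OF ds ik[OF that]] ix[OF that] by blast
    obtain v where v: "v \<in> Hom C Q (omap D k)" "\<And>j. j \<in> J \<Longrightarrow> v \<cdot> \<kappa> j = amap D (i j, k) \<cdot> x j"
      using coproduct_factor[OF Q Dk y] by blast
    have "u = \<iota> k \<cdot> v"
    proof (rule coproduct_eqI[OF Q u comp_Hom[OF v(1) \<iota>]])
      fix j assume j: "j \<in> J"
      have xj: "x j \<in> Hom C (G j) (omap D (i j))" using ix[OF j] by simp
      show "u \<cdot> \<kappa> j = \<iota> k \<cdot> v \<cdot> \<kappa> j"
        using assoc[OF \<kappa>[OF j] v(1) \<iota>] v(2)[OF j] ix[OF j]
          comp_reduce[OF direct_limit_comp[OF L ik[OF j]] direct_system_map[OF ds ik[OF j]] \<iota> xj] by simp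
    qed
    then show "\<exists>i\<in>I. \<exists>x\<in>Hom C Q (omap D i). u = \<iota> i \<cdot> x" using k(1) v(1) by blast
  next
    fix i x assume i: "i \<in> I" and x: "x \<in> Hom C Q (omap D i)" and z: "\<iota> i \<cdot> x = Zero C Q L"
    have "\<iota> i \<cdot> (x \<cdot> \<kappa> j) = Zero C (G j) L" if j: "j \<in> J" for j
      using comp_reduce[OF z x direct_limit_map[OF L i] \<kappa>[OF j]] Zero_comp[OF \<kappa>[OF j] direct_limit_Obj[OF L]] by simp
    then obtain k where k: "(i, k) \<in> r" "\<And>j. j \<in> J \<Longrightarrow> amap D (i, k) \<cdot> (x \<cdot> \<kappa> j) = Zero C (G j) (omap D k)"
      using fp_vanish_finite[OF ds L i fin, of G "\<lambda>j. x \<cdot> \<kappa> j"] G comp_Hom[OF \<kappa> x] by metis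
    note t = direct_system_map[OF ds k(1)]
    note Dk = HomD(5)[OF t]
    have "amap D (i, k) \<cdot> x = Zero C Q (omap D k)"
    proof (rule coproduct_eqI[OF Q comp_Hom[OF x t] Zero_Hom[OF QO Dk]])
      fix j assume j: "j \<in> J"
      show "amap D (i, k) \<cdot> x \<cdot> \<kappa> j = Zero C Q (omap D k) \<cdot> \<kappa> j"
        using assoc[OF \<kappa>[OF j] x t] k(2)[OF j] Zero_comp[OF \<kappa>[OF j] Dk] by simp
    qed
    then show "\<exists>j. (i, j) \<in> r \<and> amap D (i, j) \<cdot> x = Zero C Q (omap D j)" using k(1) by blast
  }
qed


section \<open>Direct limits as cokernels\<close>

text \<open>The standard presentation of a colimit: the coproduct of the stages modulo the
  differences between an injection and the later injection after a transition map. It gives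
  existence of direct limits as well as their membership in \<open>Pres\<close>.\<close>

lemma direct_limit_presentation:
  assumes ds: "direct_system U C I r D"
  obtains P inj S c L where "is_coproduct C I (omap D) P inj" "S \<prec> U"
    "S \<subseteq> {f. \<exists>i\<in>I. f \<in> Hom C (omap D i) P}"
    "c \<in> Hom C P L" "is_joint_cokernel C S c" "is_direct_limit C I r D L (\<lambda>i. c \<cdot> inj i)"
proof -
  note dir = direct_system_directed[OF ds]
  have rI: "i \<in> I" "j \<in> I" if "(i, j) \<in> r" for i j using that directed_poset_subset[OF dir] by auto
  obtain P inj where P: "is_coproduct C I (omap D) P inj"
    using coproduct_exists[OF directed_poset_small[OF dir], of "omap D"] direct_system_Obj[OF ds] by metis
  note inj = coproduct_in[OF P] and PO = coproduct_Obj[OF P]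
  note t = direct_system_map[OF ds]
  define rel where "rel i j = inj j \<cdot> amap D (i, j) \<boxminus> inj i" for i j
  have rel: "rel i j \<in> Hom C (omap D i) P" if "(i, j) \<in> r" for i j
    unfolding rel_def using diff_Hom[OF comp_Hom[OF t[OF that] inj] inj] rI[OF that] by blast
  define S where "S = (\<lambda>(i, j). rel i j) ` r"
  have "r \<prec> U"
    using small_subset[OF small_Times directed_poset_subset[OF dir]] directed_poset_small[OF dir] by blast
  then have Ssmall: "S \<prec> U" unfolding S_def by (rule small_image)
  have SH: "f \<in> Hom C (Dom C f) P" if "f \<in> S" for f
    using that rel by (auto simp: S_def Hom_def)
  obtain L c where c: "c \<in> Hom C P L" "is_joint_cokernel C S c"
    using joint_cokernel_exists[OF Ssmall PO SH] by blast
  \<comment> \<open>Killing a relation means exactly that the components of \<open>h\<close> at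
    \<open>i\<close> and \<open>j\<close> satisfy the cocone condition.\<close>
  have kill: "h \<cdot> inj j \<cdot> amap D (i, j) = h \<cdot> inj i \<longleftrightarrow> h \<cdot> rel i j = Zero C (omap D i) M"
    if h: "h \<in> Hom C P M" and ij: "(i, j) \<in> r" for h M i j
  proof -
    note a = inj[OF rI(1)[OF ij]] and b = inj[OF rI(2)[OF ij]]
    note b' = comp_Hom[OF t[OF ij] b]
    show ?thesis
      unfolding rel_def comp_diff[OF b' a h] diff_eq_Zero[OF comp_Hom[OF b' h] comp_Hom[OF a h]]
      using assoc[OF t[OF ij] b h] by simp
  qed
  have "is_direct_limit C I r D L (\<lambda>i. c \<cdot> inj i)"
  proof (rule direct_limitI)
    have "c \<cdot> inj j \<cdot> amap D (i, j) = c \<cdot> inj i" if ij: "(i, j) \<in> r" for i j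
    proof -
      have "rel i j \<in> S" using ij by (auto simp: S_def)
      then show ?thesis
        using kill[OF c(1) ij] joint_cokernel_zero[OF c(2,1) _ rel[OF ij]] by simp
    qed
    then show "is_limit_cocone C I r D L (\<lambda>i. c \<cdot> inj i)"
      unfolding is_limit_cocone_def using HomD(5)[OF c(1)] comp_Hom[OF inj c(1)] by simp
  next
    fix M \<mu> assume M: "is_limit_cocone C I r D M \<mu>"
    then have MO: "M \<in> Obj C" and \<mu>: "\<And>i. i \<in> I \<Longrightarrow> \<mu> i \<in> Hom C (omap D i) M"
      and comp: "\<And>i j. (i, j) \<in> r \<Longrightarrow> \<mu> j \<cdot> amap D (i, j) = \<mu> i"
      by (auto simp: is_limit_cocone_def)
    obtain h where h: "h \<in> Hom C P M" "\<And>i. i \<in> I \<Longrightarrow> h \<cdot> inj i = \<mu> i"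
      using coproduct_factor[OF P MO \<mu>] by blast
    have "h \<cdot> f = Zero C (Dom C f) M" if f: "f \<in> S" for f
    proof -
      obtain i j where ij: "(i, j) \<in> r" "f = rel i j" using f by (auto simp: S_def)
      then show ?thesis
        using kill[OF h(1) ij(1)] h(2) rI[OF ij(1)] comp[OF ij(1)] rel[OF ij(1)] by (simp add: Hom_def)
    qed
    then obtain u where u: "u \<in> Hom C L M" "u \<cdot> c = h"
      using joint_cokernel_factor[OF c(2,1) h(1)] by blast
    have "u \<cdot> (c \<cdot> inj i) = \<mu> i" if "i \<in> I" for i
      using assoc[OF inj[OF that] c(1) u(1)] u(2) h(2)[OF that] by simp
    then show "\<exists>h. h \<in> Hom C L M \<and> (\<forall>i\<in>I. h \<cdot> (c \<cdot> inj i) = \<mu> i)" using u(1) by blast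
  next
    fix M h k assume hk: "h \<in> Hom C L M" "k \<in> Hom C L M"
      and eq: "\<And>i. i \<in> I \<Longrightarrow> h \<cdot> (c \<cdot> inj i) = k \<cdot> (c \<cdot> inj i)"
    have "h \<cdot> c = k \<cdot> c"
    proof (rule coproduct_eqI[OF P comp_Hom[OF c(1) hk(1)] comp_Hom[OF c(1) hk(2)]])
      fix i assume i: "i \<in> I"
      show "h \<cdot> c \<cdot> inj i = k \<cdot> c \<cdot> inj i"
        using eq[OF i] assoc[OF inj[OF i] c(1) hk(1)] assoc[OF inj[OF i] c(1) hk(2)] by simp
    qed
    then show "h = k" using epi_cancel[OF joint_cokernel_epi[OF c(2)] c(1) hk] by simp
  qed
  moreover have "S \<subseteq> {f. \<exists>i\<in>I. f \<in> Hom C (omap D i) P}"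
  proof
    fix f assume "f \<in> S"
    then obtain i j where ij: "(i, j) \<in> r" "f = rel i j" by (auto simp: S_def)
    then show "f \<in> {f. \<exists>i\<in>I. f \<in> Hom C (omap D i) P}" using rel[OF ij(1)] rI(1)[OF ij(1)] by blast
  qed
  ultimately show ?thesis using that P Ssmall c by blast
qed

lemma direct_limit_exists:
  assumes "direct_system U C I r D" obtains L \<iota> where "is_direct_limit C I r D L \<iota>"
  using direct_limit_presentation[OF assms] by metis

lemma direct_limits_subset_Pres: "direct_limits_of U C T \<subseteq> Pres U C T"
proof
  fix X assume "X \<in> direct_limits_of U C T"
  then obtain I r D L \<iota> where ds: "direct_system U C I r D" and T: "\<forall>i\<in>I. omap D i \<in> T"
    and L: "is_direct_limit C I r D L \<iota>" and X: "isomorphic C X L"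
    unfolding direct_limits_of_def by blast
  obtain P inj S c M where P: "is_coproduct C I (omap D) P inj" "S \<prec> U"
    and S: "S \<subseteq> {f. \<exists>i\<in>I. f \<in> Hom C (omap D i) P}"
    and c: "c \<in> Hom C P M" "is_joint_cokernel C S c" and M: "is_direct_limit C I r D M (\<lambda>i. c \<cdot> inj i)"
    using direct_limit_presentation[OF ds] by blast
  obtain f g where "f \<in> Hom C L M" "g \<in> Hom C M L" "g \<cdot> f = Ide C L" "f \<cdot> g = Ide C M"
    using direct_limit_unique[OF ds L M] by metis
  then have "isomorphic C X M" using X isomorphicI isomorphic_trans by blast
  moreover have "Dom C f \<in> T" if "f \<in> S" for f using that S T by (auto simp: Hom_def)
  ultimately show "X \<in> Pres U C T"
    using Pres_joint_cokernel[OF P(1) directed_poset_small[OF direct_system_directed[OF ds]] _ P(2) _ c] T by blast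
qed

section \<open>Presentations as direct limits\<close>

text \<open>A coproduct is the direct limit of its finite subcoproducts. The result is phrased over
  \<open>Fpow J\<close> itself, since a direct system would have to be indexed in \<open>'u\<close>;
  the last two facts are existence and uniqueness in the universal property.\<close>

lemma finite_subcoproducts:
  fixes J :: "'j set"
  assumes Q: "is_coproduct C J G Q \<kappa>" and J: "J \<prec> U" and G: "\<And>j. j \<in> J \<Longrightarrow> G j \<in> fp U C"
  obtains N e s where
    "\<And>T. T \<in> Fpow J \<Longrightarrow> N T \<in> fp U C"
    "\<And>T. T \<in> Fpow J \<Longrightarrow> e T \<in> Hom C (N T) Q"
    "\<And>T T'. T \<in> Fpow J \<Longrightarrow> T' \<in> Fpow J \<Longrightarrow> T \<subseteq> T' \<Longrightarrow> s T T' \<in> Hom C (N T) (N T')"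
    "\<And>T. T \<in> Fpow J \<Longrightarrow> s T T = Ide C (N T)"
    "\<And>T T'. T \<in> Fpow J \<Longrightarrow> T' \<in> Fpow J \<Longrightarrow> T \<subseteq> T' \<Longrightarrow> e T' \<cdot> s T T' = e T"
    "\<And>T T' T''. T \<in> Fpow J \<Longrightarrow> T' \<in> Fpow J \<Longrightarrow> T'' \<in> Fpow J \<Longrightarrow> T \<subseteq> T' \<Longrightarrow> T' \<subseteq> T'' \<Longrightarrow>
      s T' T'' \<cdot> s T T' = s T T''"
    "\<And>M \<mu>. M \<in> Obj C \<Longrightarrow> (\<And>T. T \<in> Fpow J \<Longrightarrow> \<mu> T \<in> Hom C (N T) M) \<Longrightarrow>
      (\<And>T T'. T \<in> Fpow J \<Longrightarrow> T' \<in> Fpow J \<Longrightarrow> T \<subseteq> T' \<Longrightarrow> \<mu> T' \<cdot> s T T' = \<mu> T) \<Longrightarrow>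
      \<exists>h\<in>Hom C Q M. \<forall>T\<in>Fpow J. h \<cdot> e T = \<mu> T"
    "\<And>M h k. h \<in> Hom C Q M \<Longrightarrow> k \<in> Hom C Q M \<Longrightarrow> (\<And>T. T \<in> Fpow J \<Longrightarrow> h \<cdot> e T = k \<cdot> e T) \<Longrightarrow> h = k"
proof -
  note QO = coproduct_Obj[OF Q] and \<kappa> = coproduct_in[OF Q]
  have TJ: "j \<in> J" if "T \<in> Fpow J" "j \<in> T" for T j using that by (auto simp: Fpow_def)
  have "\<exists>P \<iota>. is_coproduct C T G P \<iota>" if T: "T \<in> Fpow J" for T
  proof -
    have "T \<prec> U" using T small_finite by (auto simp: Fpow_def)
    then show ?thesis using coproduct_exists[of T G] fp_Obj[OF G[OF TJ[OF T]]] by metis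
  qed
  then obtain N inj where N: "\<And>T. T \<in> Fpow J \<Longrightarrow> is_coproduct C T G (N T) (inj T)" by metis
  note NO = coproduct_Obj[OF N] and inj = coproduct_in[OF N]
  have "\<exists>e. e \<in> Hom C (N T) Q \<and> (\<forall>j\<in>T. e \<cdot> inj T j = \<kappa> j)" if T: "T \<in> Fpow J" for T
    using coproduct_factor[OF N[OF T] QO \<kappa>[OF TJ[OF T]]] by metis
  then obtain e where e: "\<And>T. T \<in> Fpow J \<Longrightarrow> e T \<in> Hom C (N T) Q"
      "\<And>T j. T \<in> Fpow J \<Longrightarrow> j \<in> T \<Longrightarrow> e T \<cdot> inj T j = \<kappa> j" by metis
  have "\<exists>s. s \<in> Hom C (N T) (N T') \<and> (\<forall>j\<in>T. s \<cdot> inj T j = inj T' j)"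
    if T: "T \<in> Fpow J" "T' \<in> Fpow J" "T \<subseteq> T'" for T T'
    using coproduct_factor[OF N[OF T(1)] NO[OF T(2)], of "inj T'"] inj[OF T(2)] T(3) by (metis subsetD)
  then obtain s where s: "\<And>T T'. T \<in> Fpow J \<Longrightarrow> T' \<in> Fpow J \<Longrightarrow> T \<subseteq> T' \<Longrightarrow> s T T' \<in> Hom C (N T) (N T')"
      "\<And>T T' j. T \<in> Fpow J \<Longrightarrow> T' \<in> Fpow J \<Longrightarrow> T \<subseteq> T' \<Longrightarrow> j \<in> T \<Longrightarrow> s T T' \<cdot> inj T j = inj T' j"
    by metis
  have single: "{j} \<in> Fpow J" if "j \<in> J" for j using that by (auto simp: Fpow_def)
  show ?thesis
  proof (rule that[of N e s])
    show "N T \<in> fp U C" if T: "T \<in> Fpow J" for T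
      using fp_finite_coproduct[OF N[OF T]] T G[OF TJ[OF T]] by (auto simp: Fpow_def)
    show "s T T = Ide C (N T)" if T: "T \<in> Fpow J" for T
    proof (rule coproduct_eqI[OF N[OF T] s(1)[OF T T] Ide_Hom[OF NO[OF T]]])
      show "s T T \<cdot> inj T j = Ide C (N T) \<cdot> inj T j" if j: "j \<in> T" for j
        using s(2)[OF T T _ j] Hom_Ide(2)[OF inj[OF T j]] by simp
    qed simp
    show "e T' \<cdot> s T T' = e T" if T: "T \<in> Fpow J" "T' \<in> Fpow J" "T \<subseteq> T'" for T T'
    proof (rule coproduct_eqI[OF N[OF T(1)] comp_Hom[OF s(1)[OF T] e(1)[OF T(2)]] e(1)[OF T(1)]])
      show "e T' \<cdot> s T T' \<cdot> inj T j = e T \<cdot> inj T j" if j: "j \<in> T" for j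
        using assoc[OF inj[OF T(1) j] s(1)[OF T] e(1)[OF T(2)]] s(2)[OF T j] e(2)[OF T(1) j]
          e(2)[OF T(2), of j] j T(3) by auto
    qed
    show "s T' T'' \<cdot> s T T' = s T T''"
      if T: "T \<in> Fpow J" "T' \<in> Fpow J" "T'' \<in> Fpow J" "T \<subseteq> T'" "T' \<subseteq> T''" for T T' T''
    proof -
      note s1 = s(1)[OF T(1,2,4)] and s2 = s(1)[OF T(2,3,5)]
      have TT: "T \<subseteq> T''" using T by simp
      show ?thesis
      proof (rule coproduct_eqI[OF N[OF T(1)] comp_Hom[OF s1 s2] s(1)[OF T(1,3) TT]])
        show "s T' T'' \<cdot> s T T' \<cdot> inj T j = s T T'' \<cdot> inj T j" if j: "j \<in> T" for j
        proof -
          have j': "j \<in> T'" using j T(4) by blast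
          show ?thesis
            using assoc[OF inj[OF T(1) j] s1 s2] s(2)[OF T(1,2,4) j] s(2)[OF T(2,3,5) j'] s(2)[OF T(1,3) TT j]
            by simp
        qed
      qed
    qed
    show "\<exists>h\<in>Hom C Q M. \<forall>T\<in>Fpow J. h \<cdot> e T = \<mu> T"
      if M: "M \<in> Obj C" and \<mu>: "\<And>T. T \<in> Fpow J \<Longrightarrow> \<mu> T \<in> Hom C (N T) M"
        and \<mu>s: "\<And>T T'. T \<in> Fpow J \<Longrightarrow> T' \<in> Fpow J \<Longrightarrow> T \<subseteq> T' \<Longrightarrow> \<mu> T' \<cdot> s T T' = \<mu> T" for M \<mu>
    proof -
      \<comment> \<open>A cocone on the finite subcoproducts is determined by its values on the
        singletons, which prescribe the map on each summand.\<close>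
      have "\<mu> {j} \<cdot> inj {j} j \<in> Hom C (G j) M" if "j \<in> J" for j
        using comp_Hom[OF inj \<mu>] single[OF that] by blast
      then obtain h where h: "h \<in> Hom C Q M" "\<And>j. j \<in> J \<Longrightarrow> h \<cdot> \<kappa> j = \<mu> {j} \<cdot> inj {j} j"
        using coproduct_factor[OF Q M, of "\<lambda>j. \<mu> {j} \<cdot> inj {j} j"] by blast
      have "h \<cdot> e T = \<mu> T" if T: "T \<in> Fpow J" for T
      proof (rule coproduct_eqI[OF N[OF T] comp_Hom[OF e(1)[OF T] h(1)] \<mu>[OF T]])
        fix j assume j: "j \<in> T"
        then have sub: "{j} \<subseteq> T" by simp
        note jJ = TJ[OF T j]
        note sg = single[OF jJ]
        have jj: "j \<in> {j}" by simp
        have "\<mu> T \<cdot> inj T j = \<mu> T \<cdot> (s {j} T \<cdot> inj {j} j)" using s(2)[OF sg T sub jj] by simp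
        also have "\<dots> = \<mu> {j} \<cdot> inj {j} j"
          using comp_reduce[OF \<mu>s[OF sg T sub] s(1)[OF sg T sub] \<mu>[OF T] inj[OF sg jj]] .
        finally show "h \<cdot> e T \<cdot> inj T j = \<mu> T \<cdot> inj T j"
          using assoc[OF inj[OF T j] e(1)[OF T] h(1)] e(2)[OF T j] h(2)[OF jJ] by simp
      qed
      then show ?thesis using h(1) by blast
    qed
    show "h = k" if hk: "h \<in> Hom C Q M" "k \<in> Hom C Q M" and eq: "\<And>T. T \<in> Fpow J \<Longrightarrow> h \<cdot> e T = k \<cdot> e T" for M h k
    proof (rule coproduct_eqI[OF Q hk])
      fix j assume j: "j \<in> J"
      note sg = single[OF j]
      have jj: "j \<in> {j}" by simp
      show "h \<cdot> \<kappa> j = k \<cdot> \<kappa> j"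
        using assoc[OF inj[OF sg jj] e(1)[OF sg] hk(1)] assoc[OF inj[OF sg jj] e(1)[OF sg] hk(2)]
          eq[OF sg] e(2)[OF sg jj] by simp
    qed
  qed (use s e in blast)+
qed

lemma Fpow_directed:
  fixes J :: "'j set"
  assumes "I \<prec> U" "bij_betw d I (Fpow J)"
  shows "directed_poset U I {(i, j). i \<in> I \<and> j \<in> I \<and> d i \<subseteq> d j}"
proof (rule directed_poset_pullback[OF assms])
  show "Fpow J \<noteq> {}" by (auto simp: Fpow_def)
  show "\<exists>z\<in>Fpow J. x \<subseteq> z \<and> y \<subseteq> z" if "x \<in> Fpow J" "y \<in> Fpow J" for x y
    using that by (intro bexI[of _ "x \<union> y"]) (auto simp: Fpow_def)
qed auto

text \<open>The direct system consists of the quotients of finite subcoproducts of Q by finitely many of the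
  relations in S, each of which factors through some finite subcoproduct.\<close>
lemma joint_cokernel_direct_limit:
  fixes J :: "'j set"
  assumes Q: "is_coproduct C J G Q \<kappa>" and J: "J \<prec> U" and G: "\<And>j. j \<in> J \<Longrightarrow> G j \<in> fp U C"
    and S: "S \<prec> U" "\<And>f. f \<in> S \<Longrightarrow> Dom C f \<in> fp U C"
    and c: "c \<in> Hom C Q X" "is_joint_cokernel C S c"
  obtains I r D \<iota> where "direct_system U C I r D" "is_direct_limit C I r D X \<iota>"
    "\<And>i. i \<in> I \<Longrightarrow> omap D i \<in> fp U C"
    "\<And>i. i \<in> I \<Longrightarrow> \<exists>N\<in>fp U C. \<exists>\<pi>\<in>Hom C N (omap D i). \<exists>e\<in>Hom C N Q. epi_arr C \<pi> \<and> \<iota> i \<cdot> \<pi> = c \<cdot> e"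
proof -
  obtain N e s where N: "\<And>T. T \<in> Fpow J \<Longrightarrow> N T \<in> fp U C"
    and e: "\<And>T. T \<in> Fpow J \<Longrightarrow> e T \<in> Hom C (N T) Q"
    and s: "\<And>T T'. T \<in> Fpow J \<Longrightarrow> T' \<in> Fpow J \<Longrightarrow> T \<subseteq> T' \<Longrightarrow> s T T' \<in> Hom C (N T) (N T')"
    and s_id: "\<And>T. T \<in> Fpow J \<Longrightarrow> s T T = Ide C (N T)"
    and es: "\<And>T T'. T \<in> Fpow J \<Longrightarrow> T' \<in> Fpow J \<Longrightarrow> T \<subseteq> T' \<Longrightarrow> e T' \<cdot> s T T' = e T"
    and ss: "\<And>T T' T''. T \<in> Fpow J \<Longrightarrow> T' \<in> Fpow J \<Longrightarrow> T'' \<in> Fpow J \<Longrightarrow> T \<subseteq> T' \<Longrightarrow> T' \<subseteq> T'' \<Longrightarrow>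
      s T' T'' \<cdot> s T T' = s T T''"
    and ex: "\<And>M \<mu>. M \<in> Obj C \<Longrightarrow> (\<And>T. T \<in> Fpow J \<Longrightarrow> \<mu> T \<in> Hom C (N T) M) \<Longrightarrow>
      (\<And>T T'. T \<in> Fpow J \<Longrightarrow> T' \<in> Fpow J \<Longrightarrow> T \<subseteq> T' \<Longrightarrow> \<mu> T' \<cdot> s T T' = \<mu> T) \<Longrightarrow>
      \<exists>h\<in>Hom C Q M. \<forall>T\<in>Fpow J. h \<cdot> e T = \<mu> T"
    and uniq: "\<And>M h k. h \<in> Hom C Q M \<Longrightarrow> k \<in> Hom C Q M \<Longrightarrow> (\<And>T. T \<in> Fpow J \<Longrightarrow> h \<cdot> e T = k \<cdot> e T) \<Longrightarrow> h = k"
    using finite_subcoproducts[OF Q J G] by blast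
  \<comment> \<open>Finite presentation of \<open>F\<close> is applied to \<open>Q\<close> as the
    direct limit of the \<open>N T\<close>, after coding \<open>Fpow J\<close> into
    \<open>'u\<close>: a map to \<open>Q\<close> only involves finitely many summands.\<close>
  have fac: "\<exists>T \<phi>. T \<in> Fpow J \<and> \<phi> \<in> Hom C F (N T) \<and> f = e T \<cdot> \<phi>" if F: "F \<in> fp U C" and f: "f \<in> Hom C F Q" for F f
  proof -
    obtain I :: "'u set" and d where I: "I \<prec> U" "bij_betw d I (Fpow J)"
      using small_encode[OF small_Fpow[OF J]] by blast
    have d: "d i \<in> Fpow J" if "i \<in> I" for i using I(2) that by (auto simp: bij_betw_def)
    have dsurj: "\<exists>i\<in>I. T = d i" if "T \<in> Fpow J" for T using I(2) that by (auto simp: bij_betw_def)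
    define r where "r = {(i, j). i \<in> I \<and> j \<in> I \<and> d i \<subseteq> d j}"
    have rD: "i \<in> I" "j \<in> I" "d i \<subseteq> d j" if "(i, j) \<in> r" for i j using that by (auto simp: r_def)
    define D where "D = \<lparr>omap = \<lambda>i. N (d i), amap = \<lambda>(i, j). s (d i) (d j)\<rparr>"
    have D: "omap D i = N (d i)" "amap D (i, j) = s (d i) (d j)" for i j by (simp_all add: D_def)
    have ds: "direct_system U C I r D"
    proof (rule direct_systemI)
      show "directed_poset U I r" unfolding r_def by (rule Fpow_directed[OF I])
      show "amap D (i, k) = amap D (j, k) \<cdot> amap D (i, j)" if "(i, j) \<in> r" "(j, k) \<in> r" for i j k
        unfolding D using ss d rD[OF that(1)] rD[OF that(2)] by simp
      show "amap D (i, j) \<in> Hom C (omap D i) (omap D j)" if "(i, j) \<in> r" for i j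
        unfolding D using s d rD[OF that] by blast
    qed (auto simp: D s_id d fp_Obj N)
    have lim: "is_direct_limit C I r D Q (\<lambda>i. e (d i))"
    proof (rule direct_limitI)
      have "e (d j) \<cdot> s (d i) (d j) = e (d i)" if "(i, j) \<in> r" for i j
        using es d rD[OF that] by blast
      then show "is_limit_cocone C I r D Q (\<lambda>i. e (d i))"
        unfolding is_limit_cocone_def D using coproduct_Obj[OF Q] e d by blast
    next
      fix M \<mu> assume M: "is_limit_cocone C I r D M \<mu>"
      define g where "g = inv_into I d"
      have gI: "g T \<in> I" "d (g T) = T" if "T \<in> Fpow J" for T
        using I(2) that by (auto simp: g_def bij_betw_def f_inv_into_f inv_into_into)
      have gd: "g (d i) = i" if "i \<in> I" for i using I(2) that by (simp add: g_def bij_betw_def)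
      have "\<exists>h\<in>Hom C Q M. \<forall>T\<in>Fpow J. h \<cdot> e T = \<mu> (g T)"
      proof (rule ex)
        show "M \<in> Obj C" using M by (simp add: is_limit_cocone_def)
        show "\<mu> (g T) \<in> Hom C (N T) M" if "T \<in> Fpow J" for T
          using M gI[OF that] unfolding is_limit_cocone_def D by metis
        show "\<mu> (g T') \<cdot> s T T' = \<mu> (g T)" if "T \<in> Fpow J" "T' \<in> Fpow J" "T \<subseteq> T'" for T T'
        proof -
          have "(g T, g T') \<in> r" using gI[OF that(1)] gI[OF that(2)] that(3) by (simp add: r_def)
          then have "\<mu> (g T') \<cdot> s (d (g T)) (d (g T')) = \<mu> (g T)"
            using M unfolding is_limit_cocone_def D by blast
          then show ?thesis using gI that by simp
        qed
      qed
      then show "\<exists>h. h \<in> Hom C Q M \<and> (\<forall>i\<in>I. h \<cdot> e (d i) = \<mu> i)" using gd d by metis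
    next
      fix M h k assume hk: "h \<in> Hom C Q M" "k \<in> Hom C Q M" and eq: "\<And>i. i \<in> I \<Longrightarrow> h \<cdot> e (d i) = k \<cdot> e (d i)"
      show "h = k" by (rule uniq[OF hk]) (use eq dsurj in metis)
    qed
    show ?thesis using fp_factor[OF F ds lim f] d unfolding D by metis
  qed
  have SQ: "f \<in> Hom C (Dom C f) Q" if "f \<in> S" for f using joint_cokernel_Hom[OF c(2,1) that] .
  have "\<forall>f\<in>S. \<exists>T \<phi>. T \<in> Fpow J \<and> \<phi> \<in> Hom C (Dom C f) (N T) \<and> f = e T \<cdot> \<phi>"
    using fac S(2) SQ by blast
  then obtain Tf \<phi> where Tf: "\<And>f. f \<in> S \<Longrightarrow> Tf f \<in> Fpow J"
    and \<phi>: "\<And>f. f \<in> S \<Longrightarrow> \<phi> f \<in> Hom C (Dom C f) (N (Tf f))" and f\<phi>: "\<And>f. f \<in> S \<Longrightarrow> f = e (Tf f) \<cdot> \<phi> f"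
    by metis
  \<comment> \<open>An index is a finite set of relations with a finite set of generators. The
    condition on \<open>Tf\<close> says that each of these relations, in its chosen factorization,
    already lives on the chosen generators.\<close>
  define K where "K = {p. fst p \<in> Fpow S \<and> snd p \<in> Fpow J \<and> (\<forall>f\<in>fst p. Tf f \<subseteq> snd p)}"
  \<comment> \<open>The relations in \<open>fst p\<close>, read as maps into the subcoproduct on
    \<open>snd p\<close>.\<close>
  define R where "R p = (\<lambda>f. s (Tf f) (snd p) \<cdot> \<phi> f) ` fst p" for p
  have K: "finite (fst p)" "fst p \<subseteq> S" "snd p \<in> Fpow J" if "p \<in> K" for p
    using that by (auto simp: K_def Fpow_def)
  have KT: "f \<in> S" "Tf f \<in> Fpow J" "Tf f \<subseteq> snd p" if "p \<in> K" "f \<in> fst p" for p f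
    using that Tf by (auto simp: K_def Fpow_def)
  have RH: "s (Tf f) (snd p) \<cdot> \<phi> f \<in> Hom C (Dom C f) (N (snd p))" if p: "p \<in> K" and f: "f \<in> fst p" for p f
    using comp_Hom[OF \<phi>[OF KT(1)[OF p f]] s[OF KT(2)[OF p f] K(3)[OF p] KT(3)[OF p f]]] .
  have RH': "g \<in> Hom C (Dom C g) (N (snd p))" "Dom C g \<in> fp U C" if p: "p \<in> K" and g: "g \<in> R p" for p g
  proof -
    obtain f where f: "f \<in> fst p" "g = s (Tf f) (snd p) \<cdot> \<phi> f" using g by (auto simp: R_def)
    have *: "g \<in> Hom C (Dom C f) (N (snd p))" using RH[OF p f(1)] f(2) by simp
    then have "Dom C g = Dom C f" by (simp add: Hom_def)
    then show "g \<in> Hom C (Dom C g) (N (snd p))" "Dom C g \<in> fp U C" using * S(2) KT(1)[OF p f(1)] by auto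
  qed
  have "\<exists>V \<pi>. \<pi> \<in> Hom C (N (snd p)) V \<and> is_joint_cokernel C (R p) \<pi>" if p: "p \<in> K" for p
  proof -
    have "R p \<prec> U" unfolding R_def by (intro small_finite finite_imageI K(1)[OF p])
    then show ?thesis using joint_cokernel_exists[OF _ fp_Obj[OF N[OF K(3)[OF p]]] RH'(1)[OF p]] by blast
  qed
  then obtain V \<pi> where \<pi>: "\<And>p. p \<in> K \<Longrightarrow> \<pi> p \<in> Hom C (N (snd p)) (V p)"
    and V: "\<And>p. p \<in> K \<Longrightarrow> is_joint_cokernel C (R p) (\<pi> p)" by metis
  note \<pi>epi = epi_cancel[OF joint_cokernel_epi[OF V] \<pi>]
  have VO: "V p \<in> Obj C" if "p \<in> K" for p using HomD(5)[OF \<pi>[OF that]] .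
  have Vfp: "V p \<in> fp U C" if p: "p \<in> K" for p
    using fp_joint_cokernel[OF N[OF K(3)[OF p]] _ RH'(2)[OF p] \<pi>[OF p] V[OF p]] K(1)[OF p] by (simp add: R_def)
  have \<pi>R: "\<pi> p \<cdot> (s (Tf f) (snd p) \<cdot> \<phi> f) = Zero C (Dom C f) (V p)" if p: "p \<in> K" and f: "f \<in> fst p" for p f
    using joint_cokernel_zero[OF V[OF p] \<pi>[OF p] _ RH[OF p f]] f by (simp add: R_def)
  define leq where "leq p q \<longleftrightarrow> fst p \<subseteq> fst q \<and> snd p \<subseteq> snd q" for p q :: "'m set \<times> 'j set"
  have "\<exists>t. t \<in> Hom C (V p) (V q) \<and> t \<cdot> \<pi> p = \<pi> q \<cdot> s (snd p) (snd q)"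
    if p: "p \<in> K" and q: "q \<in> K" and pq: "leq p q" for p q
  proof -
    have pq': "snd p \<subseteq> snd q" "fst p \<subseteq> fst q" using pq by (auto simp: leq_def)
    note spq = s[OF K(3)[OF p] K(3)[OF q] pq'(1)]
    have "\<pi> q \<cdot> s (snd p) (snd q) \<cdot> g = Zero C (Dom C g) (V q)" if g: "g \<in> R p" for g
    proof -
      obtain f where f: "f \<in> fst p" "g = s (Tf f) (snd p) \<cdot> \<phi> f" using g by (auto simp: R_def)
      note kt = KT[OF p f(1)]
      have fq: "f \<in> fst q" using f pq' by blast
      have "s (snd p) (snd q) \<cdot> g = s (Tf f) (snd q) \<cdot> \<phi> f"
        using comp_reduce[OF ss[OF kt(2) K(3)[OF p] K(3)[OF q] kt(3) pq'(1)] s[OF kt(2) K(3)[OF p] kt(3)]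
            spq \<phi>[OF kt(1)]] f(2) by simp
      then show ?thesis
        using assoc[OF RH'(1)[OF p g] spq \<pi>[OF q]] \<pi>R[OF q fq] RH[OF p f(1)] f(2) by (simp add: Hom_def)
    qed
    then show ?thesis using joint_cokernel_factor[OF V[OF p] \<pi>[OF p] comp_Hom[OF spq \<pi>[OF q]]] by metis
  qed
  then obtain t where t: "\<And>p q. p \<in> K \<Longrightarrow> q \<in> K \<Longrightarrow> leq p q \<Longrightarrow> t p q \<in> Hom C (V p) (V q)"
    and t\<pi>: "\<And>p q. p \<in> K \<Longrightarrow> q \<in> K \<Longrightarrow> leq p q \<Longrightarrow> t p q \<cdot> \<pi> p = \<pi> q \<cdot> s (snd p) (snd q)" by metis
  have "\<exists>i. i \<in> Hom C (V p) X \<and> i \<cdot> \<pi> p = c \<cdot> e (snd p)" if p: "p \<in> K" for p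
  proof -
    note ep = e[OF K(3)[OF p]]
    have "c \<cdot> e (snd p) \<cdot> g = Zero C (Dom C g) X" if g: "g \<in> R p" for g
    proof -
      obtain f where f: "f \<in> fst p" "g = s (Tf f) (snd p) \<cdot> \<phi> f" using g by (auto simp: R_def)
      note kt = KT[OF p f(1)]
      have "e (snd p) \<cdot> g = f"
        using comp_reduce[OF es[OF kt(2) K(3)[OF p] kt(3)] s[OF kt(2) K(3)[OF p] kt(3)] ep \<phi>[OF kt(1)]]
          f(2) f\<phi>[OF kt(1)] by simp
      then show ?thesis
        using assoc[OF RH'(1)[OF p g] ep c(1)] joint_cokernel_zero[OF c(2,1) kt(1) SQ[OF kt(1)]]
          RH[OF p f(1)] f(2) by (simp add: Hom_def)
    qed
    then show ?thesis using joint_cokernel_factor[OF V[OF p] \<pi>[OF p] comp_Hom[OF ep c(1)]] by metis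
  qed
  then obtain \<iota> where \<iota>: "\<And>p. p \<in> K \<Longrightarrow> \<iota> p \<in> Hom C (V p) X"
    and \<iota>\<pi>: "\<And>p. p \<in> K \<Longrightarrow> \<iota> p \<cdot> \<pi> p = c \<cdot> e (snd p)" by metis
  have t_id: "t p p = Ide C (V p)" if p: "p \<in> K" for p
  proof -
    have pp: "leq p p" by (simp add: leq_def)
    have "t p p \<cdot> \<pi> p = Ide C (V p) \<cdot> \<pi> p"
      using t\<pi>[OF p p pp] s_id[OF K(3)[OF p]] \<pi>[OF p] by (simp add: Hom_Ide)
    then show ?thesis using \<pi>epi[OF p p t[OF p p pp] Ide_Hom[OF VO[OF p]]] by simp
  qed
  have t_comp: "t p w = t q w \<cdot> t p q" if p: "p \<in> K" and q: "q \<in> K" and w: "w \<in> K" and pq: "leq p q" and qw: "leq q w" for p q w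
  proof -
    have pw: "leq p w" using pq qw by (auto simp: leq_def)
    have sub: "snd p \<subseteq> snd q" "snd q \<subseteq> snd w" using pq qw by (auto simp: leq_def)
    note spq = s[OF K(3)[OF p] K(3)[OF q] sub(1)]
    have "t q w \<cdot> t p q \<cdot> \<pi> p = t q w \<cdot> (\<pi> q \<cdot> s (snd p) (snd q))"
      using assoc[OF \<pi>[OF p] t[OF p q pq] t[OF q w qw]] t\<pi>[OF p q pq] by simp
    also have "\<dots> = \<pi> w \<cdot> s (snd q) (snd w) \<cdot> s (snd p) (snd q)"
      using comp_reduce[OF t\<pi>[OF q w qw] \<pi>[OF q] t[OF q w qw] spq] .
    also have "\<dots> = \<pi> w \<cdot> (s (snd q) (snd w) \<cdot> s (snd p) (snd q))"
      using assoc[OF spq s[OF K(3)[OF q] K(3)[OF w] sub(2)] \<pi>[OF w]] .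
    also have "\<dots> = t p w \<cdot> \<pi> p"
      using ss[OF K(3)[OF p] K(3)[OF q] K(3)[OF w] sub] t\<pi>[OF p w pw] by simp
    finally show ?thesis using \<pi>epi[OF p p t[OF p w pw] comp_Hom[OF t[OF p q pq] t[OF q w qw]]] by simp
  qed
  have \<iota>t: "\<iota> q \<cdot> t p q = \<iota> p" if p: "p \<in> K" and q: "q \<in> K" and pq: "leq p q" for p q
  proof -
    have sub: "snd p \<subseteq> snd q" using pq by (auto simp: leq_def)
    note spq = s[OF K(3)[OF p] K(3)[OF q] sub]
    have "\<iota> q \<cdot> t p q \<cdot> \<pi> p = \<iota> q \<cdot> (\<pi> q \<cdot> s (snd p) (snd q))"
      using assoc[OF \<pi>[OF p] t[OF p q pq] \<iota>[OF q]] t\<pi>[OF p q pq] by simp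
    also have "\<dots> = c \<cdot> e (snd q) \<cdot> s (snd p) (snd q)"
      using comp_reduce[OF \<iota>\<pi>[OF q] \<pi>[OF q] \<iota>[OF q] spq] .
    also have "\<dots> = \<iota> p \<cdot> \<pi> p"
      using assoc[OF spq e[OF K(3)[OF q]] c(1)] es[OF K(3)[OF p] K(3)[OF q] sub] \<iota>\<pi>[OF p] by simp
    finally show ?thesis using \<pi>epi[OF p p comp_Hom[OF t[OF p q pq] \<iota>[OF q]] \<iota>[OF p]] by simp
  qed
  \<comment> \<open>Indices without relations give access to the bare subcoproducts, and so to maps
    out of \<open>Q\<close>.\<close>
  have emp: "({}, T) \<in> K" if "T \<in> Fpow J" for T using that by (simp add: K_def Fpow_def)
  have lim_ex: "\<exists>u\<in>Hom C X M. \<forall>p\<in>K. u \<cdot> \<iota> p = \<mu> p"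
    if M: "M \<in> Obj C" and \<mu>: "\<And>p. p \<in> K \<Longrightarrow> \<mu> p \<in> Hom C (V p) M"
      and \<mu>t: "\<And>p q. p \<in> K \<Longrightarrow> q \<in> K \<Longrightarrow> leq p q \<Longrightarrow> \<mu> q \<cdot> t p q = \<mu> p" for M \<mu>
  proof -
    \<comment> \<open>Restricted to the indices without relations, the cocone becomes one on the
      finite subcoproducts and therefore induces a map \<open>h\<close> on \<open>Q\<close>. It
      remains to see that \<open>h\<close> kills \<open>S\<close>.\<close>
    define \<nu> where "\<nu> T = \<mu> ({}, T) \<cdot> \<pi> ({}, T)" for T
    have \<nu>: "\<nu> T \<in> Hom C (N T) M" if "T \<in> Fpow J" for T
      unfolding \<nu>_def using comp_Hom[OF \<pi>[OF emp[OF that]] \<mu>[OF emp[OF that]]] by simp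
    have \<mu>\<pi>: "\<mu> p \<cdot> \<pi> p \<cdot> s T (snd p) = \<nu> T" if p: "p \<in> K" and T: "T \<in> Fpow J" "T \<subseteq> snd p" for p T
    proof -
      have l: "leq ({}, T) p" using T by (simp add: leq_def)
      have "\<mu> p \<cdot> t ({}, T) p \<cdot> \<pi> ({}, T) = \<mu> p \<cdot> (\<pi> p \<cdot> s T (snd p))"
        using assoc[OF \<pi>[OF emp[OF T(1)]] t[OF emp[OF T(1)] p l] \<mu>[OF p]] t\<pi>[OF emp[OF T(1)] p l] by simp
      then show ?thesis
        using \<mu>t[OF emp[OF T(1)] p l] assoc[OF s[OF T(1) K(3)[OF p] T(2)] \<pi>[OF p] \<mu>[OF p]] by (simp add: \<nu>_def)
    qed
    have \<mu>\<nu>: "\<mu> p \<cdot> \<pi> p = \<nu> (snd p)" if p: "p \<in> K" for p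
      using \<mu>\<pi>[OF p K(3)[OF p]] s_id[OF K(3)[OF p]] Hom_Ide(1)[OF comp_Hom[OF \<pi>[OF p] \<mu>[OF p]]] by simp
    have "\<exists>h\<in>Hom C Q M. \<forall>T\<in>Fpow J. h \<cdot> e T = \<nu> T"
    proof (rule ex[OF M \<nu>])
      show "\<nu> T' \<cdot> s T T' = \<nu> T" if "T \<in> Fpow J" "T' \<in> Fpow J" "T \<subseteq> T'" for T T'
        using \<mu>\<pi>[OF emp[OF that(2)] that(1)] that(3) by (simp add: \<nu>_def)
    qed
    then obtain h where h: "h \<in> Hom C Q M" "\<And>T. T \<in> Fpow J \<Longrightarrow> h \<cdot> e T = \<nu> T" by blast
    have "h \<cdot> f = Zero C (Dom C f) M" if f: "f \<in> S" for f
    proof -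
      \<comment> \<open>At this index the relation \<open>f\<close> is itself imposed. As the cocone
        passes through that stage, \<open>h\<close> must kill \<open>f\<close>.\<close>
      have p: "({f}, Tf f) \<in> K" using f Tf[OF f] by (simp add: K_def Fpow_def)
      have "\<pi> ({f}, Tf f) \<cdot> \<phi> f = Zero C (Dom C f) (V ({f}, Tf f))"
        using \<pi>R[OF p, of f] s_id[OF Tf[OF f]] Hom_Ide(2)[OF \<phi>[OF f]] by simp
      moreover have "h \<cdot> f = \<nu> (Tf f) \<cdot> \<phi> f"
        using f\<phi>[OF f] assoc[OF \<phi>[OF f] e[OF Tf[OF f]] h(1)] h(2)[OF Tf[OF f]] by metis
      moreover have "\<nu> (Tf f) \<cdot> \<phi> f = \<mu> ({f}, Tf f) \<cdot> (\<pi> ({f}, Tf f) \<cdot> \<phi> f)"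
        using \<mu>\<nu>[OF p] assoc[OF _ \<pi>[OF p] \<mu>[OF p], of "\<phi> f"] \<phi>[OF f] by simp
      ultimately show ?thesis using comp_Zero[OF \<mu>[OF p] HomD(4)[OF SQ[OF f]]] by simp
    qed
    then obtain u where u: "u \<in> Hom C X M" "u \<cdot> c = h" using joint_cokernel_factor[OF c(2,1) h(1)] by blast
    have "u \<cdot> \<iota> p = \<mu> p" if p: "p \<in> K" for p
    proof -
      have "u \<cdot> \<iota> p \<cdot> \<pi> p = u \<cdot> (c \<cdot> e (snd p))" using assoc[OF \<pi>[OF p] \<iota>[OF p] u(1)] \<iota>\<pi>[OF p] by simp
      also have "\<dots> = \<mu> p \<cdot> \<pi> p"
        using comp_reduce[OF u(2) c(1) u(1) e[OF K(3)[OF p]]] h(2)[OF K(3)[OF p]] \<mu>\<nu>[OF p] by simp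
      finally show ?thesis using \<pi>epi[OF p p comp_Hom[OF \<iota>[OF p] u(1)] \<mu>[OF p]] by simp
    qed
    then show ?thesis using u(1) by blast
  qed
  have lim_uniq: "u = v" if uv: "u \<in> Hom C X M" "v \<in> Hom C X M" and eq: "\<And>p. p \<in> K \<Longrightarrow> u \<cdot> \<iota> p = v \<cdot> \<iota> p" for u v M
  proof -
    have "u \<cdot> c = v \<cdot> c"
    proof (rule uniq[OF comp_Hom[OF c(1) uv(1)] comp_Hom[OF c(1) uv(2)]])
      fix T assume T: "T \<in> Fpow J"
      note p = emp[OF T]
      have *: "w \<cdot> c \<cdot> e T = w \<cdot> \<iota> ({}, T) \<cdot> \<pi> ({}, T)" if "w \<in> Hom C X M" for w
        using assoc[OF e[OF T] c(1) that] assoc[OF \<pi>[OF p] \<iota>[OF p] that] \<iota>\<pi>[OF p] by simp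
      show "u \<cdot> c \<cdot> e T = v \<cdot> c \<cdot> e T" using *[OF uv(1)] *[OF uv(2)] eq[OF p] by simp
    qed
    then show ?thesis using epi_cancel[OF joint_cokernel_epi[OF c(2)] c(1) uv] by simp
  qed
  have "K \<subseteq> Fpow S \<times> Fpow J" by (auto simp: K_def)
  then have Ksmall: "K \<prec> U" using small_subset[OF small_Times[OF small_Fpow[OF S(1)] small_Fpow[OF J]]] by blast
  obtain I :: "'u set" and d where I: "I \<prec> U" "bij_betw d I K"
    using small_encode[OF Ksmall] by blast
  have d: "d i \<in> K" if "i \<in> I" for i using I(2) that by (auto simp: bij_betw_def)
  have dsurj: "\<exists>i\<in>I. p = d i" if "p \<in> K" for p using I(2) that by (auto simp: bij_betw_def)
  define r where "r = {(i, j). i \<in> I \<and> j \<in> I \<and> leq (d i) (d j)}"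
  have rD: "i \<in> I" "j \<in> I" "leq (d i) (d j)" if "(i, j) \<in> r" for i j using that by (auto simp: r_def)
  have dir: "directed_poset U I r"
    unfolding r_def
  proof (rule directed_poset_pullback[OF I])
    show "K \<noteq> {}" using emp[of "{}"] by (auto simp: Fpow_def)
    show "\<exists>z\<in>K. leq x z \<and> leq y z" if "x \<in> K" "y \<in> K" for x y
      using that by (intro bexI[of _ "(fst x \<union> fst y, snd x \<union> snd y)"]) (auto simp: leq_def K_def Fpow_def)
  qed (auto simp: leq_def prod_eq_iff)
  define D where "D = \<lparr>omap = \<lambda>i. V (d i), amap = \<lambda>(i, j). t (d i) (d j)\<rparr>"
  have D: "omap D i = V (d i)" "amap D (i, j) = t (d i) (d j)" for i j by (simp_all add: D_def)
  have ds: "direct_system U C I r D"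
  proof (rule direct_systemI[OF dir])
    show "amap D (i, k) = amap D (j, k) \<cdot> amap D (i, j)" if "(i, j) \<in> r" "(j, k) \<in> r" for i j k
      unfolding D using t_comp d rD[OF that(1)] rD[OF that(2)] by blast
    show "amap D (i, j) \<in> Hom C (omap D i) (omap D j)" if "(i, j) \<in> r" for i j
      unfolding D using t d rD[OF that] by blast
  qed (auto simp: D t_id d VO)
  have lim: "is_direct_limit C I r D X (\<lambda>i. \<iota> (d i))"
  proof (rule direct_limitI)
    have "\<iota> (d j) \<cdot> t (d i) (d j) = \<iota> (d i)" if "(i, j) \<in> r" for i j
      using \<iota>t d rD[OF that] by blast
    then show "is_limit_cocone C I r D X (\<lambda>i. \<iota> (d i))"
      unfolding is_limit_cocone_def D using HomD(5)[OF c(1)] \<iota> d by blast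
  next
    fix M \<mu> assume M: "is_limit_cocone C I r D M \<mu>"
    define g where "g = inv_into I d"
    have gI: "g p \<in> I" "d (g p) = p" if "p \<in> K" for p
      using I(2) that by (auto simp: g_def bij_betw_def f_inv_into_f inv_into_into)
    have gd: "g (d i) = i" if "i \<in> I" for i using I(2) that by (simp add: g_def bij_betw_def)
    have "\<exists>u\<in>Hom C X M. \<forall>p\<in>K. u \<cdot> \<iota> p = \<mu> (g p)"
    proof (rule lim_ex)
      show "M \<in> Obj C" using M by (simp add: is_limit_cocone_def)
      show "\<mu> (g p) \<in> Hom C (V p) M" if "p \<in> K" for p
        using M gI[OF that] unfolding is_limit_cocone_def D by metis
      show "\<mu> (g q) \<cdot> t p q = \<mu> (g p)" if "p \<in> K" "q \<in> K" "leq p q" for p q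
      proof -
        have "(g p, g q) \<in> r" using gI[OF that(1)] gI[OF that(2)] that(3) by (simp add: r_def)
        then have "\<mu> (g q) \<cdot> t (d (g p)) (d (g q)) = \<mu> (g p)"
          using M unfolding is_limit_cocone_def D by blast
        then show ?thesis using gI that by simp
      qed
    qed
    then show "\<exists>h. h \<in> Hom C X M \<and> (\<forall>i\<in>I. h \<cdot> \<iota> (d i) = \<mu> i)" using gd d by metis
  next
    fix M h k assume hk: "h \<in> Hom C X M" "k \<in> Hom C X M" and eq: "\<And>i. i \<in> I \<Longrightarrow> h \<cdot> \<iota> (d i) = k \<cdot> \<iota> (d i)"
    show "h = k" by (rule lim_uniq[OF hk]) (use eq dsurj in metis)
  qed
  show ?thesis
  proof (rule that[OF ds lim])
    fix i assume i: "i \<in> I"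
    note p = d[OF i]
    show "omap D i \<in> fp U C" unfolding D using Vfp[OF p] .
    \<comment> \<open>For the coreflection it is recorded that every structure map, after an
      epimorphism from a finitely presented object, factors through \<open>c\<close>.\<close>
    show "\<exists>N\<in>fp U C. \<exists>\<pi>\<in>Hom C N (omap D i). \<exists>e\<in>Hom C N Q. epi_arr C \<pi> \<and> \<iota> (d i) \<cdot> \<pi> = c \<cdot> e"
      unfolding D using N[OF K(3)[OF p]] \<pi>[OF p] e[OF K(3)[OF p]] joint_cokernel_epi[OF V[OF p]] \<iota>\<pi>[OF p]
      by blast
  qed
qed

lemma Pres_fp_eq: "Pres U C (fp U C) = direct_limits_of U C (fp U C)"
proof
  show "Pres U C (fp U C) \<subseteq> direct_limits_of U C (fp U C)"
  proof
    fix X assume "X \<in> Pres U C (fp U C)"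
    then obtain I J :: "'u set" and F G P Q \<iota> \<kappa> f c where
      I: "I \<prec> U" and J: "J \<prec> U" and F: "\<forall>i\<in>I. F i \<in> fp U C" and G: "\<forall>j\<in>J. G j \<in> fp U C"
      and P: "is_coproduct C I F P \<iota>" and Q: "is_coproduct C J G Q \<kappa>" and f: "f \<in> Hom C P Q"
      and c: "is_cokernel C c f" and X: "isomorphic C X (Cod C c)"
      unfolding Pres_def by blast
    have S: "Dom C g \<in> fp U C" if g: "g \<in> (\<lambda>i. f \<cdot> \<iota> i) ` I" for g
    proof -
      obtain i where i: "i \<in> I" "g = f \<cdot> \<iota> i" using g by blast
      then show ?thesis using comp_Hom[OF coproduct_in[OF P i(1)] f] F by (simp add: Hom_def)
    qed
    obtain K r D lam where K: "direct_system U C K r D" "is_direct_limit C K r D (Cod C c) lam"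
      "\<And>i. i \<in> K \<Longrightarrow> omap D i \<in> fp U C"
      by (rule joint_cokernel_direct_limit[OF Q J G[rule_format] small_image[OF I] S cokernelD(1)[OF c f]
          cokernel_coproduct[OF P f c]]) (assumption, assumption, rule that, assumption+)
    then show "X \<in> direct_limits_of U C (fp U C)" unfolding direct_limits_of_def using X by blast
  qed
qed (rule direct_limits_subset_Pres)

end

section \<open>Extensions\<close>

lemma short_exactD:
  assumes "short_exact C f g" shows "is_kernel C f g" "is_cokernel C g f"
  using assms by (auto simp: short_exact_def)

context cocomplete_abelian
begin

section \<open>Monomorphisms, epimorphisms and biproducts in an abelian category\<close>

lemma mono_zero:
  assumes "mono_arr C f" "f \<in> Hom C X Y" "x \<in> Hom C Z X" "f \<cdot> x = Zero C Z Y"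
  shows "x = Zero C Z X"
proof -
  note ZX = HomD(4)[OF assms(3)] HomD(4)[OF assms(2)]
  have "f \<cdot> Zero C Z X = f \<cdot> x" using comp_Zero[OF assms(2) ZX(1)] assms(4) by simp
  then show ?thesis using assms(1-3) Zero_Hom[OF ZX] unfolding mono_arr_def Hom_def by auto
qed

lemma kernel_mono: assumes "is_kernel C k f" shows "mono_arr C k"
proof -
  have "k \<in> Hom C (Dom C k) (Dom C f)" using assms by (auto simp: is_kernel_def Hom_def)
  then show ?thesis
    using kernel_cancel[OF assms] by (auto simp: mono_arr_def Hom_def)
qed

text \<open>Some \<open>g\<close> has \<open>f\<close> as its kernel. Since \<open>g\<close> kills
  \<open>f\<close>, it factors through \<open>c\<close>, so whatever \<open>c\<close> kills is
  killed by \<open>g\<close> and factors through \<open>f\<close>.\<close>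

lemma mono_kernel_cokernel:
  assumes f: "mono_arr C f" "f \<in> Hom C X Y" and c: "is_cokernel C c f"
  shows "is_kernel C f c"
proof -
  obtain g where g: "is_kernel C f g" using abelian f(1) unfolding abelian_category_def by blast
  have gH: "g \<in> Hom C Y (Cod C g)" using g f(2) by (auto simp: is_kernel_def Hom_def)
  note cH = cokernelD[OF c f(2)]
  obtain v where v: "v \<in> Hom C (Cod C c) (Cod C g)" "v \<cdot> c = g"
    using cokernel_factor[OF c f(2) gH] kernelD(2)[OF g gH] f(2) by (auto simp: Hom_def)
  have "\<exists>!u. u \<in> Hom C (Dom C h) (Dom C f) \<and> f \<cdot> u = h"
    if h: "h \<in> Arr C" "Cod C h = Dom C c" "c \<cdot> h = Zero C (Dom C h) (Cod C c)" for h
  proof -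
    have hH: "h \<in> Hom C (Dom C h) Y" using h cH(1) by (auto simp: Hom_def)
    have "g \<cdot> h = Zero C (Dom C h) (Cod C g)"
      using assoc[OF hH cH(1) v(1)] v(2) h(3) comp_Zero[OF v(1) HomD(4)[OF hH]] by simp
    then obtain u where u: "u \<in> Hom C (Dom C h) (Dom C f)" "f \<cdot> u = h"
      using kernel_factor[OF g gH hH] by blast
    show ?thesis
    proof (rule ex1I[of _ u])
      show "u' = u" if "u' \<in> Hom C (Dom C h) (Dom C f) \<and> f \<cdot> u' = h" for u'
        using kernel_cancel[OF g] that u by metis
    qed (use u in simp)
  qed
  then show ?thesis unfolding is_kernel_def using f(2) cH by (auto simp: Hom_def)
qed

text \<open>The dual argument: some \<open>g\<close> has \<open>f\<close> as its cokernel, and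
  \<open>g\<close> factors through \<open>k\<close>.\<close>

lemma epi_cokernel_kernel:
  assumes f: "epi_arr C f" "f \<in> Hom C X Y" and k: "is_kernel C k f"
  shows "is_cokernel C f k"
proof -
  obtain g where g: "is_cokernel C f g" using abelian f(1) unfolding abelian_category_def by blast
  have gH: "g \<in> Hom C (Dom C g) X" using g f(2) by (auto simp: is_cokernel_def Hom_def)
  note kH = kernelD[OF k f(2)]
  have fg: "f \<cdot> g = Zero C (Dom C g) Y" using cokernelD(2)[OF g gH] f(2) by (simp add: Hom_def)
  obtain v where v: "v \<in> Hom C (Dom C g) (Dom C k)" "k \<cdot> v = g"
    using kernel_factor[OF k f(2) gH fg] by blast
  have "\<exists>!u. u \<in> Hom C (Cod C f) (Cod C h) \<and> u \<cdot> f = h"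
    if h: "h \<in> Arr C" "Dom C h = Cod C k" "h \<cdot> k = Zero C (Dom C k) (Cod C h)" for h
  proof -
    have hH: "h \<in> Hom C X (Cod C h)" using h kH(1) by (auto simp: Hom_def)
    have "h \<cdot> g = Zero C (Dom C g) (Cod C h)"
      using assoc[OF v(1) kH(1) hH] v(2) h(3) Zero_comp[OF v(1) HomD(5)[OF hH]] by simp
    then obtain u where u: "u \<in> Hom C (Cod C f) (Cod C h)" "u \<cdot> f = h"
      using cokernel_factor[OF g gH hH] by blast
    have fH: "f \<in> Hom C X (Cod C f)" using f(2) by (simp add: Hom_def)
    show ?thesis
    proof (rule ex1I[of _ u])
      show "u' = u" if "u' \<in> Hom C (Cod C f) (Cod C h) \<and> u' \<cdot> f = h" for u'
        using epi_cancel[OF f(1) fH] that u by metis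
    qed (use u in simp)
  qed
  then show ?thesis unfolding is_cokernel_def using f(2) kH by (auto simp: Hom_def)
qed

lemma biproduct_exists:
  assumes "X \<in> Obj C" "Y \<in> Obj C"
  obtains P i j p q where "is_biproduct C X Y P i j p q"
  using abelian assms unfolding abelian_category_def additive_category_def by blast

lemma biproductD:
  assumes "is_biproduct C X Y P i j p q"
  shows "i \<in> Hom C X P" "j \<in> Hom C Y P" "p \<in> Hom C P X" "q \<in> Hom C P Y"
    "p \<cdot> i = Ide C X" "q \<cdot> j = Ide C Y" "q \<cdot> i = Zero C X Y" "p \<cdot> j = Zero C Y X"
    "i \<cdot> p \<boxplus> j \<cdot> q = Ide C P"
  using assms by (auto simp: is_biproduct_def)

lemma biproduct_eqI:
  assumes B: "is_biproduct C X Y P i j p q" and h: "h \<in> Hom C P M" "k \<in> Hom C P M"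
    and eq: "h \<cdot> i = k \<cdot> i" "h \<cdot> j = k \<cdot> j"
  shows "h = k"
proof -
  note b = biproductD[OF B]
  have *: "f = f \<cdot> i \<cdot> p \<boxplus> f \<cdot> j \<cdot> q" if f: "f \<in> Hom C P M" for f
    using comp_Add[OF comp_Hom[OF b(3,1)] comp_Hom[OF b(4,2)] f] b(9) Hom_Ide(1)[OF f]
      assoc[OF b(3,1) f] assoc[OF b(4,2) f] by simp
  show ?thesis using *[OF h(1)] *[OF h(2)] eq by simp
qed

lemma biproduct_factor:
  assumes B: "is_biproduct C X Y P i j p q" and h: "h \<in> Hom C X M" "k \<in> Hom C Y M"
  obtains u where "u \<in> Hom C P M" "u \<cdot> i = h" "u \<cdot> j = k"
proof -
  note b = biproductD[OF B]
  have hp: "h \<cdot> p \<in> Hom C P M" and kq: "k \<cdot> q \<in> Hom C P M" using b h by blast+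
  have "(h \<cdot> p \<boxplus> k \<cdot> q) \<cdot> i = h"
    using Add_comp[OF b(1) hp kq] assoc[OF b(1,3) h(1)] assoc[OF b(1,4) h(2)] b(5,7)
      Hom_Ide(1)[OF h(1)] comp_Zero[OF h(2) HomD(4)[OF h(1)]] Add_Zero(1)[OF h(1)] by simp
  moreover have "(h \<cdot> p \<boxplus> k \<cdot> q) \<cdot> j = k"
    using Add_comp[OF b(2) hp kq] assoc[OF b(2,3) h(1)] assoc[OF b(2,4) h(2)] b(6,8)
      Hom_Ide(1)[OF h(2)] comp_Zero[OF h(1) HomD(4)[OF h(2)]] Add_Zero(2)[OF h(2)] by simp
  ultimately show ?thesis using that Add_Hom[OF hp kq] by blast
qed

text \<open>The maps \<open>a\<close> and \<open>q\<close> form the row of the extension pushed out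
  along \<open>w\<close>, with \<open>b\<close> as the map from the old middle term. The last two
  clauses are the universal property of the square, and the objects are read off \<open>f\<close>,
  \<open>g\<close> and \<open>w\<close>.\<close>

definition pushout_extension :: "'m \<Rightarrow> 'm \<Rightarrow> 'm \<Rightarrow> 'o \<Rightarrow> 'm \<Rightarrow> 'm \<Rightarrow> 'm \<Rightarrow> bool" where
  "pushout_extension f g w P a b q \<longleftrightarrow>
     a \<in> Hom C (Cod C w) P \<and> b \<in> Hom C (Cod C f) P \<and> q \<in> Hom C P (Cod C g) \<and>
     a \<cdot> w = b \<cdot> f \<and> q \<cdot> a = Zero C (Cod C w) (Cod C g) \<and> q \<cdot> b = g \<and> is_kernel C a q \<and> is_cokernel C q a \<and>
     (\<forall>M. \<forall>h\<in>Hom C (Cod C w) M. \<forall>k\<in>Hom C (Cod C f) M. h \<cdot> w = k \<cdot> f \<longrightarrow>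
        (\<exists>u\<in>Hom C P M. u \<cdot> a = h \<and> u \<cdot> b = k)) \<and>
     (\<forall>M. \<forall>u\<in>Hom C P M. \<forall>v\<in>Hom C P M. u \<cdot> a = v \<cdot> a \<and> u \<cdot> b = v \<cdot> b \<longrightarrow> u = v)"

lemma pushout_extensionD:
  assumes "pushout_extension f g w P a b q" "f \<in> Hom C X E" "g \<in> Hom C E Y" "w \<in> Hom C X D"
  shows "a \<in> Hom C D P" "b \<in> Hom C E P" "q \<in> Hom C P Y"
    "a \<cdot> w = b \<cdot> f" "q \<cdot> a = Zero C D Y" "q \<cdot> b = g" "is_kernel C a q" "is_cokernel C q a"
    "h \<in> Hom C D M \<Longrightarrow> k \<in> Hom C E M \<Longrightarrow> h \<cdot> w = k \<cdot> f \<Longrightarrow> \<exists>u\<in>Hom C P M. u \<cdot> a = h \<and> u \<cdot> b = k"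
    "u \<in> Hom C P M \<Longrightarrow> v \<in> Hom C P M \<Longrightarrow> u \<cdot> a = v \<cdot> a \<Longrightarrow> u \<cdot> b = v \<cdot> b \<Longrightarrow> u = v"
proof -
  have "Cod C f = E" "Cod C g = Y" "Cod C w = D" using assms(2-4) by (auto simp: Hom_def)
  note * = assms(1)[unfolded pushout_extension_def this]
  show "a \<in> Hom C D P" "b \<in> Hom C E P" "q \<in> Hom C P Y"
    "a \<cdot> w = b \<cdot> f" "q \<cdot> a = Zero C D Y" "q \<cdot> b = g" "is_kernel C a q" "is_cokernel C q a"
    "h \<in> Hom C D M \<Longrightarrow> k \<in> Hom C E M \<Longrightarrow> h \<cdot> w = k \<cdot> f \<Longrightarrow> \<exists>u\<in>Hom C P M. u \<cdot> a = h \<and> u \<cdot> b = k"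
    "u \<in> Hom C P M \<Longrightarrow> v \<in> Hom C P M \<Longrightarrow> u \<cdot> a = v \<cdot> a \<Longrightarrow> u \<cdot> b = v \<cdot> b \<Longrightarrow> u = v"
    using * by blast+
qed

text \<open>The pushout is the cokernel of \<open>d\<close>, the difference of
  \<open>i \<cdot> w\<close> and \<open>j \<cdot> f\<close>, into the biproduct. Its universal
  property makes \<open>q\<close> a cokernel of \<open>a\<close>; once \<open>a\<close> is known to
  be a monomorphism, it is the kernel of that cokernel.\<close>

lemma pushout_extension_exists:
  assumes f: "f \<in> Hom C X E" and g: "g \<in> Hom C E Y" and fg: "short_exact C f g" and w: "w \<in> Hom C X D"
  shows "\<exists>P a b q. pushout_extension f g w P a b q"
proof -
  note ker = short_exactD(1)[OF fg] and coker = short_exactD(2)[OF fg]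
  note XO = HomD(4)[OF f] and EO = HomD(5)[OF f] and DO = HomD(5)[OF w] and YO = HomD(5)[OF g]
  obtain B i j p p' where B: "is_biproduct C D E B i j p p'" using biproduct_exists[OF DO EO] by blast
  note b = biproductD[OF B]
  define d where "d = i \<cdot> w \<boxminus> j \<cdot> f"
  have iw: "i \<cdot> w \<in> Hom C X B" and jf: "j \<cdot> f \<in> Hom C X B" using b f w by blast+
  have d: "d \<in> Hom C X B" unfolding d_def using diff_Hom[OF iw jf] .
  obtain P c where c: "c \<in> Hom C B P" "is_cokernel C c d" using cokernel_exists[OF d] by blast
  have cd: "c \<cdot> d = Zero C X P" using cokernelD(2)[OF c(2) d] c(1) by (simp add: Hom_def)
  define a b' where "a = c \<cdot> i" and "b' = c \<cdot> j"
  have a: "a \<in> Hom C D P" and b': "b' \<in> Hom C E P" using b c(1) by (auto simp: a_def b'_def)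
  have hd: "h \<cdot> d = Zero C X M \<longleftrightarrow> (h \<cdot> i) \<cdot> w = (h \<cdot> j) \<cdot> f" if h: "h \<in> Hom C B M" for h M
    unfolding d_def comp_diff[OF iw jf h] diff_eq_Zero[OF comp_Hom[OF iw h] comp_Hom[OF jf h]]
    using assoc[OF w b(1) h] assoc[OF f b(2) h] by simp
  have comm: "a \<cdot> w = b' \<cdot> f" using hd[OF c(1)] cd by (simp add: a_def b'_def)
  have Pc: "Cod C c = P" using c(1) by (simp add: Hom_def)
  have ex: "\<exists>u\<in>Hom C P M. u \<cdot> a = h \<and> u \<cdot> b' = k"
    if h: "h \<in> Hom C D M" and k: "k \<in> Hom C E M" and eq: "h \<cdot> w = k \<cdot> f" for M h k
  proof -
    obtain m where m: "m \<in> Hom C B M" "m \<cdot> i = h" "m \<cdot> j = k" using biproduct_factor[OF B h k] by blast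
    have "m \<cdot> d = Zero C X M" using hd[OF m(1)] m(2,3) eq by simp
    then obtain u where u: "u \<in> Hom C P M" "u \<cdot> c = m" using cokernel_factor[OF c(2) d m(1)] Pc by blast
    then show ?thesis
      using assoc[OF b(1) c(1) u(1)] assoc[OF b(2) c(1) u(1)] m(2,3) by (auto simp: a_def b'_def)
  qed
  have uniq: "u = v" if u: "u \<in> Hom C P M" and v: "v \<in> Hom C P M" and eq: "u \<cdot> a = v \<cdot> a" "u \<cdot> b' = v \<cdot> b'" for M u v
  proof -
    have "u \<cdot> c = v \<cdot> c"
    proof (rule biproduct_eqI[OF B comp_Hom[OF c(1) u] comp_Hom[OF c(1) v]])
      show "u \<cdot> c \<cdot> i = v \<cdot> c \<cdot> i" using eq(1) assoc[OF b(1) c(1) u] assoc[OF b(1) c(1) v] by (simp add: a_def)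
      show "u \<cdot> c \<cdot> j = v \<cdot> c \<cdot> j" using eq(2) assoc[OF b(2) c(1) u] assoc[OF b(2) c(1) v] by (simp add: b'_def)
    qed
    then show ?thesis using epi_cancel[OF cokernel_epi[OF c(2)] c(1) u v] by simp
  qed
  have gf: "g \<cdot> f = Zero C X Y" using cokernelD(2)[OF coker f] g by (simp add: Hom_def)
  have gY: "Cod C g = Y" using g by (simp add: Hom_def)
  \<comment> \<open>The projection \<open>q\<close> is induced by zero on \<open>D\<close> and
    \<open>g\<close> on \<open>E\<close>; the two agree on \<open>X\<close> because \<open>g\<close>
    kills \<open>f\<close>.\<close>
  have "Zero C D Y \<cdot> w = g \<cdot> f" using Zero_comp[OF w YO] gf by simp
  then obtain q where q: "q \<in> Hom C P Y" "q \<cdot> a = Zero C D Y" "q \<cdot> b' = g"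
    using ex[OF Zero_Hom[OF DO YO] g] by blast
  have qfac: "\<exists>v\<in>Hom C Y M. v \<cdot> q = h" if h: "h \<in> Hom C P M" and ha: "h \<cdot> a = Zero C D M" for M h
  proof -
    note MO = HomD(5)[OF h]
    have "(h \<cdot> b') \<cdot> f = Zero C X M"
      using assoc[OF f b' h] comm assoc[OF w a h] ha Zero_comp[OF w MO] by simp
    then obtain v where v: "v \<in> Hom C Y M" "v \<cdot> g = h \<cdot> b'"
      using cokernel_factor[OF coker f comp_Hom[OF b' h]] gY by metis
    have "v \<cdot> q = h"
      using uniq[OF comp_Hom[OF q(1) v(1)] h] assoc[OF a q(1) v(1)] assoc[OF b' q(1) v(1)] q(2,3) v(2) ha
        comp_Zero[OF v(1) DO] by simp
    then show ?thesis using v(1) by blast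
  qed
  have qepi: "epi_arr C q"
  proof (rule epi_arrI[OF q(1)])
    fix Z u v assume uv: "u \<in> Hom C Y Z" "v \<in> Hom C Y Z" "u \<cdot> q = v \<cdot> q"
    have "u \<cdot> g = v \<cdot> g"
      using assoc[OF b' q(1) uv(1)] assoc[OF b' q(1) uv(2)] uv(3) q(3) by simp
    then show "u = v" using epi_cancel[OF cokernel_epi[OF coker] g uv(1,2)] by simp
  qed
  have qcoker: "is_cokernel C q a"
    unfolding is_cokernel_def
  proof (intro conjI ballI impI)
    fix h assume h: "h \<in> Arr C" "Dom C h = Cod C a \<and> h \<cdot> a = Zero C (Dom C a) (Cod C h)"
    then have hH: "h \<in> Hom C P (Cod C h)" and ha: "h \<cdot> a = Zero C D (Cod C h)"
      using a by (auto simp: Hom_def)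
    obtain v where v: "v \<in> Hom C Y (Cod C h)" "v \<cdot> q = h" using qfac[OF hH ha] by blast
    have qY: "Cod C q = Y" using q(1) by (simp add: Hom_def)
    show "\<exists>!u. u \<in> Hom C (Cod C q) (Cod C h) \<and> u \<cdot> q = h"
      unfolding qY
    proof (rule ex1I[of _ v])
      show "v' = v" if "v' \<in> Hom C Y (Cod C h) \<and> v' \<cdot> q = h" for v'
        using epi_cancel[OF qepi q(1)] that v by metis
    qed (use v in simp)
  qed (use a q in \<open>auto simp: Hom_def\<close>)
  have fmono: "mono_arr C f" using kernel_mono[OF ker] .
  have qd: "p' \<cdot> d = Zero C X E \<boxminus> f"
    unfolding d_def comp_diff[OF iw jf b(4)]
    using assoc[OF w b(1,4)] assoc[OF f b(2,4)] b(6,7) Zero_comp[OF w EO] Hom_Ide(2)[OF f] by simp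
  \<comment> \<open>The second component of \<open>d\<close> is the negative of the monomorphism
    \<open>f\<close>, so it detects zero. This serves both for \<open>d\<close> and for
    \<open>a\<close>.\<close>
  have qdx: "x = Zero C Z X" if x: "x \<in> Hom C Z X" and z: "p' \<cdot> (d \<cdot> x) = Zero C Z E" for x Z
  proof -
    have "Zero C Z E \<boxminus> f \<cdot> x = Zero C Z E"
      using z assoc[OF x d b(4)] qd diff_comp[OF x Zero_Hom[OF XO EO] f] Zero_comp[OF x EO] by simp
    then have "f \<cdot> x = Zero C Z E"
      using diff_eq_Zero[OF Zero_Hom[OF HomD(4)[OF x] EO] comp_Hom[OF x f]] by simp
    then show ?thesis using mono_zero[OF fmono f x] by simp
  qed
  have dmono: "mono_arr C d"
  proof (rule mono_arr_zeroI[OF d])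
    fix Z x assume "x \<in> Hom C Z X" "d \<cdot> x = Zero C Z B"
    then show "x = Zero C Z X" using qdx comp_Zero[OF b(4)] HomD(4) by metis
  qed
  \<comment> \<open>If \<open>a\<close> kills \<open>y\<close>, then \<open>i \<cdot> y\<close> lies
    in the kernel of \<open>c\<close>, hence equals some \<open>d \<cdot> x\<close>. Its second
    component is zero, so \<open>x\<close> and then \<open>y\<close> vanish.\<close>
  have amono: "mono_arr C a"
  proof (rule mono_arr_zeroI[OF a])
    fix Z y assume y: "y \<in> Hom C Z D" and ay: "a \<cdot> y = Zero C Z P"
    note ZO = HomD(4)[OF y]
    have "c \<cdot> (i \<cdot> y) = Zero C Z P" using ay assoc[OF y b(1) c(1)] by (simp add: a_def)
    then obtain x where x: "x \<in> Hom C Z X" "d \<cdot> x = i \<cdot> y"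
      using kernel_factor[OF mono_kernel_cokernel[OF dmono d c(2)] c(1) comp_Hom[OF y b(1)]] d
      by (auto simp: Hom_def)
    have "p' \<cdot> (d \<cdot> x) = Zero C Z E"
      using x(2) assoc[OF y b(1,4)] b(7) Zero_comp[OF y EO] by simp
    then have "x = Zero C Z X" using qdx[OF x(1)] by simp
    then have "i \<cdot> y = Zero C Z B" using x(2) comp_Zero[OF d ZO] by simp
    then have "p \<cdot> (i \<cdot> y) = Zero C Z D" using comp_Zero[OF b(3) ZO] by simp
    then show "y = Zero C Z D" using assoc[OF y b(1,3)] b(5) Hom_Ide(2)[OF y] by simp
  qed
  have cods: "Cod C f = E" "Cod C g = Y" "Cod C w = D" using f g w by (auto simp: Hom_def)
  have "pushout_extension f g w P a b' q"
    unfolding pushout_extension_def cods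
    using a b' q comm mono_kernel_cokernel[OF amono a qcoker] qcoker ex uniq by simp
  then show ?thesis by blast
qed

text \<open>The stages above \<open>i\<close> are cofinal. A cocone on them extends to all of
  \<open>I\<close> by moving to any later stage above \<open>i\<close>, and directedness makes the
  choice of that stage irrelevant. It is used to have a map from \<open>X\<close> available at every
  stage.\<close>

lemma direct_limit_tail:
  assumes ds: "direct_system U C I r D" and L: "is_direct_limit C I r D L \<iota>" and i: "i \<in> I"
  defines "I' \<equiv> {j. (i, j) \<in> r}"
  shows "directed_poset U I' (r \<inter> I' \<times> I')"
    and "direct_system U C I' (r \<inter> I' \<times> I') D" and "is_direct_limit C I' (r \<inter> I' \<times> I') D L \<iota>"
proof -
  note dir = direct_system_directed[OF ds]
  note rI = directed_poset_subset[OF dir] and refl = directed_poset_refl[OF dir]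
    and trans = directed_poset_trans[OF dir]
  have sub: "I' \<subseteq> I" using rI by (auto simp: I'_def)
  have iI': "i \<in> I'" using refl[OF i] by (simp add: I'_def)
  have antisym: "antisym r" using dir by (simp add: directed_poset_def order_on_defs)
  have up: "\<exists>k\<in>I'. (j, k) \<in> r" if "j \<in> I" for j
    using directed_poset_bound2[OF dir i that] by (metis I'_def mem_Collect_eq)
  show dir': "directed_poset U I' (r \<inter> I' \<times> I')"
    unfolding directed_poset_def partial_order_on_def preorder_on_def
  proof (intro conjI ballI)
    show "I' \<prec> U" using small_subset[OF directed_poset_small[OF dir] sub] .
    show "refl_on I' (r \<inter> I' \<times> I')" using refl sub by (auto simp: refl_on_def)
    show "Relation.trans (r \<inter> I' \<times> I')" using trans unfolding Relation.trans_def by blast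
    show "antisym (r \<inter> I' \<times> I')" using antisym unfolding antisym_def by blast
    show "I' \<noteq> {}" using iI' by blast
    fix j k assume jk: "j \<in> I'" "k \<in> I'"
    then obtain l where l: "(j, l) \<in> r" "(k, l) \<in> r"
      using directed_poset_bound2[OF dir, of j k] sub by blast
    then have "l \<in> I'" using jk trans by (auto simp: I'_def)
    then show "\<exists>l\<in>I'. (j, l) \<in> r \<inter> I' \<times> I' \<and> (k, l) \<in> r \<inter> I' \<times> I'" using l jk by blast
  qed blast
  show ds': "direct_system U C I' (r \<inter> I' \<times> I') D"
    by (rule direct_systemI[OF dir'])
      (use sub direct_system_Obj[OF ds] direct_system_map[OF ds] direct_system_Ide[OF ds]
        direct_system_comp[OF ds] in auto)
  show "is_direct_limit C I' (r \<inter> I' \<times> I') D L \<iota>"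
  proof (rule direct_limitI)
    show "is_limit_cocone C I' (r \<inter> I' \<times> I') D L \<iota>"
      using direct_limit_cocone[OF L] sub unfolding is_limit_cocone_def by blast
  next
    fix M \<mu> assume M: "is_limit_cocone C I' (r \<inter> I' \<times> I') D M \<mu>"
    then have \<mu>: "\<And>k. k \<in> I' \<Longrightarrow> \<mu> k \<in> Hom C (omap D k) M"
      and \<mu>t: "\<And>k l. k \<in> I' \<Longrightarrow> l \<in> I' \<Longrightarrow> (k, l) \<in> r \<Longrightarrow> \<mu> l \<cdot> amap D (k, l) = \<mu> k"
      and MO: "M \<in> Obj C" by (auto simp: is_limit_cocone_def)
    have I'up: "l \<in> I'" if "k \<in> I'" "(k, l) \<in> r" for k l using that trans by (auto simp: I'_def)
    have eq: "\<mu> k \<cdot> amap D (j, k) = \<mu> l \<cdot> amap D (j, l)"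
      if kl: "k \<in> I'" "l \<in> I'" "(j, k) \<in> r" "(j, l) \<in> r" for j k l
    proof -
      obtain m where m: "(k, m) \<in> r" "(l, m) \<in> r" using directed_poset_bound2[OF dir, of k l] sub kl by blast
      have mI: "m \<in> I'" using I'up[OF kl(1) m(1)] .
      have *: "\<mu> n \<cdot> amap D (j, n) = \<mu> m \<cdot> amap D (j, m)" if n: "n \<in> I'" "(n, m) \<in> r" "(j, n) \<in> r" for n
        using assoc[OF direct_system_map[OF ds n(3)] direct_system_map[OF ds n(2)] \<mu>[OF mI]]
          \<mu>t[OF n(1) mI n(2)] direct_system_comp[OF ds n(3,2)] by simp
      show ?thesis using *[OF kl(1) m(1) kl(3)] *[OF kl(2) m(2) kl(4)] by simp
    qed
    have "\<forall>j\<in>I. \<exists>k. k \<in> I' \<and> (j, k) \<in> r" using up by blast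
    then obtain n where n: "\<And>j. j \<in> I \<Longrightarrow> n j \<in> I' \<and> (j, n j) \<in> r" by metis
    have nu: "is_limit_cocone C I r D M (\<lambda>j. \<mu> (n j) \<cdot> amap D (j, n j))"
      unfolding is_limit_cocone_def
    proof (intro conjI ballI allI impI MO)
      show "\<mu> (n j) \<cdot> amap D (j, n j) \<in> Hom C (omap D j) M" if "j \<in> I" for j
        using n[OF that] direct_system_map[OF ds] \<mu> by blast
      fix j k assume jk: "(j, k) \<in> r"
      then have jkI: "j \<in> I" "k \<in> I" using rI by auto
      have k: "n k \<in> I'" "(k, n k) \<in> r" using n[OF jkI(2)] by auto
      have "\<mu> (n k) \<cdot> amap D (k, n k) \<cdot> amap D (j, k) = \<mu> (n k) \<cdot> amap D (j, n k)"
        using assoc[OF direct_system_map[OF ds jk] direct_system_map[OF ds k(2)] \<mu>[OF k(1)]]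
          direct_system_comp[OF ds jk k(2)] by simp
      then show "\<mu> (n k) \<cdot> amap D (k, n k) \<cdot> amap D (j, k) = \<mu> (n j) \<cdot> amap D (j, n j)"
        using eq[of "n k" "n j" j] n[OF jkI(1)] k trans[OF jk k(2)] by simp
    qed
    obtain h where h: "h \<in> Hom C L M" "\<And>j. j \<in> I \<Longrightarrow> h \<cdot> \<iota> j = \<mu> (n j) \<cdot> amap D (j, n j)"
      using direct_limit_factor[OF L nu] by blast
    have "h \<cdot> \<iota> j = \<mu> j" if j: "j \<in> I'" for j
    proof -
      have jI: "j \<in> I" using j sub by blast
      show ?thesis
        using h(2)[OF jI] eq[of "n j" j j] n[OF jI] j refl[OF jI] direct_system_Ide[OF ds jI]
          Hom_Ide(1)[OF \<mu>[OF j]] by simp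
    qed
    then show "\<exists>h. h \<in> Hom C L M \<and> (\<forall>j\<in>I'. h \<cdot> \<iota> j = \<mu> j)" using h(1) by blast
  next
    fix M h k assume hk: "h \<in> Hom C L M" "k \<in> Hom C L M" and eq: "\<And>j. j \<in> I' \<Longrightarrow> h \<cdot> \<iota> j = k \<cdot> \<iota> j"
    show "h = k"
    proof (rule direct_limit_eqI[OF L hk _ dir direct_system_map[OF ds]])
      fix j assume j: "j \<in> I"
      then obtain l where l: "l \<in> I'" "(j, l) \<in> r" using up by blast
      note t = direct_system_map[OF ds l(2)]
      have \<iota>: "\<iota> l \<in> Hom C (omap D l) L" using direct_limit_map[OF L] l(1) sub by blast
      show "h \<cdot> \<iota> j = k \<cdot> \<iota> j"
        using assoc[OF t \<iota> hk(1)] assoc[OF t \<iota> hk(2)] eq[OF l(1)] direct_limit_comp[OF L l(2)] by simp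
    qed
  qed
qed

text \<open>A map u from E to the limit pushes the extension out along compatible maps to all late stages and
  to the limit, where u provides a retraction, hence a section over Y. As Y is finitely
  presented, the section, and with it the splitting, exists at some stage.\<close>
lemma fp_extension:
  assumes f: "f \<in> Hom C X E" and g: "g \<in> Hom C E Y" and fg: "short_exact C f g"
    and X: "X \<in> fp U C" and Y: "Y \<in> fp U C"
  shows "E \<in> fp U C"
proof (rule fpI)
  show "E \<in> Obj C" using HomD(5)[OF f] .
  note ker = short_exactD(1)[OF fg] and coker = short_exactD(2)[OF fg]
  have gY: "Cod C g = Y" using g by (simp add: Hom_def)
  note YO = fp_Obj[OF Y] and XO = fp_Obj[OF X]
  fix I r D L \<iota>
  assume ds: "direct_system U C I r D" and L: "is_direct_limit C I r D L \<iota>"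
  note dir = direct_system_directed[OF ds]
  note LO = direct_limit_Obj[OF L]
  have rI: "i \<in> I" "j \<in> I" if "(i, j) \<in> r" for i j using that directed_poset_subset[OF dir] by auto
  note t = direct_system_map[OF ds]
  {
    \<comment> \<open>Vanishing: at a later stage \<open>x\<close> is zero on \<open>X\<close>, so
      it factors through \<open>g\<close>. The factor is zero in the limit because \<open>g\<close>
      is an epimorphism, hence zero at a further stage because \<open>Y\<close> is finitely
      presented.\<close>
    fix i x assume i: "i \<in> I" and x: "x \<in> Hom C E (omap D i)" and z: "\<iota> i \<cdot> x = Zero C E L"
    have "\<iota> i \<cdot> (x \<cdot> f) = Zero C X L"
      using assoc[OF f x direct_limit_map[OF L i]] z Zero_comp[OF f LO] by simp
    then obtain j where j: "(i, j) \<in> r" "amap D (i, j) \<cdot> (x \<cdot> f) = Zero C X (omap D j)"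
      using fp_vanish[OF X ds L i comp_Hom[OF f x]] by blast
    note tx = comp_Hom[OF x t[OF j(1)]]
    have "amap D (i, j) \<cdot> x \<cdot> f = Zero C X (omap D j)" using j(2) assoc[OF f x t[OF j(1)]] by simp
    then obtain y where y: "y \<in> Hom C Y (omap D j)" "y \<cdot> g = amap D (i, j) \<cdot> x"
      using cokernel_factor[OF coker f tx] gY by metis
    note \<iota>j = direct_limit_map[OF L rI(2)[OF j(1)]]
    have "\<iota> j \<cdot> y \<cdot> g = Zero C E L"
      using assoc[OF g y(1) \<iota>j] y(2) comp_reduce[OF direct_limit_comp[OF L j(1)] t[OF j(1)] \<iota>j x] z by simp
    then have "\<iota> j \<cdot> y \<cdot> g = Zero C Y L \<cdot> g" using Zero_comp[OF g LO] by simp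
    then have "\<iota> j \<cdot> y = Zero C Y L"
      using epi_cancel[OF cokernel_epi[OF coker] g comp_Hom[OF y(1) \<iota>j] Zero_Hom[OF YO LO]] by simp
    then obtain k where k: "(j, k) \<in> r" "amap D (j, k) \<cdot> y = Zero C Y (omap D k)"
      using fp_vanish[OF Y ds L rI(2)[OF j(1)] y(1)] by blast
    have "amap D (i, k) \<cdot> x = amap D (j, k) \<cdot> (y \<cdot> g)"
      using comp_reduce[OF direct_system_comp[OF ds j(1) k(1)] t[OF j(1)] t[OF k(1)] x] y(2) by simp
    also have "\<dots> = Zero C E (omap D k)"
      using comp_reduce[OF k(2) y(1) t[OF k(1)] g] Zero_comp[OF g HomD(5)[OF t[OF k(1)]]] by simp
    finally show "\<exists>k. (i, k) \<in> r \<and> amap D (i, k) \<cdot> x = Zero C E (omap D k)"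
      using directed_poset_trans[OF dir j(1) k(1)] by blast
  }
  fix u assume u: "u \<in> Hom C E L"
  obtain i w where i: "i \<in> I" and w: "w \<in> Hom C X (omap D i)" and uf: "u \<cdot> f = \<iota> i \<cdot> w"
    using fp_factor[OF X ds L comp_Hom[OF f u]] by blast
  \<comment> \<open>Lifting: beyond the stage \<open>i\<close> that carries the lift
    \<open>w\<close> of \<open>u \<cdot> f\<close>, the extension can be pushed out
    compatibly.\<close>
  define I' where "I' = {j. (i, j) \<in> r}"
  define r' where "r' = r \<inter> I' \<times> I'"
  note dir' = direct_limit_tail(1)[OF ds L i, folded I'_def r'_def]
    and ds' = direct_limit_tail(2)[OF ds L i, folded I'_def r'_def]
    and L' = direct_limit_tail(3)[OF ds L i, folded I'_def r'_def]
  have I'D: "(i, j) \<in> r" "j \<in> I" if "j \<in> I'" for j using that rI by (auto simp: I'_def)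
  have r'D: "(j, k) \<in> r" "j \<in> I'" "k \<in> I'" if "(j, k) \<in> r'" for j k using that by (auto simp: r'_def)
  have iI': "i \<in> I'" using directed_poset_refl[OF dir i] by (simp add: I'_def)
  have ij': "(i, j) \<in> r'" if "j \<in> I'" for j using that iI' I'D by (auto simp: r'_def)
  note \<iota> = direct_limit_map[OF L']
  define ws where "ws j = amap D (i, j) \<cdot> w" for j
  have ws: "ws j \<in> Hom C X (omap D j)" if "j \<in> I'" for j
    unfolding ws_def using comp_Hom[OF w t[OF I'D(1)[OF that]]] .
  have tws: "amap D (j, k) \<cdot> ws j = ws k" if jk: "(j, k) \<in> r'" for j k
    unfolding ws_def using comp_reduce[OF direct_system_comp[OF ds I'D(1) r'D(1)[OF jk]]
        t[OF I'D(1)] t[OF r'D(1)[OF jk]] w] r'D[OF jk] by blast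
  have \<iota>ws: "\<iota> j \<cdot> ws j = u \<cdot> f" if j: "j \<in> I'" for j
    unfolding ws_def using comp_reduce[OF direct_limit_comp[OF L I'D(1)[OF j]] t[OF I'D(1)[OF j]] \<iota>[OF j] w] uf by simp
  obtain P a b q where PE: "\<And>j. j \<in> I' \<Longrightarrow> pushout_extension f g (ws j) (P j) (a j) (b j) (q j)"
    using pushout_extension_exists[OF f g fg ws] by metis
  note PED = pushout_extensionD[OF PE f g ws]
  have a: "a j \<in> Hom C (omap D j) (P j)" and b: "b j \<in> Hom C E (P j)" and q: "q j \<in> Hom C (P j) Y"
    and comm: "a j \<cdot> ws j = b j \<cdot> f" and qa: "q j \<cdot> a j = Zero C (omap D j) Y" and qb: "q j \<cdot> b j = g"
    and aker: "is_kernel C (a j) (q j)" if j: "j \<in> I'" for j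
    by (rule PED(1-7)[OF j j])+
  have ex: "\<exists>u\<in>Hom C (P j) M. u \<cdot> a j = h \<and> u \<cdot> b j = k"
    if "j \<in> I'" "h \<in> Hom C (omap D j) M" "k \<in> Hom C E M" "h \<cdot> ws j = k \<cdot> f" for j M h k
    using PED(9)[OF that(1) that(1) that(2-4)] .
  have uniq: "u = v"
    if "j \<in> I'" "u \<in> Hom C (P j) M" "v \<in> Hom C (P j) M" "u \<cdot> a j = v \<cdot> a j" "u \<cdot> b j = v \<cdot> b j" for j M u v
    using PED(10)[OF that(1) that(1) that(2-5)] .
  have PO: "P j \<in> Obj C" if "j \<in> I'" for j using HomD(5)[OF a[OF that]] .
  \<comment> \<open>The pushout along \<open>u \<cdot> f\<close> itself, which is to be the direct
    limit of the pushouts \<open>P j\<close>.\<close>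
  obtain P0 a0 b0 q0 where PE0: "pushout_extension f g (u \<cdot> f) P0 a0 b0 q0"
    using pushout_extension_exists[OF f g fg comp_Hom[OF f u]] by blast
  note PED0 = pushout_extensionD[OF PE0 f g comp_Hom[OF f u]]
  note a0 = PED0(1) and b0 = PED0(2) and q0 = PED0(3) and comm0 = PED0(4) and qa0 = PED0(5)
    and qb0 = PED0(6) and coker0 = PED0(8) and ex0 = PED0(9) and uniq0 = PED0(10)
  note P0O = HomD(5)[OF a0]
  have "\<exists>T. T \<in> Hom C (P j) (P k) \<and> T \<cdot> a j = a k \<cdot> amap D (j, k) \<and> T \<cdot> b j = b k" if jk: "(j, k) \<in> r'" for j k
  proof -
    note jk' = r'D[OF jk]
    have "a k \<cdot> amap D (j, k) \<cdot> ws j = b k \<cdot> f"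
      using assoc[OF ws[OF jk'(2)] t[OF jk'(1)] a[OF jk'(3)]] tws[OF jk] comm[OF jk'(3)] by simp
    then show ?thesis using ex[OF jk'(2) comp_Hom[OF t[OF jk'(1)] a[OF jk'(3)]] b[OF jk'(3)]] by blast
  qed
  then obtain T where T: "\<And>j k. (j, k) \<in> r' \<Longrightarrow> T j k \<in> Hom C (P j) (P k)"
    and Ta: "\<And>j k. (j, k) \<in> r' \<Longrightarrow> T j k \<cdot> a j = a k \<cdot> amap D (j, k)"
    and Tb: "\<And>j k. (j, k) \<in> r' \<Longrightarrow> T j k \<cdot> b j = b k" by metis
  define PD where "PD = \<lparr>omap = P, amap = \<lambda>(j, k). T j k\<rparr>"
  have PD: "omap PD j = P j" "amap PD (j, k) = T j k" for j k by (simp_all add: PD_def)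
  have dsP: "direct_system U C I' r' PD"
  proof (rule direct_systemI[OF dir'])
    show "amap PD (j, j) = Ide C (omap PD j)" if j: "j \<in> I'" for j
    proof -
      note jj = directed_poset_refl[OF dir' j]
      show ?thesis
        unfolding PD
        using uniq[OF j T[OF jj] Ide_Hom[OF PO[OF j]]] Ta[OF jj] Tb[OF jj] direct_system_Ide[OF ds' j]
          Hom_Ide[OF a[OF j]] Hom_Ide(2)[OF b[OF j]] by simp
    qed
    show "amap PD (j, l) = amap PD (k, l) \<cdot> amap PD (j, k)" if jk: "(j, k) \<in> r'" and kl: "(k, l) \<in> r'" for j k l
    proof -
      note jl = directed_poset_trans[OF dir' jk kl]
      note j = r'D(2)[OF jk] and k = r'D(2)[OF kl] and l = r'D(3)[OF kl]
      have "T k l \<cdot> T j k \<cdot> a j = a l \<cdot> amap D (j, l)"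
        using assoc[OF a[OF j] T[OF jk] T[OF kl]] Ta[OF jk]
          comp_reduce[OF Ta[OF kl] a[OF k] T[OF kl] t[OF r'D(1)[OF jk]]]
          assoc[OF t[OF r'D(1)[OF jk]] t[OF r'D(1)[OF kl]] a[OF l]] direct_system_comp[OF ds' jk kl] by simp
      moreover have "T k l \<cdot> T j k \<cdot> b j = b l"
        using assoc[OF b[OF j] T[OF jk] T[OF kl]] Tb[OF jk] Tb[OF kl] by simp
      ultimately show ?thesis
        unfolding PD using uniq[OF j T[OF jl] comp_Hom[OF T[OF jk] T[OF kl]]] Ta[OF jl] Tb[OF jl] by simp
    qed
  qed (auto simp: PD PO T)
  have "\<exists>n. n \<in> Hom C (P j) P0 \<and> n \<cdot> a j = a0 \<cdot> \<iota> j \<and> n \<cdot> b j = b0" if j: "j \<in> I'" for j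
  proof -
    have "a0 \<cdot> \<iota> j \<cdot> ws j = b0 \<cdot> f" using assoc[OF ws[OF j] \<iota>[OF j] a0] \<iota>ws[OF j] comm0 by simp
    then show ?thesis using ex[OF j comp_Hom[OF \<iota>[OF j] a0] b0] by blast
  qed
  then obtain n where n: "\<And>j. j \<in> I' \<Longrightarrow> n j \<in> Hom C (P j) P0"
    and na: "\<And>j. j \<in> I' \<Longrightarrow> n j \<cdot> a j = a0 \<cdot> \<iota> j" and nb: "\<And>j. j \<in> I' \<Longrightarrow> n j \<cdot> b j = b0" by metis
  \<comment> \<open>Pushouts commute with direct limits: a cocone on the \<open>P j\<close> gives a
    cocone on the stages \<open>omap D j\<close> through \<open>a\<close> and one constant map on
    \<open>E\<close> through \<open>b\<close>, and these glue on \<open>P0\<close>.\<close>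
  have limP: "is_direct_limit C I' r' PD P0 n"
  proof (rule direct_limitI)
    have "n k \<cdot> T j k = n j" if jk: "(j, k) \<in> r'" for j k
    proof (rule uniq[OF r'D(2)[OF jk] comp_Hom[OF T[OF jk] n[OF r'D(3)[OF jk]]] n[OF r'D(2)[OF jk]]])
      note j = r'D(2)[OF jk] and k = r'D(3)[OF jk]
      show "n k \<cdot> T j k \<cdot> a j = n j \<cdot> a j"
        using assoc[OF a[OF j] T[OF jk] n[OF k]] Ta[OF jk] comp_reduce[OF na[OF k] a[OF k] n[OF k] t[OF r'D(1)[OF jk]]]
          assoc[OF t[OF r'D(1)[OF jk]] \<iota>[OF k] a0] direct_limit_comp[OF L' jk] na[OF j] by simp
      show "n k \<cdot> T j k \<cdot> b j = n j \<cdot> b j"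
        using assoc[OF b[OF j] T[OF jk] n[OF k]] Tb[OF jk] nb[OF k] nb[OF j] by simp
    qed
    then show "is_limit_cocone C I' r' PD P0 n" unfolding is_limit_cocone_def PD using n P0O by blast
  next
    fix M \<mu> assume M: "is_limit_cocone C I' r' PD M \<mu>"
    then have MO: "M \<in> Obj C" and \<mu>: "\<And>j. j \<in> I' \<Longrightarrow> \<mu> j \<in> Hom C (P j) M"
      and \<mu>T: "\<And>j k. (j, k) \<in> r' \<Longrightarrow> \<mu> k \<cdot> T j k = \<mu> j" unfolding is_limit_cocone_def PD by auto
    have \<mu>b: "\<mu> j \<cdot> b j = \<mu> i \<cdot> b i" if j: "j \<in> I'" for j
      using assoc[OF b[OF iI'] T[OF ij'[OF j]] \<mu>[OF j]] \<mu>T[OF ij'[OF j]] Tb[OF ij'[OF j]] by simp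
    have "is_limit_cocone C I' r' D M (\<lambda>j. \<mu> j \<cdot> a j)"
      unfolding is_limit_cocone_def
    proof (intro conjI ballI allI impI MO)
      show "\<mu> j \<cdot> a j \<in> Hom C (omap D j) M" if "j \<in> I'" for j using comp_Hom[OF a \<mu>] that by blast
      fix j k assume jk: "(j, k) \<in> r'"
      note j = r'D(2)[OF jk] and k = r'D(3)[OF jk]
      show "\<mu> k \<cdot> a k \<cdot> amap D (j, k) = \<mu> j \<cdot> a j"
        using assoc[OF t[OF r'D(1)[OF jk]] a[OF k] \<mu>[OF k]] Ta[OF jk]
          comp_reduce[OF \<mu>T[OF jk] T[OF jk] \<mu>[OF k] a[OF j]] by simp
    qed
    then obtain h where h: "h \<in> Hom C L M" "\<And>j. j \<in> I' \<Longrightarrow> h \<cdot> \<iota> j = \<mu> j \<cdot> a j"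
      using direct_limit_factor[OF L'] by blast
    have "h \<cdot> (u \<cdot> f) = (h \<cdot> \<iota> i) \<cdot> ws i" using \<iota>ws[OF iI'] assoc[OF ws[OF iI'] \<iota>[OF iI'] h(1)] by simp
    also have "\<dots> = \<mu> i \<cdot> b i \<cdot> f"
      using h(2)[OF iI'] assoc[OF ws[OF iI'] a[OF iI'] \<mu>[OF iI']] comm[OF iI'] assoc[OF f b[OF iI'] \<mu>[OF iI']] by simp
    finally obtain m where m: "m \<in> Hom C P0 M" "m \<cdot> a0 = h" "m \<cdot> b0 = \<mu> i \<cdot> b i"
      using ex0[OF h(1) comp_Hom[OF b[OF iI'] \<mu>[OF iI']]] by blast
    have "m \<cdot> n j = \<mu> j" if j: "j \<in> I'" for j
      using uniq[OF j comp_Hom[OF n[OF j] m(1)] \<mu>[OF j]] assoc[OF a[OF j] n[OF j] m(1)] na[OF j]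
        assoc[OF \<iota>[OF j] a0 m(1)] m(2,3) h(2)[OF j] assoc[OF b[OF j] n[OF j] m(1)] nb[OF j] \<mu>b[OF j] by simp
    then show "\<exists>h. h \<in> Hom C P0 M \<and> (\<forall>j\<in>I'. h \<cdot> n j = \<mu> j)" using m(1) by blast
  next
    fix M h k assume hk: "h \<in> Hom C P0 M" "k \<in> Hom C P0 M" and eq: "\<And>j. j \<in> I' \<Longrightarrow> h \<cdot> n j = k \<cdot> n j"
    show "h = k"
    proof (rule uniq0[OF hk])
      show "h \<cdot> a0 = k \<cdot> a0"
      proof (rule direct_limit_eqI[OF L' comp_Hom[OF a0 hk(1)] comp_Hom[OF a0 hk(2)] _ dir' direct_system_map[OF ds']])
        fix j assume j: "j \<in> I'"
        have *: "v \<cdot> a0 \<cdot> \<iota> j = v \<cdot> n j \<cdot> a j" if "v \<in> Hom C P0 M" for v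
          using assoc[OF \<iota>[OF j] a0 that] assoc[OF a[OF j] n[OF j] that] na[OF j] by simp
        show "h \<cdot> a0 \<cdot> \<iota> j = k \<cdot> a0 \<cdot> \<iota> j" using *[OF hk(1)] *[OF hk(2)] eq[OF j] by simp
      qed
      have *: "v \<cdot> b0 = v \<cdot> n i \<cdot> b i" if "v \<in> Hom C P0 M" for v
        using assoc[OF b[OF iI'] n[OF iI'] that] nb[OF iI'] by simp
      show "h \<cdot> b0 = k \<cdot> b0" using *[OF hk(1)] *[OF hk(2)] eq[OF iI'] by simp
    qed
  qed
  have qn: "q0 \<cdot> n j = q j" if j: "j \<in> I'" for j
    using uniq[OF j comp_Hom[OF n[OF j] q0] q[OF j]] assoc[OF a[OF j] n[OF j] q0] na[OF j]
      assoc[OF \<iota>[OF j] a0 q0] qa0 Zero_comp[OF \<iota>[OF j] YO] qa[OF j] assoc[OF b[OF j] n[OF j] q0] nb[OF j]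
      qb0 qb[OF j] by simp
  \<comment> \<open>The identity of \<open>L\<close> and the map \<open>u\<close> agree on
    \<open>X\<close>, so together they induce a retraction of \<open>a0\<close>.\<close>
  obtain \<rho> where \<rho>: "\<rho> \<in> Hom C P0 L" "\<rho> \<cdot> a0 = Ide C L"
    using ex0[OF Ide_Hom[OF LO] u] Hom_Ide(2)[OF comp_Hom[OF f u]] by auto
  have a\<rho>: "a0 \<cdot> \<rho> \<in> Hom C P0 P0" using comp_Hom[OF \<rho>(1) a0] .
  have "(Ide C P0 \<boxminus> a0 \<cdot> \<rho>) \<cdot> a0 = Zero C L P0"
    using diff_comp[OF a0 Ide_Hom[OF P0O] a\<rho>] Hom_Ide[OF a0] assoc[OF a0 \<rho>(1) a0] \<rho>(2) diff_self[OF a0] by simp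
  \<comment> \<open>The idempotent complementary to \<open>a0 \<cdot> \<rho>\<close> kills
    \<open>a0\<close>, so it descends along \<open>q0\<close>; the resulting map is a section of
    \<open>q0\<close>.\<close>
  then obtain s where s: "s \<in> Hom C Y P0" "s \<cdot> q0 = Ide C P0 \<boxminus> a0 \<cdot> \<rho>"
    using cokernel_factor[OF coker0 a0 diff_Hom[OF Ide_Hom[OF P0O] a\<rho>]] q0 by (auto simp: Hom_def)
  have "q0 \<cdot> (s \<cdot> q0) = q0"
    using comp_diff[OF Ide_Hom[OF P0O] a\<rho> q0] s(2) Hom_Ide(1)[OF q0] assoc[OF \<rho>(1) a0 q0] qa0
      Zero_comp[OF \<rho>(1) YO] diff_Zero[OF q0] by simp
  then have "q0 \<cdot> s \<cdot> q0 = Ide C Y \<cdot> q0" using assoc[OF q0 s(1) q0] Hom_Ide(2)[OF q0] by simp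
  then have qs: "q0 \<cdot> s = Ide C Y"
    using epi_cancel[OF cokernel_epi[OF coker0] q0 comp_Hom[OF s(1) q0] Ide_Hom[OF YO]] by simp
  \<comment> \<open>Finite presentation of \<open>Y\<close> brings the section down to a stage. It
    is a section of \<open>q j\<close> there without moving further, because
    \<open>q0 \<cdot> n j\<close> equals \<open>q j\<close>.\<close>
  obtain j sj where j: "j \<in> I'" and sj: "sj \<in> Hom C Y (P j)" and s_sj: "s = n j \<cdot> sj"
    using fp_factor[OF Y dsP limP s(1)] unfolding PD by blast
  have qsj: "q j \<cdot> sj = Ide C Y" using assoc[OF sj n[OF j] q0] qn[OF j] qs s_sj by simp
  note aj = a[OF j] and bj = b[OF j] and qj = q[OF j] and Pj = PO[OF j]
  have sq: "sj \<cdot> q j \<in> Hom C (P j) (P j)" using comp_Hom[OF qj sj] .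
  \<comment> \<open>The complementary idempotent at stage \<open>j\<close> lands in the kernel of
    \<open>q j\<close>, so it factors through \<open>a j\<close> by a map \<open>y\<close>. That map
    is a retraction of \<open>a j\<close>.\<close>
  define ej where "ej = Ide C (P j) \<boxminus> sj \<cdot> q j"
  have ej: "ej \<in> Hom C (P j) (P j)" unfolding ej_def using diff_Hom[OF Ide_Hom[OF Pj] sq] .
  have "q j \<cdot> ej = Zero C (P j) Y"
    unfolding ej_def using comp_diff[OF Ide_Hom[OF Pj] sq qj] Hom_Ide[OF qj] assoc[OF qj sj qj] qsj diff_self[OF qj]
    by simp
  then obtain y where y: "y \<in> Hom C (P j) (omap D j)" "a j \<cdot> y = ej"
    using kernel_factor[OF aker[OF j] qj ej] aj by (auto simp: Hom_def)
  have DjO: "omap D j \<in> Obj C" using HomD(4)[OF aj] .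
  have "ej \<cdot> a j = a j"
    unfolding ej_def using diff_comp[OF aj Ide_Hom[OF Pj] sq] Hom_Ide(2)[OF aj] assoc[OF aj qj sj] qa[OF j]
      comp_Zero[OF sj DjO] diff_Zero[OF aj] by simp
  then have "a j \<cdot> (y \<cdot> a j) = a j \<cdot> Ide C (omap D j)"
    using assoc[OF aj y(1) aj] y(2) Hom_Ide(1)[OF aj] by simp
  moreover have "Dom C (a j) = omap D j" using aj by (simp add: Hom_def)
  ultimately have ya: "y \<cdot> a j = Ide C (omap D j)"
    using kernel_cancel[OF aker[OF j], of "y \<cdot> a j" "omap D j" "Ide C (omap D j)"] comp_Hom[OF aj y(1)]
      Ide_Hom[OF DjO] by simp
  \<comment> \<open>The retraction extends \<open>ws j\<close> from \<open>X\<close> to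
    \<open>E\<close>. Thus \<open>u'\<close> is a candidate lift of \<open>u\<close> that is correct
    on \<open>X\<close>.\<close>
  define u' where "u' = y \<cdot> b j"
  have u': "u' \<in> Hom C E (omap D j)" unfolding u'_def using comp_Hom[OF bj y(1)] .
  have "u' \<cdot> f = ws j"
    unfolding u'_def using assoc[OF f bj y(1)] comm[OF j] assoc[OF ws[OF j] aj y(1)] ya Hom_Ide(2)[OF ws[OF j]] by simp
  note \<iota>u' = comp_Hom[OF u' \<iota>[OF j]]
  have "(u \<boxminus> \<iota> j \<cdot> u') \<cdot> f = Zero C X L"
    using diff_comp[OF f u \<iota>u'] assoc[OF f u' \<iota>[OF j]] \<open>u' \<cdot> f = ws j\<close> \<iota>ws[OF j] diff_self[OF comp_Hom[OF f u]] by simp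
  \<comment> \<open>The error of the candidate vanishes on \<open>X\<close>, so it comes from a map
    \<open>z\<close> on \<open>Y\<close>, which lifts to a stage in turn.\<close>
  then obtain z where z: "z \<in> Hom C Y L" "z \<cdot> g = u \<boxminus> \<iota> j \<cdot> u'"
    using cokernel_factor[OF coker f diff_Hom[OF u \<iota>u']] gY by metis
  obtain k z' where k: "k \<in> I'" and z': "z' \<in> Hom C Y (omap D k)" and zz': "z = \<iota> k \<cdot> z'"
    using fp_factor[OF Y ds' L' z(1)] by blast
  obtain l where l: "l \<in> I'" "(j, l) \<in> r'" "(k, l) \<in> r'" using directed_poset_bound2[OF dir' j k] by blast
  note tj = t[OF r'D(1)[OF l(2)]] and tk = t[OF r'D(1)[OF l(3)]]
  \<comment> \<open>The candidate plus the lifted error, both moved to a common stage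
    \<open>l\<close>.\<close>
  define v where "v = amap D (k, l) \<cdot> (z' \<cdot> g) \<boxplus> amap D (j, l) \<cdot> u'"
  note v1 = comp_Hom[OF comp_Hom[OF g z'] tk] and v2 = comp_Hom[OF u' tj]
  have v: "v \<in> Hom C E (omap D l)" unfolding v_def using Add_Hom[OF v1 v2] .
  have "u = z \<cdot> g \<boxplus> \<iota> j \<cdot> u'"
    using diff_eq_iff[OF u \<iota>u' comp_Hom[OF g z(1)]] z(2) by simp
  also have "\<dots> = \<iota> l \<cdot> v"
    unfolding v_def comp_Add[OF v1 v2 \<iota>[OF l(1)]]
    using comp_reduce[OF direct_limit_comp[OF L' l(2)] tj \<iota>[OF l(1)] u']
      comp_reduce[OF direct_limit_comp[OF L' l(3)] tk \<iota>[OF l(1)] comp_Hom[OF g z']]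
      assoc[OF g z' \<iota>[OF k]] zz' by simp
  finally show "\<exists>i\<in>I. \<exists>x\<in>Hom C E (omap D i). u = \<iota> i \<cdot> x" using v I'D(2)[OF l(1)] by blast
qed

end

section \<open>Finitely presented objects are skeletally small\<close>

lemma exact_direct_limitsD:
  assumes "exact_direct_limits U C"
    and "direct_system U C I r D" "direct_system U C I r E" "direct_system U C I r F"
    and "nat_trans (poset_category I r) C D E \<sigma>" "nat_trans (poset_category I r) C E F \<tau>"
    and "\<forall>i\<in>I. short_exact C (\<sigma> i) (\<tau> i)"
    and "is_direct_limit C I r D L \<iota>" "is_direct_limit C I r E M \<kappa>" "is_direct_limit C I r F N \<nu>"
    and "f \<in> Hom C L M" "\<forall>i\<in>I. f \<cdot>\<^bsub>C\<^esub> \<iota> i = \<kappa> i \<cdot>\<^bsub>C\<^esub> \<sigma> i"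
    and "g \<in> Hom C M N" "\<forall>i\<in>I. g \<cdot>\<^bsub>C\<^esub> \<kappa> i = \<nu> i \<cdot>\<^bsub>C\<^esub> \<tau> i"
  shows "short_exact C f g"
  using assms(1)[unfolded exact_direct_limits_def, THEN spec[of _ I], THEN spec[of _ r], THEN spec[of _ D],
      THEN spec[of _ E], THEN spec[of _ F], THEN spec[of _ \<sigma>], THEN spec[of _ \<tau>], THEN spec[of _ L],
      THEN spec[of _ M], THEN spec[of _ N], THEN spec[of _ \<iota>], THEN spec[of _ \<kappa>], THEN spec[of _ \<nu>],
      THEN spec[of _ f], THEN spec[of _ g]] assms(2-) by simp

lemma nat_trans_posetI:
  assumes "r \<subseteq> I \<times> I" "\<And>i. i \<in> I \<Longrightarrow> \<tau> i \<in> Hom C (omap D i) (omap E i)"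
    and "\<And>i j. (i, j) \<in> r \<Longrightarrow> amap E (i, j) \<cdot>\<^bsub>C\<^esub> \<tau> i = \<tau> j \<cdot>\<^bsub>C\<^esub> amap D (i, j)"
  shows "nat_trans (poset_category I r) C D E \<tau>"
  using assms by (auto simp: nat_trans_def poset_category_def)

lemma (in preadditive) direct_limits_ofI:
  assumes "direct_system U C I r D" "\<And>i. i \<in> I \<Longrightarrow> omap D i \<in> T" "is_direct_limit C I r D X \<iota>"
  shows "X \<in> direct_limits_of U C T"
  unfolding direct_limits_of_def using assms isomorphic_refl[OF direct_limit_Obj[OF assms(3)]] by blast

context cocomplete_abelian
begin

section \<open>Zero objects, generators and finite generation\<close>

lemma zero_object_exists: obtains Z where "zero_object C Z"
  using abelian unfolding abelian_category_def additive_category_def by blast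

lemma zero_object_eq:
  assumes "zero_object C Z"
  shows "f \<in> Hom C X Z \<Longrightarrow> f = Zero C X Z" "f \<in> Hom C Z X \<Longrightarrow> f = Zero C Z X"
proof -
  have ZO: "Z \<in> Obj C" using assms by (simp add: zero_object_def)
  show "f = Zero C X Z" if f: "f \<in> Hom C X Z"
  proof -
    have "\<exists>!f. f \<in> Hom C X Z" using assms HomD(4)[OF f] by (simp add: zero_object_def)
    then show ?thesis by (rule ex1_eqI) (use f Zero_Hom[OF HomD(4)[OF f] ZO] in simp_all)
  qed
  show "f = Zero C Z X" if f: "f \<in> Hom C Z X"
  proof -
    have "\<exists>!f. f \<in> Hom C Z X" using assms HomD(5)[OF f] by (simp add: zero_object_def)
    then show ?thesis by (rule ex1_eqI) (use f Zero_Hom[OF ZO HomD(5)[OF f]] in simp_all)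
  qed
qed

lemma generator_zero:
  assumes G: "is_generator C G" and f: "f \<in> Hom C X Y"
    and z: "\<And>h. h \<in> Hom C G X \<Longrightarrow> f \<cdot> h = Zero C G Y"
  shows "f = Zero C X Y"
proof -
  note XO = HomD(4)[OF f] and YO = HomD(5)[OF f]
  have "\<forall>h\<in>Hom C G X. f \<cdot> h = Zero C X Y \<cdot> h" using z Zero_comp[OF _ YO] by simp
  then show ?thesis
    using G f Zero_Hom[OF XO YO] XO YO unfolding is_generator_def by blast
qed

text \<open>F is the direct limit of the images of finite families of maps from G, being the kernels of the maps
  from F to the joint cokernels of these families, which have limit zero.\<close>
lemma fp_finitely_generated:
  assumes ex: "exact_direct_limits U C" and G: "is_generator C G" and F: "F \<in> fp U C"
  obtains S where "finite S" "S \<subseteq> Hom C G F"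
    "\<And>M h. h \<in> Hom C F M \<Longrightarrow> (\<And>f. f \<in> S \<Longrightarrow> h \<cdot> f = Zero C G M) \<Longrightarrow> h = Zero C F M"
proof -
  note FO = fp_Obj[OF F]
  have GO: "G \<in> Obj C" using G by (simp add: is_generator_def)
  obtain I :: "'u set" and d where I: "I \<prec> U" "bij_betw d I (Fpow (Hom C G F))"
    using small_encode[OF small_Fpow[OF small_Hom[OF GO FO]]] by blast
  have d: "finite (d i)" "d i \<subseteq> Hom C G F" if "i \<in> I" for i
    using I(2) that by (auto simp: bij_betw_def Fpow_def)
  have dsurj: "\<exists>i\<in>I. S = d i" if "finite S" "S \<subseteq> Hom C G F" for S
  proof -
    have "S \<in> d ` I" using I(2) that by (simp add: bij_betw_def Fpow_def)
    then show ?thesis by blast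
  qed
  define r where "r = {(i, j). i \<in> I \<and> j \<in> I \<and> d i \<subseteq> d j}"
  have dir: "directed_poset U I r" unfolding r_def by (rule Fpow_directed[OF I])
  have rD: "i \<in> I" "j \<in> I" "d i \<subseteq> d j" if "(i, j) \<in> r" for i j using that by (auto simp: r_def)
  have rI: "r \<subseteq> I \<times> I" by (auto simp: r_def)
  have dH: "f \<in> Hom C (Dom C f) F" "Dom C f = G" if "i \<in> I" "f \<in> d i" for i f
    using d(2)[OF that(1)] that(2) by (auto simp: Hom_def)
  have "\<exists>W c. c \<in> Hom C F W \<and> is_joint_cokernel C (d i) c" if i: "i \<in> I" for i
    using joint_cokernel_exists[OF small_finite[OF d(1)[OF i]] FO dH(1)[OF i]] by metis
  then obtain W c where c: "\<And>i. i \<in> I \<Longrightarrow> c i \<in> Hom C F (W i)"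
    and W: "\<And>i. i \<in> I \<Longrightarrow> is_joint_cokernel C (d i) (c i)" by metis
  note WO = HomD(5)[OF c] and cepi = joint_cokernel_epi[OF W]
  have cd: "c i \<cdot> f = Zero C G (W i)" if i: "i \<in> I" and f: "f \<in> d i" for i f
    using joint_cokernel_zero[OF W[OF i] c[OF i] f] d(2)[OF i] f by blast
  have "\<exists>V k. k \<in> Hom C V F \<and> is_kernel C k (c i)" if i: "i \<in> I" for i
    using kernel_exists[OF c[OF i]] by metis
  then obtain V k where k: "\<And>i. i \<in> I \<Longrightarrow> k i \<in> Hom C (V i) F"
    and V: "\<And>i. i \<in> I \<Longrightarrow> is_kernel C (k i) (c i)" by metis
  have kDom: "Dom C (k i) = V i" if "i \<in> I" for i using k[OF that] by (simp add: Hom_def)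
  have ck: "c i \<cdot> k i = Zero C (V i) (W i)" if i: "i \<in> I" for i
    using kernelD(2)[OF V[OF i] c[OF i]] kDom[OF i] by simp
  note VO = HomD(4)[OF k]
  have kcancel: "g = h" if i: "i \<in> I" and gh: "g \<in> Hom C Z (V i)" "h \<in> Hom C Z (V i)" "k i \<cdot> g = k i \<cdot> h" for i g h Z
    by (rule kernel_cancel[OF V[OF i], unfolded kDom[OF i], OF gh])
  have "\<exists>t. t \<in> Hom C (W i) (W j) \<and> t \<cdot> c i = c j" if ij: "(i, j) \<in> r" for i j
  proof -
    note i = rD(1)[OF ij] and j = rD(2)[OF ij]
    have "c j \<cdot> f = Zero C (Dom C f) (W j)" if f: "f \<in> d i" for f
      using cd[OF j, of f] dH(2)[OF i f] rD(3)[OF ij] f by auto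
    then show ?thesis using joint_cokernel_factor[OF W[OF i] c[OF i] c[OF j]] by metis
  qed
  then obtain t where t: "\<And>i j. (i, j) \<in> r \<Longrightarrow> t i j \<in> Hom C (W i) (W j)"
    and tc: "\<And>i j. (i, j) \<in> r \<Longrightarrow> t i j \<cdot> c i = c j" by metis
  have "\<exists>s. s \<in> Hom C (V i) (V j) \<and> k j \<cdot> s = k i" if ij: "(i, j) \<in> r" for i j
  proof -
    note i = rD(1)[OF ij] and j = rD(2)[OF ij]
    have "c j \<cdot> k i = Zero C (V i) (W j)"
      using assoc[OF k[OF i] c[OF i] t[OF ij]] tc[OF ij] ck[OF i] comp_Zero[OF t[OF ij] VO[OF i]] by simp
    then obtain s where "s \<in> Hom C (V i) (Dom C (k j))" "k j \<cdot> s = k i"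
      using kernel_factor[OF V[OF j] c[OF j] k[OF i]] by blast
    then show ?thesis using kDom[OF j] by auto
  qed
  then obtain s where s: "\<And>i j. (i, j) \<in> r \<Longrightarrow> s i j \<in> Hom C (V i) (V j)"
    and ks: "\<And>i j. (i, j) \<in> r \<Longrightarrow> k j \<cdot> s i j = k i" by metis
  define VD where "VD = \<lparr>omap = V, amap = \<lambda>(i, j). s i j\<rparr>"
  define WD where "WD = \<lparr>omap = W, amap = \<lambda>(i, j). t i j\<rparr>"
  \<comment> \<open>The middle term of the exact sequence of direct systems is constant with value
    \<open>F\<close>.\<close>
  define FD where "FD = \<lparr>omap = \<lambda>i :: 'u. F, amap = \<lambda>p :: 'u \<times> 'u. Ide C F\<rparr>"
  have VD: "omap VD i = V i" "amap VD (i, j) = s i j" for i j by (simp_all add: VD_def)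
  have WD: "omap WD i = W i" "amap WD (i, j) = t i j" for i j by (simp_all add: WD_def)
  have FD: "omap FD i = F" "amap FD (i, j) = Ide C F" for i j by (simp_all add: FD_def)
  have dsF: "direct_system U C I r FD"
    by (rule direct_systemI[OF dir]) (auto simp: FD FO Ide_Hom)
  have dsV: "direct_system U C I r VD"
  proof (rule direct_systemI[OF dir])
    show "amap VD (i, i) = Ide C (omap VD i)" if i: "i \<in> I" for i
    proof -
      note ii = directed_poset_refl[OF dir i]
      show ?thesis unfolding VD
        using kcancel[OF i s[OF ii] Ide_Hom[OF VO[OF i]]] ks[OF ii] Hom_Ide(1)[OF k[OF i]] by simp
    qed
    show "amap VD (i, l) = amap VD (j, l) \<cdot> amap VD (i, j)" if ij: "(i, j) \<in> r" and jl: "(j, l) \<in> r" for i j l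
    proof -
      note il = directed_poset_trans[OF dir ij jl] and l = rD(2)[OF jl]
      show ?thesis unfolding VD
        using kcancel[OF l s[OF il] comp_Hom[OF s[OF ij] s[OF jl]]] ks[OF il] ks[OF ij]
          comp_reduce[OF ks[OF jl] s[OF jl] k[OF l] s[OF ij]] by simp
    qed
  qed (auto simp: VD VO s)
  have dsW: "direct_system U C I r WD"
  proof (rule direct_systemI[OF dir])
    show "amap WD (i, i) = Ide C (omap WD i)" if i: "i \<in> I" for i
    proof -
      note ii = directed_poset_refl[OF dir i]
      show ?thesis unfolding WD
        using epi_cancel[OF cepi[OF i] c[OF i] t[OF ii] Ide_Hom[OF WO[OF i]]] tc[OF ii]
          Hom_Ide(2)[OF c[OF i]] by simp
    qed
    show "amap WD (i, l) = amap WD (j, l) \<cdot> amap WD (i, j)" if ij: "(i, j) \<in> r" and jl: "(j, l) \<in> r" for i j l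
    proof -
      note il = directed_poset_trans[OF dir ij jl] and i = rD(1)[OF ij]
      show ?thesis unfolding WD
        using epi_cancel[OF cepi[OF i] c[OF i] t[OF il] comp_Hom[OF t[OF ij] t[OF jl]]] tc[OF il] tc[OF jl]
          assoc[OF c[OF i] t[OF ij] t[OF jl]] tc[OF ij] by simp
    qed
  qed (auto simp: WD WO t)
  obtain L \<iota> where L: "is_direct_limit C I r VD L \<iota>" using direct_limit_exists[OF dsV] by blast
  obtain Z where Z: "zero_object C Z" using zero_object_exists by blast
  have ZO: "Z \<in> Obj C" using Z by (simp add: zero_object_def)
  have I0: "\<exists>i. i \<in> I" using dsurj[of "{}"] by auto
  \<comment> \<open>A directed poset is nonempty and any two indices have a common bound, so a
    cocone on a constant system is a single map.\<close>
  have limF: "is_direct_limit C I r FD F (\<lambda>i. Ide C F)"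
  proof (rule direct_limitI)
    show "is_limit_cocone C I r FD F (\<lambda>i. Ide C F)"
      by (simp add: is_limit_cocone_def FD FO Ide_Hom)
  next
    fix M \<mu> assume M: "is_limit_cocone C I r FD M \<mu>"
    then have MO: "M \<in> Obj C" and \<mu>: "\<And>i. i \<in> I \<Longrightarrow> \<mu> i \<in> Hom C F M"
      and \<mu>t: "\<And>i j. (i, j) \<in> r \<Longrightarrow> \<mu> j \<cdot> Ide C F = \<mu> i" unfolding is_limit_cocone_def FD by auto
    have eq: "\<mu> j = \<mu> i" if ij: "(i, j) \<in> r" for i j
      using \<mu>t[OF ij] Hom_Ide(1)[OF \<mu>[OF rD(2)[OF ij]]] by simp
    obtain i where i: "i \<in> I" using I0 by blast
    have "\<mu> j = \<mu> i" if j: "j \<in> I" for j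
      using directed_poset_bound2[OF dir i j] eq by metis
    then show "\<exists>h. h \<in> Hom C F M \<and> (\<forall>i\<in>I. h \<cdot> Ide C F = \<mu> i)"
      using \<mu>[OF i] Hom_Ide(1)[OF \<mu>[OF i]] by (intro exI[of _ "\<mu> i"]) simp
  next
    fix M h l assume hl: "h \<in> Hom C F M" "l \<in> Hom C F M" and eq: "\<And>i. i \<in> I \<Longrightarrow> h \<cdot> Ide C F = l \<cdot> Ide C F"
    show "h = l" using I0 eq Hom_Ide(1)[OF hl(1)] Hom_Ide(1)[OF hl(2)] by metis
  qed
  have limW: "is_direct_limit C I r WD Z (\<lambda>i. Zero C (W i) Z)"
  proof (rule direct_limitI)
    show "is_limit_cocone C I r WD Z (\<lambda>i. Zero C (W i) Z)"
      unfolding is_limit_cocone_def WD using ZO Zero_Hom[OF WO ZO] Zero_comp[OF t ZO] by blast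
  next
    fix M \<mu> assume M: "is_limit_cocone C I r WD M \<mu>"
    then have MO: "M \<in> Obj C" and \<mu>: "\<And>i. i \<in> I \<Longrightarrow> \<mu> i \<in> Hom C (W i) M"
      and \<mu>t: "\<And>i j. (i, j) \<in> r \<Longrightarrow> \<mu> j \<cdot> t i j = \<mu> i" unfolding is_limit_cocone_def WD by auto
    have \<mu>0: "\<mu> i = Zero C (W i) M" if i: "i \<in> I" for i
    proof -
      have "\<mu> i \<cdot> c i = Zero C F M"
      proof (rule generator_zero[OF G comp_Hom[OF c[OF i] \<mu>[OF i]]])
        fix h assume h: "h \<in> Hom C G F"
        \<comment> \<open>Any map \<open>h\<close> from \<open>G\<close> belongs to the finite
          family of some later stage, whose quotient kills it. So a cocone on the quotients is zero
          on all maps from the generator.\<close>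
        have "finite (insert h (d i))" "insert h (d i) \<subseteq> Hom C G F" using h d[OF i] by auto
        then obtain j where j: "j \<in> I" "insert h (d i) = d j" using dsurj by blast
        then have ij: "(i, j) \<in> r" using i by (auto simp: r_def)
        have hj: "h \<in> d j" using j(2) by blast
        have "\<mu> i \<cdot> c i = \<mu> j \<cdot> c j"
          using \<mu>t[OF ij] assoc[OF c[OF i] t[OF ij] \<mu>[OF j(1)]] tc[OF ij] by simp
        then show "\<mu> i \<cdot> c i \<cdot> h = Zero C G M"
          using assoc[OF h c[OF j(1)] \<mu>[OF j(1)]] cd[OF j(1) hj] comp_Zero[OF \<mu>[OF j(1)] GO] by simp
      qed
      then show ?thesis
        using epi_cancel[OF cepi[OF i] c[OF i] \<mu>[OF i] Zero_Hom[OF WO[OF i] MO]] Zero_comp[OF c[OF i] MO] by simp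
    qed
    have "\<forall>i\<in>I. Zero C Z M \<cdot> Zero C (W i) Z = \<mu> i"
      using \<mu>0 Zero_comp[OF Zero_Hom[OF WO ZO] MO] by simp
    then show "\<exists>h. h \<in> Hom C Z M \<and> (\<forall>i\<in>I. h \<cdot> Zero C (W i) Z = \<mu> i)" using Zero_Hom[OF ZO MO] by blast
  next
    fix M h l assume hl: "h \<in> Hom C Z M" "l \<in> Hom C Z M"
    show "h = l" using zero_object_eq(2)[OF Z hl(1)] zero_object_eq(2)[OF Z hl(2)] by simp
  qed
  have "is_limit_cocone C I r VD F k"
    unfolding is_limit_cocone_def VD using FO k ks by blast
  then obtain f where f: "f \<in> Hom C L F" "\<And>i. i \<in> I \<Longrightarrow> f \<cdot> \<iota> i = k i" using direct_limit_factor[OF L] by blast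
  note F0 = Zero_Hom[OF FO ZO]
  have "short_exact C f (Zero C F Z)"
  proof (rule exact_direct_limitsD[OF ex dsV dsF dsW _ _ _ L limF limW f(1) _ F0])
    show "nat_trans (poset_category I r) C VD FD k"
    proof (rule nat_trans_posetI[OF rI])
      show "amap FD (i, j) \<cdot> k i = k j \<cdot> amap VD (i, j)" if ij: "(i, j) \<in> r" for i j
        unfolding VD FD using ks[OF ij] Hom_Ide(2)[OF k[OF rD(1)[OF ij]]] by simp
    qed (use k in \<open>simp add: VD FD\<close>)
    show "nat_trans (poset_category I r) C FD WD c"
    proof (rule nat_trans_posetI[OF rI])
      show "amap WD (i, j) \<cdot> c i = c j \<cdot> amap FD (i, j)" if ij: "(i, j) \<in> r" for i j
        unfolding WD FD using tc[OF ij] Hom_Ide(1)[OF c[OF rD(2)[OF ij]]] by simp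
    qed (use c in \<open>simp add: WD FD\<close>)
    show "\<forall>i\<in>I. short_exact C (k i) (c i)"
      using V epi_cokernel_kernel[OF cepi c V] by (simp add: short_exact_def)
    show "\<forall>i\<in>I. f \<cdot> \<iota> i = Ide C F \<cdot> k i" using f(2) Hom_Ide(2)[OF k] by simp
    show "\<forall>i\<in>I. Zero C F Z \<cdot> Ide C F = Zero C (W i) Z \<cdot> c i"
      using Hom_Ide(1)[OF F0] Zero_comp[OF c ZO] by simp
  qed
  note ker = short_exactD(1)[OF this]
  have fDom: "Dom C f = L" using f(1) by (simp add: Hom_def)
  \<comment> \<open>By exactness \<open>f\<close> is the kernel of a map to a zero object, so the
    identity of \<open>F\<close> factors through the limit of the images.\<close>
  obtain u where u: "u \<in> Hom C F L" "f \<cdot> u = Ide C F"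
    using kernel_factor[OF ker F0 Ide_Hom[OF FO] Hom_Ide(1)[OF F0]] fDom by metis
  \<comment> \<open>As \<open>F\<close> is finitely presented, this factorization already exists at
    a stage. There \<open>k i\<close> has a section, so the quotient map \<open>c i\<close> is zero
    and the finite family \<open>d i\<close> is jointly epimorphic.\<close>
  obtain i x where i: "i \<in> I" and x: "x \<in> Hom C F (V i)" and ux: "u = \<iota> i \<cdot> x"
    using fp_factor[OF F dsV L u(1)] unfolding VD by blast
  have \<iota>: "\<iota> i \<in> Hom C (V i) L" using direct_limit_map[OF L i] unfolding VD .
  have "k i \<cdot> x = Ide C F" using assoc[OF x \<iota> f(1)] f(2)[OF i] u(2) ux by simp
  then have c0: "c i = Zero C F (W i)"
    using assoc[OF x k[OF i] c[OF i]] ck[OF i] Zero_comp[OF x WO[OF i]] Hom_Ide(1)[OF c[OF i]] by simp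
  show ?thesis
  proof (rule that[OF d[OF i]])
    fix M h assume h: "h \<in> Hom C F M" and hS: "\<And>f. f \<in> d i \<Longrightarrow> h \<cdot> f = Zero C G M"
    have "h \<cdot> f = Zero C (Dom C f) M" if "f \<in> d i" for f using hS[OF that] dH(2)[OF i that] by simp
    then obtain v where v: "v \<in> Hom C (W i) M" "v \<cdot> c i = h"
      using joint_cokernel_factor[OF W[OF i] c[OF i] h] by blast
    then show "h = Zero C F M" using c0 comp_Zero[OF v(1) FO] by simp
  qed
qed

text \<open>One coproduct \<open>Q\<close> serves all finitely presented objects at once, which
  makes them comparable as quotients of the same object.\<close>

lemma fp_quotient:
  assumes ex: "exact_direct_limits U C" and G: "is_generator C G"
    and Q: "is_coproduct C (UNIV :: nat set) (\<lambda>_. G) Q \<kappa>" and F: "F \<in> fp U C"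
  obtains q where "q \<in> Hom C Q F" "epi_arr C q"
proof -
  note FO = fp_Obj[OF F]
  have GO: "G \<in> Obj C" using G by (simp add: is_generator_def)
  obtain S where S: "finite S" "S \<subseteq> Hom C G F"
    and epi: "\<And>M h. h \<in> Hom C F M \<Longrightarrow> (\<And>f. f \<in> S \<Longrightarrow> h \<cdot> f = Zero C G M) \<Longrightarrow> h = Zero C F M"
    using fp_finitely_generated[OF ex G F] by blast
  \<comment> \<open>The zero map makes the finite family nonempty, so that it can be enumerated,
    with repetitions, by the natural numbers.\<close>
  let ?S = "insert (Zero C G F) S"
  obtain m where m: "range (m :: nat \<Rightarrow> 'm) = ?S"
    using range_from_nat_into[of ?S] S(1) countable_finite by blast
  have mH: "m n \<in> Hom C G F" for n
    using rangeI[of m n] S(2) Zero_Hom[OF GO FO] unfolding m by (metis insertE subsetD)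
  obtain q where q: "q \<in> Hom C Q F" "\<And>n. q \<cdot> \<kappa> n = m n"
    by (rule coproduct_factor[OF Q FO, of m]) (simp_all add: mH)
  have "epi_arr C q"
  proof (rule epi_arr_zeroI[OF q(1)])
    fix Z h assume h: "h \<in> Hom C F Z" and z: "h \<cdot> q = Zero C Q Z"
    note ZO = HomD(5)[OF h]
    show "h = Zero C F Z"
    proof (rule epi[OF h])
      fix f assume "f \<in> S"
      then obtain n where n: "f = m n" using m by (metis insertI2 rangeE)
      note \<kappa> = coproduct_in[OF Q, of n, simplified]
      show "h \<cdot> f = Zero C G Z"
        using assoc[OF \<kappa> q(1) h] z Zero_comp[OF \<kappa> ZO] q(2) n by simp
    qed
  qed
  then show ?thesis using that q(1) by blast
qed

text \<open>An epimorphism is the cokernel of its kernel \<open>k\<close>, and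
  \<open>q' \<cdot> k\<close> is zero because this may be tested on maps from the generator, all of
  which \<open>q\<close> kills after \<open>k\<close>.\<close>

lemma epi_factor_generator:
  assumes G: "is_generator C G" and q: "epi_arr C q" "q \<in> Hom C Q F" and q': "q' \<in> Hom C Q F'"
    and ker: "\<And>h. h \<in> Hom C G Q \<Longrightarrow> q \<cdot> h = Zero C G F \<Longrightarrow> q' \<cdot> h = Zero C G F'"
  obtains u where "u \<in> Hom C F F'" "u \<cdot> q = q'"
proof -
  have GO: "G \<in> Obj C" using G by (simp add: is_generator_def)
  obtain K k where k: "k \<in> Hom C K Q" "is_kernel C k q" using kernel_exists[OF q(2)] by blast
  have qk: "q \<cdot> k = Zero C K F" using kernelD(2)[OF k(2) q(2)] k(1) by (simp add: Hom_def)
  have "q' \<cdot> k = Zero C K F'"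
  proof (rule generator_zero[OF G comp_Hom[OF k(1) q']])
    fix h assume h: "h \<in> Hom C G K"
    have "q \<cdot> (k \<cdot> h) = Zero C G F"
      using assoc[OF h k(1) q(2)] qk Zero_comp[OF h HomD(5)[OF q(2)]] by simp
    then show "q' \<cdot> k \<cdot> h = Zero C G F'" using ker[OF comp_Hom[OF h k(1)]] assoc[OF h k(1) q'] by simp
  qed
  moreover have "Cod C q = F" using q(2) by (simp add: Hom_def)
  ultimately show ?thesis
    using cokernel_factor[OF epi_cokernel_kernel[OF q k(2)] k(1) q'] that by metis
qed

text \<open>A quotient of Q is determined up to isomorphism by the maps from the generator that it kills.\<close>
lemma fp_skeletally_small:
  assumes ex: "exact_direct_limits U C" and G: "is_generator C G"
  shows "skeletally_small U C (fp U C)"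
proof -
  have GO: "G \<in> Obj C" using G by (simp add: is_generator_def)
  obtain Q \<kappa> where Q: "is_coproduct C (UNIV :: nat set) (\<lambda>_. G) Q \<kappa>"
    using coproduct_exists[OF small_nat, of "\<lambda>_. G"] GO by blast
  have "\<forall>F\<in>fp U C. \<exists>q. q \<in> Hom C Q F \<and> epi_arr C q" using fp_quotient[OF ex G Q] by metis
  then obtain q where q: "\<And>F. F \<in> fp U C \<Longrightarrow> q F \<in> Hom C Q F" "\<And>F. F \<in> fp U C \<Longrightarrow> epi_arr C (q F)" by metis
  define \<Phi> where "\<Phi> F = {h \<in> Hom C G Q. q F \<cdot> h = Zero C G F}" for F
  have iso: "isomorphic C F F'" if F: "F \<in> fp U C" and F': "F' \<in> fp U C" and eq: "\<Phi> F = \<Phi> F'" for F F'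
  proof -
    have mem: "h \<in> Hom C G Q \<Longrightarrow> q F \<cdot> h = Zero C G F \<longleftrightarrow> q F' \<cdot> h = Zero C G F'" for h
      using eq unfolding \<Phi>_def by blast
    obtain u where u: "u \<in> Hom C F F'" "u \<cdot> q F = q F'"
      using epi_factor_generator[OF G q(2)[OF F] q(1)[OF F] q(1)[OF F']] mem by blast
    obtain v where v: "v \<in> Hom C F' F" "v \<cdot> q F' = q F"
      using epi_factor_generator[OF G q(2)[OF F'] q(1)[OF F'] q(1)[OF F]] mem by blast
    have "v \<cdot> u \<cdot> q F = Ide C F \<cdot> q F"
      using assoc[OF q(1)[OF F] u(1) v(1)] u(2) v(2) Hom_Ide(2)[OF q(1)[OF F]] by simp
    then have vu: "v \<cdot> u = Ide C F"
      using epi_cancel[OF q(2)[OF F] q(1)[OF F] comp_Hom[OF u(1) v(1)] Ide_Hom[OF fp_Obj[OF F]]] by simp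
    have "u \<cdot> v \<cdot> q F' = Ide C F' \<cdot> q F'"
      using assoc[OF q(1)[OF F'] v(1) u(1)] u(2) v(2) Hom_Ide(2)[OF q(1)[OF F']] by simp
    then have uv: "u \<cdot> v = Ide C F'"
      using epi_cancel[OF q(2)[OF F'] q(1)[OF F'] comp_Hom[OF v(1) u(1)] Ide_Hom[OF fp_Obj[OF F']]] by simp
    show ?thesis using isomorphicI[OF u(1) v(1) vu uv] .
  qed
  \<comment> \<open>One object is picked for each set of killed maps that occurs; these sets are
    subsets of one small hom set.\<close>
  define rep where "rep = inv_into (fp U C) \<Phi>"
  have rep: "rep (\<Phi> F) \<in> fp U C" "\<Phi> (rep (\<Phi> F)) = \<Phi> F" if "F \<in> fp U C" for F
    using that unfolding rep_def by (simp_all add: inv_into_into f_inv_into_f)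
  have "\<Phi> ` fp U C \<subseteq> Pow (Hom C G Q)" by (auto simp: \<Phi>_def)
  then have "\<Phi> ` fp U C \<prec> U"
    using small_subset[OF small_Pow[OF small_Hom[OF GO coproduct_Obj[OF Q]]]] by blast
  then have "rep ` \<Phi> ` fp U C \<prec> U" by (rule small_image)
  moreover have "rep ` \<Phi> ` fp U C \<subseteq> fp U C" using rep(1) by blast
  moreover have "\<exists>Y\<in>rep ` \<Phi> ` fp U C. isomorphic C F Y" if F: "F \<in> fp U C" for F
    using iso[OF F rep(1)[OF F]] rep(2)[OF F] F by auto
  ultimately show ?thesis unfolding skeletally_small_def by blast
qed

section \<open>The coreflection\<close>

lemma direct_limits_ofE:
  assumes "X \<in> direct_limits_of U C T"
  obtains I r D \<iota> where "direct_system U C I r D" "\<And>i. i \<in> I \<Longrightarrow> omap D i \<in> T" "is_direct_limit C I r D X \<iota>"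
proof -
  obtain I r D L \<iota> where ds: "direct_system U C I r D" and T: "\<forall>i\<in>I. omap D i \<in> T"
    and L: "is_direct_limit C I r D L \<iota>" and X: "isomorphic C X L"
    using assms unfolding direct_limits_of_def by blast
  obtain f g where "f \<in> Hom C X L" "g \<in> Hom C L X" "g \<cdot> f = Ide C X" "f \<cdot> g = Ide C L"
    using X by (rule isomorphicE)
  then show ?thesis using that[OF ds _ direct_limit_iso[OF ds L, of g X f]] T by blast
qed

lemma direct_limits_of_iso_closed: "iso_closed C (direct_limits_of U C T)"
proof -
  have "Y \<in> direct_limits_of U C T" if X: "X \<in> direct_limits_of U C T" and XY: "isomorphic C X Y" for X Y
  proof -
    obtain I r D L \<iota> where ds: "direct_system U C I r D" and T: "\<forall>i\<in>I. omap D i \<in> T"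
      and L: "is_direct_limit C I r D L \<iota>" and XL: "isomorphic C X L"
      using X unfolding direct_limits_of_def by blast
    have "isomorphic C Y L" using isomorphic_trans[OF isomorphic_sym[OF XY] XL] .
    then show ?thesis unfolding direct_limits_of_def using ds T L by blast
  qed
  moreover have "direct_limits_of U C T \<subseteq> Obj C"
    unfolding direct_limits_of_def isomorphic_def by blast
  ultimately show ?thesis unfolding iso_closed_def by blast
qed

text \<open>\<open>F\<close> is its own coproduct over one index, with no relations imposed, so it
  lies in \<open>Pres\<close>, which has already been identified with the direct limits.\<close>

lemma fp_subset_direct_limits: "fp U C \<subseteq> direct_limits_of U C (fp U C)"
proof
  fix F assume F: "F \<in> fp U C"
  note FO = fp_Obj[OF F] and idF = Ide_Hom[OF fp_Obj[OF F]]
  have Q: "is_coproduct C {()} (\<lambda>_. F) F (\<lambda>_. Ide C F)"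
    unfolding is_coproduct_def
  proof (intro conjI ballI allI impI)
    fix M \<mu> assume \<mu>: "\<forall>i\<in>{()}. \<mu> i \<in> Hom C F M"
    then show "\<exists>!h. h \<in> Hom C F M \<and> (\<forall>i\<in>{()}. h \<cdot> Ide C F = \<mu> i)"
      by (intro ex1I[of _ "\<mu> ()"]) (auto simp: Hom_Ide)
  qed (use FO idF in simp_all)
  have epi: "epi_arr C (Ide C F)" by (rule epi_arrI[OF idF]) (simp add: Hom_Ide)
  have "is_joint_cokernel C {} (Ide C F)"
    by (rule joint_cokernelI[OF epi idF]) (use Hom_Ide in blast)+
  then have "F \<in> Pres U C (fp U C)"
    using Pres_joint_cokernel[OF Q small_finite F small_finite[of "{}"] _ idF _ isomorphic_refl[OF FO]] by simp
  then show "F \<in> direct_limits_of U C (fp U C)" using Pres_fp_eq by simp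
qed

text \<open>P is the coproduct of all maps x from representatives of finitely presented objects to X. The
  coreflection R is the quotient of P by all maps from such representatives to the kernel of P to X.
  A map a to R with zero composite to X factors through a stage of R, where the structure map equals,
  by construction of R, one that factors through a quotient killing a.\<close>
lemma coreflection_fp:
  assumes sk: "skeletally_small U C (fp U C)" and X: "X \<in> Obj C"
  obtains R \<epsilon> where "R \<in> direct_limits_of U C (fp U C)" "\<epsilon> \<in> Hom C R X"
    "\<And>F x. F \<in> fp U C \<Longrightarrow> x \<in> Hom C F X \<Longrightarrow> \<exists>a\<in>Hom C F R. \<epsilon> \<cdot> a = x"
    "\<And>F a. F \<in> fp U C \<Longrightarrow> a \<in> Hom C F R \<Longrightarrow> \<epsilon> \<cdot> a = Zero C F X \<Longrightarrow> a = Zero C F R"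
proof -
  obtain T where T: "T \<subseteq> fp U C" "T \<prec> U" "\<And>F. F \<in> fp U C \<Longrightarrow> \<exists>F'\<in>T. isomorphic C F F'"
    using sk unfolding skeletally_small_def by blast
  have TO: "F \<in> Obj C" if "F \<in> T" for F using T(1) fp_Obj that by blast
  \<comment> \<open>Maps from the representatives are collected without labels; \<open>Dom C\<close>
    recovers the representative a map starts from.\<close>
  define \<Lambda> where "\<Lambda> Y = (\<Union>F\<in>T. Hom C F Y)" for Y
  have \<Lambda>small: "\<Lambda> Y \<prec> U" if "Y \<in> Obj C" for Y
    unfolding \<Lambda>_def by (rule small_UN[OF T(2) small_Hom[OF TO that]])
  have \<Lambda>: "f \<in> Hom C (Dom C f) Y" "Dom C f \<in> T" if "f \<in> \<Lambda> Y" for f Y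
    using that by (auto simp: \<Lambda>_def Hom_def)
  have \<Lambda>I: "f \<in> \<Lambda> Y" if "F \<in> T" "f \<in> Hom C F Y" for f F Y using that by (auto simp: \<Lambda>_def)
  obtain P \<kappa> where P: "is_coproduct C (\<Lambda> X) (Dom C) P \<kappa>"
    using coproduct_exists[OF \<Lambda>small[OF X], of "Dom C"] HomD(4)[OF \<Lambda>(1)] by metis
  note PO = coproduct_Obj[OF P]
  obtain p where p: "p \<in> Hom C P X" "\<And>x. x \<in> \<Lambda> X \<Longrightarrow> p \<cdot> \<kappa> x = x"
    using coproduct_factor[OF P X \<Lambda>(1)] by blast
  define S where "S = {y \<in> \<Lambda> P. p \<cdot> y = Zero C (Dom C y) X}"
  have Ssmall: "S \<prec> U" using small_subset[OF \<Lambda>small[OF PO]] by (simp add: S_def)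
  have SH: "f \<in> Hom C (Dom C f) P" "Dom C f \<in> T" if "f \<in> S" for f using that \<Lambda> by (auto simp: S_def)
  obtain R q where q: "q \<in> Hom C P R" "is_joint_cokernel C S q"
    using joint_cokernel_exists[OF Ssmall PO SH(1)] by blast
  note qepi = joint_cokernel_epi[OF q(2)] and RO = HomD(5)[OF q(1)]
  obtain \<epsilon> where \<epsilon>: "\<epsilon> \<in> Hom C R X" "\<epsilon> \<cdot> q = p"
    using joint_cokernel_factor[OF q(2,1) p(1)] by (auto simp: S_def)
  have Gfp: "Dom C x \<in> fp U C" if "x \<in> \<Lambda> X" for x using \<Lambda>(2)[OF that] T(1) by blast
  have Sfp: "Dom C f \<in> fp U C" if "f \<in> S" for f using SH(2)[OF that] T(1) by blast
  \<comment> \<open>Each map from a representative is an index of \<open>P\<close>, so it lifts by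
    its own injection. Other finitely presented objects are reached through an isomorphism.\<close>
  have lift: "\<exists>y\<in>Hom C F P. p \<cdot> y = x" if F: "F \<in> fp U C" and x: "x \<in> Hom C F X" for F x
  proof -
    obtain F' where F': "F' \<in> T" "isomorphic C F F'" using T(3)[OF F] by blast
    obtain \<phi> \<psi> where \<phi>: "\<phi> \<in> Hom C F F'" "\<psi> \<in> Hom C F' F" "\<psi> \<cdot> \<phi> = Ide C F"
      using F'(2) by (rule isomorphicE)
    have x\<psi>: "x \<cdot> \<psi> \<in> Hom C F' X" using comp_Hom[OF \<phi>(2) x] .
    then have mem: "x \<cdot> \<psi> \<in> \<Lambda> X" and Dx: "Dom C (x \<cdot> \<psi>) = F'" using \<Lambda>I[OF F'(1)] by (auto simp: Hom_def)
    have \<kappa>: "\<kappa> (x \<cdot> \<psi>) \<in> Hom C F' P" using coproduct_in[OF P mem] Dx by simp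
    have "p \<cdot> (\<kappa> (x \<cdot> \<psi>) \<cdot> \<phi>) = x"
      using comp_reduce[OF p(2)[OF mem] \<kappa> p(1) \<phi>(1)] assoc[OF \<phi>(1,2) x] \<phi>(3) Hom_Ide(1)[OF x] by simp
    then show ?thesis using comp_Hom[OF \<phi>(1) \<kappa>] by blast
  qed
  have kill: "q \<cdot> y = Zero C F R" if F: "F \<in> fp U C" and y: "y \<in> Hom C F P" and z: "p \<cdot> y = Zero C F X" for F y
  proof -
    obtain F' where F': "F' \<in> T" "isomorphic C F F'" using T(3)[OF F] by blast
    obtain \<phi> \<psi> where \<phi>: "\<phi> \<in> Hom C F F'" "\<psi> \<in> Hom C F' F" "\<psi> \<cdot> \<phi> = Ide C F"
      using F'(2) by (rule isomorphicE)
    have y\<psi>: "y \<cdot> \<psi> \<in> Hom C F' P" using comp_Hom[OF \<phi>(2) y] .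
    have "p \<cdot> (y \<cdot> \<psi>) = Zero C F' X" using comp_reduce[OF z y p(1) \<phi>(2)] Zero_comp[OF \<phi>(2) X] by simp
    then have "y \<cdot> \<psi> \<in> S" using \<Lambda>I[OF F'(1) y\<psi>] y\<psi> by (simp add: S_def Hom_def)
    then have qy: "q \<cdot> (y \<cdot> \<psi>) = Zero C F' R" using joint_cokernel_zero[OF q(2,1) _ y\<psi>] by blast
    have "q \<cdot> y = q \<cdot> (y \<cdot> \<psi> \<cdot> \<phi>)" using assoc[OF \<phi>(1,2) y] \<phi>(3) Hom_Ide(1)[OF y] by simp
    also have "\<dots> = Zero C F R" using comp_reduce[OF qy y\<psi> q(1) \<phi>(1)] Zero_comp[OF \<phi>(1) RO] by simp
    finally show ?thesis .
  qed
  obtain I r D \<iota> where ds: "direct_system U C I r D" and L: "is_direct_limit C I r D R \<iota>"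
    and Dfp: "\<And>i. i \<in> I \<Longrightarrow> omap D i \<in> fp U C"
    and stage: "\<And>i. i \<in> I \<Longrightarrow> \<exists>N\<in>fp U C. \<exists>\<pi>\<in>Hom C N (omap D i). \<exists>e\<in>Hom C N P. epi_arr C \<pi> \<and> \<iota> i \<cdot> \<pi> = q \<cdot> e"
    using joint_cokernel_direct_limit[OF P \<Lambda>small[OF X] Gfp Ssmall Sfp q] by metis
  show ?thesis
  proof (rule that[OF direct_limits_ofI[OF ds Dfp L] \<epsilon>(1)])
    fix F x assume F: "F \<in> fp U C" and x: "x \<in> Hom C F X"
    obtain y where y: "y \<in> Hom C F P" "p \<cdot> y = x" using lift[OF F x] by blast
    have "\<epsilon> \<cdot> (q \<cdot> y) = x" using comp_reduce[OF \<epsilon>(2) q(1) \<epsilon>(1) y(1)] y(2) by simp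
    then show "\<exists>a\<in>Hom C F R. \<epsilon> \<cdot> a = x" using comp_Hom[OF y(1) q(1)] by blast
  next
    fix F a assume F: "F \<in> fp U C" and a: "a \<in> Hom C F R" and z: "\<epsilon> \<cdot> a = Zero C F X"
    obtain i b where i: "i \<in> I" and b: "b \<in> Hom C F (omap D i)" and ab: "a = \<iota> i \<cdot> b"
      using fp_factor[OF F ds L a] by blast
    obtain N \<pi> e where N: "N \<in> fp U C" and \<pi>: "\<pi> \<in> Hom C N (omap D i)" and e: "e \<in> Hom C N P"
      and \<pi>epi: "epi_arr C \<pi>" and \<iota>\<pi>: "\<iota> i \<cdot> \<pi> = q \<cdot> e" using stage[OF i] by blast
    note \<iota> = direct_limit_map[OF L i]
    \<comment> \<open>The part of the stage that survives killing \<open>b\<close> is finitely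
      presented, so the map it induces to \<open>X\<close> lifts to \<open>P\<close>.\<close>
    obtain V c where c: "c \<in> Hom C (omap D i) V" "is_cokernel C c b" using cokernel_exists[OF b] by blast
    have cV: "Cod C c = V" using c(1) by (simp add: Hom_def)
    have V: "V \<in> fp U C" using fp_cokernel[OF c(2) b F Dfp[OF i]] cV by simp
    have cb: "c \<cdot> b = Zero C F V" using cokernelD(2)[OF c(2) b] cV by simp
    note \<epsilon>\<iota> = comp_Hom[OF \<iota> \<epsilon>(1)]
    have "\<epsilon> \<cdot> \<iota> i \<cdot> b = Zero C F X" using assoc[OF b \<iota> \<epsilon>(1)] ab z by simp
    then obtain x where x: "x \<in> Hom C V X" "x \<cdot> c = \<epsilon> \<cdot> \<iota> i"
      using cokernel_factor[OF c(2) b \<epsilon>\<iota>] cV by metis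
    obtain y where y: "y \<in> Hom C V P" "p \<cdot> y = x" using lift[OF V x(1)] by blast
    note c\<pi> = comp_Hom[OF \<pi> c(1)]
    note yc\<pi> = comp_Hom[OF c\<pi> y(1)]
    have "p \<cdot> (y \<cdot> (c \<cdot> \<pi>)) = x \<cdot> (c \<cdot> \<pi>)" using comp_reduce[OF y(2,1) p(1) c\<pi>] .
    also have "\<dots> = \<epsilon> \<cdot> \<iota> i \<cdot> \<pi>" using comp_reduce[OF x(2) c(1) x(1) \<pi>] .
    also have "\<dots> = \<epsilon> \<cdot> (q \<cdot> e)" using assoc[OF \<pi> \<iota> \<epsilon>(1)] \<iota>\<pi> by simp
    also have "\<dots> = p \<cdot> e" using comp_reduce[OF \<epsilon>(2) q(1) \<epsilon>(1) e] .
    \<comment> \<open>The maps \<open>e\<close> and \<open>y \<cdot> (c \<cdot> \<pi>)\<close> agree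
      in \<open>X\<close>, so their difference is one of the relations killed by \<open>q\<close>,
      up to an isomorphism of its domain.\<close>
    finally have "p \<cdot> (e \<boxminus> y \<cdot> (c \<cdot> \<pi>)) = Zero C N X"
      using comp_diff[OF e yc\<pi> p(1)] diff_self[OF comp_Hom[OF e p(1)]] by simp
    then have "q \<cdot> (e \<boxminus> y \<cdot> (c \<cdot> \<pi>)) = Zero C N R" using kill[OF N diff_Hom[OF e yc\<pi>]] by blast
    then have "q \<cdot> e = q \<cdot> (y \<cdot> (c \<cdot> \<pi>))"
      using comp_diff[OF e yc\<pi> q(1)] diff_eq_Zero[OF comp_Hom[OF e q(1)] comp_Hom[OF yc\<pi> q(1)]] by simp
    also have "\<dots> = q \<cdot> (y \<cdot> c) \<cdot> \<pi>"
      using assoc[OF \<pi> c(1) y(1)] assoc[OF \<pi> comp_Hom[OF c(1) y(1)] q(1)] by simp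
    \<comment> \<open>Cancelling \<open>\<pi>\<close> shows that the structure map factors through
      \<open>c\<close>, and \<open>c\<close> kills \<open>b\<close>.\<close>
    finally have "\<iota> i = q \<cdot> (y \<cdot> c)"
      using epi_cancel[OF \<pi>epi \<pi> \<iota> comp_Hom[OF comp_Hom[OF c(1) y(1)] q(1)]] \<iota>\<pi> by simp
    then have "a = q \<cdot> (y \<cdot> (c \<cdot> b))"
      using ab assoc[OF b comp_Hom[OF c(1) y(1)] q(1)] assoc[OF b c(1) y(1)] by simp
    then show "a = Zero C F R"
      using cb comp_Zero[OF y(1) HomD(4)[OF b]] comp_Zero[OF q(1) HomD(4)[OF b]] by simp
  qed
qed

text \<open>Lifts along \<open>\<epsilon>\<close> exist and are unique on finitely presented stages.
  Uniqueness makes the lifts on the stages of a direct limit compatible, so they glue, and it also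
  gives uniqueness of the glued map.\<close>

lemma coreflection:
  assumes sk: "skeletally_small U C (fp U C)" and X: "X \<in> Obj C"
  obtains R \<epsilon> where "R \<in> direct_limits_of U C (fp U C)" "\<epsilon> \<in> Hom C R X"
    "\<And>Y x. Y \<in> direct_limits_of U C (fp U C) \<Longrightarrow> x \<in> Hom C Y X \<Longrightarrow> \<exists>!a. a \<in> Hom C Y R \<and> \<epsilon> \<cdot> a = x"
proof -
  obtain R \<epsilon> where R: "R \<in> direct_limits_of U C (fp U C)" and \<epsilon>: "\<epsilon> \<in> Hom C R X"
    and surj: "\<And>F x. F \<in> fp U C \<Longrightarrow> x \<in> Hom C F X \<Longrightarrow> \<exists>a\<in>Hom C F R. \<epsilon> \<cdot> a = x"
    and inj: "\<And>F a. F \<in> fp U C \<Longrightarrow> a \<in> Hom C F R \<Longrightarrow> \<epsilon> \<cdot> a = Zero C F X \<Longrightarrow> a = Zero C F R"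
    using coreflection_fp[OF sk X] by blast
  have RO: "R \<in> Obj C" using HomD(4)[OF \<epsilon>] .
  have inj': "a = b" if F: "F \<in> fp U C" and ab: "a \<in> Hom C F R" "b \<in> Hom C F R" "\<epsilon> \<cdot> a = \<epsilon> \<cdot> b" for F a b
  proof -
    have "\<epsilon> \<cdot> (a \<boxminus> b) = Zero C F X"
      using comp_diff[OF ab(1,2) \<epsilon>] ab(3) diff_self[OF comp_Hom[OF ab(2) \<epsilon>]] by simp
    then show ?thesis using inj[OF F diff_Hom[OF ab(1,2)]] diff_eq_Zero[OF ab(1,2)] by simp
  qed
  have "\<exists>!a. a \<in> Hom C Y R \<and> \<epsilon> \<cdot> a = x" if Y: "Y \<in> direct_limits_of U C (fp U C)" and x: "x \<in> Hom C Y X" for Y x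
  proof -
    obtain I r D \<iota> where ds: "direct_system U C I r D" and Dfp: "\<And>i. i \<in> I \<Longrightarrow> omap D i \<in> fp U C"
      and L: "is_direct_limit C I r D Y \<iota>" using direct_limits_ofE[OF Y] by blast
    note dir = direct_system_directed[OF ds] and t = direct_system_map[OF ds] and \<iota> = direct_limit_map[OF L]
    have rI: "i \<in> I" "j \<in> I" if "(i, j) \<in> r" for i j using that directed_poset_subset[OF dir] by auto
    have "\<exists>a. a \<in> Hom C (omap D i) R \<and> \<epsilon> \<cdot> a = x \<cdot> \<iota> i" if i: "i \<in> I" for i
      using surj[OF Dfp[OF i] comp_Hom[OF \<iota>[OF i] x]] by blast
    then obtain a where a: "\<And>i. i \<in> I \<Longrightarrow> a i \<in> Hom C (omap D i) R" "\<And>i. i \<in> I \<Longrightarrow> \<epsilon> \<cdot> a i = x \<cdot> \<iota> i" by metis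
    have "a j \<cdot> amap D (i, j) = a i" if ij: "(i, j) \<in> r" for i j
    proof (rule inj'[OF Dfp[OF rI(1)[OF ij]] comp_Hom[OF t[OF ij] a(1)[OF rI(2)[OF ij]]] a(1)[OF rI(1)[OF ij]]])
      show "\<epsilon> \<cdot> (a j \<cdot> amap D (i, j)) = \<epsilon> \<cdot> a i"
        using comp_reduce[OF a(2)[OF rI(2)[OF ij]] a(1)[OF rI(2)[OF ij]] \<epsilon> t[OF ij]]
          assoc[OF t[OF ij] \<iota>[OF rI(2)[OF ij]] x] direct_limit_comp[OF L ij] a(2)[OF rI(1)[OF ij]] by simp
    qed
    then have "is_limit_cocone C I r D R a" unfolding is_limit_cocone_def using RO a(1) by blast
    then obtain h where h: "h \<in> Hom C Y R" "\<And>i. i \<in> I \<Longrightarrow> h \<cdot> \<iota> i = a i" using direct_limit_factor[OF L] by blast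
    have hx: "\<epsilon> \<cdot> h = x"
    proof (rule direct_limit_eqI[OF L comp_Hom[OF h(1) \<epsilon>] x _ dir t])
      show "\<epsilon> \<cdot> h \<cdot> \<iota> i = x \<cdot> \<iota> i" if i: "i \<in> I" for i
        using assoc[OF \<iota>[OF i] h(1) \<epsilon>] h(2)[OF i] a(2)[OF i] by simp
    qed
    show ?thesis
    proof (rule ex1I[of _ h])
      show "h \<in> Hom C Y R \<and> \<epsilon> \<cdot> h = x" using h(1) hx by blast
      fix b assume b: "b \<in> Hom C Y R \<and> \<epsilon> \<cdot> b = x"
      then have bH: "b \<in> Hom C Y R" and bx: "\<epsilon> \<cdot> b = x" by auto
      show "b = h"
      proof (rule direct_limit_eqI[OF L bH h(1) _ dir t])
        fix i assume i: "i \<in> I"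
        show "b \<cdot> \<iota> i = h \<cdot> \<iota> i"
          by (rule inj'[OF Dfp[OF i] comp_Hom[OF \<iota>[OF i] bH] comp_Hom[OF \<iota>[OF i] h(1)]])
            (use assoc[OF \<iota>[OF i] bH \<epsilon>] assoc[OF \<iota>[OF i] h(1) \<epsilon>] bx hx in simp)
      qed
    qed
  qed
  then show ?thesis using that[OF R \<epsilon>] by blast
qed

end

section \<open>The subcategory of direct limits of finitely presented objects\<close>

lemma full_subcategory_simps [simp]:
  "Obj (full_subcategory C S) = S" "Dom (full_subcategory C S) = Dom C" "Cod (full_subcategory C S) = Cod C"
  "Ide (full_subcategory C S) = Ide C" "Comp (full_subcategory C S) = Comp C"
  "Arr (full_subcategory C S) = {f \<in> Arr C. Dom C f \<in> S \<and> Cod C f \<in> S}"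
  by (simp_all add: full_subcategory_def)

lemma full_subcategory_add_simps [simp]:
  fixes C :: "('o, 'm, 'x) addcat_scheme"
  shows "Add (full_subcategory C S) = Add C" "Zero (full_subcategory C S) = Zero C"
  by (simp_all add: full_subcategory_def)

lemma Hom_full_subcategory: "X \<in> S \<Longrightarrow> Y \<in> S \<Longrightarrow> Hom (full_subcategory C S) X Y = Hom C X Y"
  by (auto simp: Hom_def)

lemma Hom_full_subcategory_iff:
  "f \<in> Hom (full_subcategory C S) X Y \<longleftrightarrow> f \<in> Hom C X Y \<and> X \<in> S \<and> Y \<in> S"
  by (auto simp: Hom_def)

locale coreflective_direct_limits = cocomplete_abelian U C
  for U :: "'u set" and C :: "('o, 'm, 'x) addcat_scheme" (structure) +
  assumes skeletally_small: "skeletally_small U C (fp U C)"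
begin

abbreviation S :: "'o set" where "S \<equiv> direct_limits_of U C (fp U C)"

abbreviation B :: "('o, 'm, 'x) addcat_scheme" where "B \<equiv> full_subcategory C S"

lemma S_Obj: "X \<in> S \<Longrightarrow> X \<in> Obj C"
  using direct_limits_of_iso_closed[of "fp U C"] by (auto simp: iso_closed_def)

text \<open>The universal arrows \<open>\<epsilon> X\<close> assemble into a right adjoint: the
  adjunction \<open>\<phi>\<close> takes a map to its unique lift, and functoriality and naturality
  follow from uniqueness.\<close>

lemma coreflective: "coreflective C S"
proof -
  have "\<exists>R \<epsilon>. R \<in> S \<and> \<epsilon> \<in> Hom C R X \<and> (\<forall>Y\<in>S. \<forall>x\<in>Hom C Y X. \<exists>!a. a \<in> Hom C Y R \<and> \<epsilon> \<cdot> a = x)"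
    if X: "X \<in> Obj C" for X
    by (rule coreflection[OF skeletally_small X]) blast
  then obtain R \<epsilon> where R: "\<And>X. X \<in> Obj C \<Longrightarrow> R X \<in> S" and \<epsilon>: "\<And>X. X \<in> Obj C \<Longrightarrow> \<epsilon> X \<in> Hom C (R X) X"
    and univ: "\<And>X Y x. X \<in> Obj C \<Longrightarrow> Y \<in> S \<Longrightarrow> x \<in> Hom C Y X \<Longrightarrow> \<exists>!a. a \<in> Hom C Y (R X) \<and> \<epsilon> X \<cdot> a = x"
    by metis
  define \<phi> where "\<phi> Y X x = (THE a. a \<in> Hom C Y (R X) \<and> \<epsilon> X \<cdot> a = x)" for Y X x
  have \<phi>: "\<phi> Y X x \<in> Hom C Y (R X)" "\<epsilon> X \<cdot> \<phi> Y X x = x" if "Y \<in> S" "x \<in> Hom C Y X" for Y X x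
    using theI'[OF univ[OF HomD(5)[OF that(2)] that]] unfolding \<phi>_def by auto
  have \<phi>_eq: "\<phi> Y X x = a" if "Y \<in> S" "a \<in> Hom C Y (R X)" "X \<in> Obj C" "\<epsilon> X \<cdot> a = x" for Y X x a
  proof -
    have x: "x \<in> Hom C Y X" using comp_Hom[OF that(2) \<epsilon>[OF that(3)]] that(4) by simp
    show ?thesis
      by (rule ex1_eqI[OF univ[OF that(3,1) x]]) (use \<phi>[OF that(1) x] that in simp_all)
  qed
  \<comment> \<open>On a map \<open>g\<close> the functor is the lift of \<open>g\<close> composed
    with the universal arrow of its domain.\<close>
  define F where "F = \<lparr>omap = R, amap = \<lambda>g. \<phi> (R (Dom C g)) (Cod C g) (g \<cdot> \<epsilon> (Dom C g))\<rparr>"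
  have oF: "omap F X = R X" for X by (simp add: F_def)
  have F: "amap F g \<in> Hom C (R X) (R Y)" "\<epsilon> Y \<cdot> amap F g = g \<cdot> \<epsilon> X" if g: "g \<in> Hom C X Y" for g X Y
  proof -
    have XO: "X \<in> Obj C" using HomD(4)[OF g] .
    have "amap F g = \<phi> (R X) Y (g \<cdot> \<epsilon> X)" using g by (simp add: F_def Hom_def)
    then show "amap F g \<in> Hom C (R X) (R Y)" "\<epsilon> Y \<cdot> amap F g = g \<cdot> \<epsilon> X"
      using \<phi>[OF R[OF XO] comp_Hom[OF \<epsilon>[OF XO] g]] by simp_all
  qed
  have F_eq: "amap F g = a" if g: "g \<in> Hom C X Y" and a: "a \<in> Hom C (R X) (R Y)" and eq: "\<epsilon> Y \<cdot> a = g \<cdot> \<epsilon> X" for g a X Y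
  proof -
    note XO = HomD(4)[OF g] and YO = HomD(5)[OF g]
    have "amap F g = \<phi> (R X) Y (g \<cdot> \<epsilon> X)" using g by (simp add: F_def Hom_def)
    then show ?thesis using \<phi>_eq[OF R[OF XO] a YO eq] by simp
  qed
  have Ffun: "is_functor C B F"
    unfolding is_functor_def
  proof (intro conjI ballI impI)
    show "omap F X \<in> Obj B" if "X \<in> Obj C" for X using R[OF that] by (simp add: oF)
    show "amap F f \<in> Hom B (omap F (Dom C f)) (omap F (Cod C f))" if f: "f \<in> Arr C" for f
      using F(1)[of f "Dom C f" "Cod C f"] R f by (simp add: oF Hom_full_subcategory_iff) (simp add: Hom_def)
    show "amap F (Ide C X) = Ide B (omap F X)" if X: "X \<in> Obj C" for X
      using F_eq[OF Ide_Hom[OF X] Ide_Hom[OF S_Obj[OF R[OF X]]]] Hom_Ide[OF \<epsilon>[OF X]] by (simp add: oF)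
    fix f g assume fg: "f \<in> Arr C" "g \<in> Arr C" "Cod C f = Dom C g"
    define X Y Z where XYZ: "X = Dom C f" "Y = Cod C f" "Z = Cod C g"
    have f: "f \<in> Hom C X Y" and g: "g \<in> Hom C Y Z" using fg by (auto simp: Hom_def XYZ)
    note XO = HomD(4)[OF f] and YO = HomD(4)[OF g] and ZO = HomD(5)[OF g]
    have "\<epsilon> Z \<cdot> (amap F g \<cdot> amap F f) = g \<cdot> \<epsilon> Y \<cdot> amap F f"
      using comp_reduce[OF F(2)[OF g] F(1)[OF g] \<epsilon>[OF ZO] F(1)[OF f]] .
    also have "\<dots> = g \<cdot> f \<cdot> \<epsilon> X"
      using assoc[OF F(1)[OF f] \<epsilon>[OF YO] g] F(2)[OF f] assoc[OF \<epsilon>[OF XO] f g] by simp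
    finally show "amap F (g \<cdot> f) = amap F g \<cdot>\<^bsub>B\<^esub> amap F f"
      using F_eq[OF comp_Hom[OF f g] comp_Hom[OF F(1)[OF f] F(1)[OF g]]] by simp
  qed
  let ?I = "\<lparr>omap = \<lambda>X. X, amap = \<lambda>f. f\<rparr> :: ('o, 'm, 'o, 'm) cfunctor"
  have Ifun: "is_functor B C ?I"
    using S_Obj by (auto simp: is_functor_def Hom_def)
  have bij: "bij_betw (\<phi> Y X) (Hom C Y X) (Hom C Y (R X))" if Y: "Y \<in> S" and X: "X \<in> Obj C" for X Y
  proof (rule bij_betwI[where g = "\<lambda>a. \<epsilon> X \<cdot> a"])
    show "(\<lambda>a. \<epsilon> X \<cdot> a) \<in> Hom C Y (R X) \<rightarrow> Hom C Y X" using comp_Hom[OF _ \<epsilon>[OF X]] by blast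
    show "\<phi> Y X (\<epsilon> X \<cdot> a) = a" if "a \<in> Hom C Y (R X)" for a using \<phi>_eq[OF Y that X] by simp
  qed (use \<phi>[OF Y] in auto)
  have nat: "\<phi> Y' X' (g \<cdot> h \<cdot> f) = amap F g \<cdot> \<phi> Y X h \<cdot> f"
    if Y: "Y \<in> S" "Y' \<in> S" and X: "X \<in> Obj C" "X' \<in> Obj C" and f: "f \<in> Hom C Y' Y" and g: "g \<in> Hom C X X'"
      and h: "h \<in> Hom C Y X" for Y Y' X X' f g h
  proof (rule \<phi>_eq[OF Y(2) _ X(2)])
    note \<phi>h = \<phi>[OF Y(1) h] and Fg = F[OF g]
    note c = comp_Hom[OF \<phi>h(1) Fg(1)]
    show "amap F g \<cdot> \<phi> Y X h \<cdot> f \<in> Hom C Y' (R X')" using comp_Hom[OF f c] .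
    have "\<epsilon> X' \<cdot> (amap F g \<cdot> \<phi> Y X h) = g \<cdot> h"
      using comp_reduce[OF Fg(2,1) \<epsilon>[OF X(2)] \<phi>h(1)] assoc[OF \<phi>h(1) \<epsilon>[OF X(1)] g] \<phi>h(2) by simp
    then show "\<epsilon> X' \<cdot> (amap F g \<cdot> \<phi> Y X h \<cdot> f) = g \<cdot> h \<cdot> f"
      using comp_reduce[OF _ c \<epsilon>[OF X(2)] f] by simp
  qed
  have "is_right_adjoint B C ?I F"
    unfolding is_right_adjoint_def
  proof (intro conjI exI[of _ \<phi>] ballI Ifun Ffun)
    show "bij_betw (\<phi> Y X) (Hom C (omap ?I Y) X) (Hom B Y (omap F X))" if "Y \<in> Obj B" "X \<in> Obj C" for X Y
      using bij[of Y X] that R[OF that(2)] by (simp add: oF Hom_full_subcategory)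
    show "\<phi> Y' X' (g \<cdot> h \<cdot> amap ?I f) = amap F g \<cdot>\<^bsub>B\<^esub> \<phi> Y X h \<cdot>\<^bsub>B\<^esub> f"
      if "Y \<in> Obj B" "Y' \<in> Obj B" "X \<in> Obj C" "X' \<in> Obj C" "f \<in> Hom B Y' Y" "g \<in> Hom C X X'"
        "h \<in> Hom C (omap ?I Y) X" for Y Y' X X' f g h
      using nat[of Y Y' X X' f g h] that by (simp add: Hom_full_subcategory)
  qed
  then show ?thesis using direct_limits_of_iso_closed unfolding coreflective_def by blast
qed

text \<open>If the coreflection R of Z has a section s, then s is inverse to it by uniqueness.\<close>
lemma S_colimit_closed:
  assumes Z: "Z \<in> Obj C"
    and Y: "\<And>i. i \<in> I \<Longrightarrow> Y i \<in> S" "\<And>i. i \<in> I \<Longrightarrow> \<kappa> i \<in> Hom C (Y i) Z"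
    and uniq: "\<And>h k. h \<in> Hom C Z Z \<Longrightarrow> k \<in> Hom C Z Z \<Longrightarrow> (\<And>i. i \<in> I \<Longrightarrow> h \<cdot> \<kappa> i = k \<cdot> \<kappa> i) \<Longrightarrow> h = k"
    and glue: "\<And>R \<epsilon> a. R \<in> S \<Longrightarrow> \<epsilon> \<in> Hom C R Z \<Longrightarrow>
      (\<And>Y a b. Y \<in> S \<Longrightarrow> a \<in> Hom C Y R \<Longrightarrow> b \<in> Hom C Y R \<Longrightarrow> \<epsilon> \<cdot> a = \<epsilon> \<cdot> b \<Longrightarrow> a = b) \<Longrightarrow>
      (\<And>i. i \<in> I \<Longrightarrow> a i \<in> Hom C (Y i) R) \<Longrightarrow> (\<And>i. i \<in> I \<Longrightarrow> \<epsilon> \<cdot> a i = \<kappa> i) \<Longrightarrow>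
      \<exists>s\<in>Hom C Z R. \<forall>i\<in>I. s \<cdot> \<kappa> i = a i"
  shows "Z \<in> S"
proof -
  obtain R \<epsilon> where R: "R \<in> S" and \<epsilon>: "\<epsilon> \<in> Hom C R Z"
    and univ: "\<And>Y x. Y \<in> S \<Longrightarrow> x \<in> Hom C Y Z \<Longrightarrow> \<exists>!a. a \<in> Hom C Y R \<and> \<epsilon> \<cdot> a = x"
    using coreflection[OF skeletally_small Z] by blast
  have inj: "a = b" if "Y \<in> S" "a \<in> Hom C Y R" "b \<in> Hom C Y R" "\<epsilon> \<cdot> a = \<epsilon> \<cdot> b" for Y a b
    by (rule ex1_eqI[OF univ[OF that(1) comp_Hom[OF that(2) \<epsilon>]]]) (use that in simp_all)
  have "\<exists>a. a \<in> Hom C (Y i) R \<and> \<epsilon> \<cdot> a = \<kappa> i" if "i \<in> I" for i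
    using univ[OF Y(1)[OF that] Y(2)[OF that]] by blast
  then obtain a where a: "\<And>i. i \<in> I \<Longrightarrow> a i \<in> Hom C (Y i) R" "\<And>i. i \<in> I \<Longrightarrow> \<epsilon> \<cdot> a i = \<kappa> i" by metis
  \<comment> \<open>The colimit maps lift to the coreflection one by one; \<open>glue\<close> is
    what the particular shape of colimit contributes to combine them into a section.\<close>
  have "\<exists>s\<in>Hom C Z R. \<forall>i\<in>I. s \<cdot> \<kappa> i = a i"
  proof (rule glue[OF R \<epsilon>])
    show "b = c" if "Y \<in> S" "b \<in> Hom C Y R" "c \<in> Hom C Y R" "\<epsilon> \<cdot> b = \<epsilon> \<cdot> c" for Y b c using inj[OF that] .
  qed (simp_all add: a)
  then obtain s where s: "s \<in> Hom C Z R" "\<And>i. i \<in> I \<Longrightarrow> s \<cdot> \<kappa> i = a i" by blast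
  have \<epsilon>s: "\<epsilon> \<cdot> s = Ide C Z"
  proof (rule uniq[OF comp_Hom[OF s(1) \<epsilon>] Ide_Hom[OF Z]])
    show "\<epsilon> \<cdot> s \<cdot> \<kappa> i = Ide C Z \<cdot> \<kappa> i" if i: "i \<in> I" for i
      using assoc[OF Y(2)[OF i] s(1) \<epsilon>] s(2)[OF i] a(2)[OF i] Hom_Ide(2)[OF Y(2)[OF i]] by simp
  qed
  have "s \<cdot> \<epsilon> = Ide C R"
  proof (rule inj[OF R comp_Hom[OF \<epsilon> s(1)] Ide_Hom[OF S_Obj[OF R]]])
    show "\<epsilon> \<cdot> (s \<cdot> \<epsilon>) = \<epsilon> \<cdot> Ide C R" using comp_reduce[OF \<epsilon>s s(1) \<epsilon> \<epsilon>] Hom_Ide[OF \<epsilon>] by simp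
  qed
  then have "isomorphic C R Z" using isomorphicI[OF \<epsilon> s(1) _ \<epsilon>s] by blast
  then show ?thesis using R direct_limits_of_iso_closed[of "fp U C"] unfolding iso_closed_def by blast
qed

text \<open>Two maps into the coreflection from an object of \<open>S\<close> are equal if they
  agree after \<open>\<epsilon>\<close>. This makes the lifts of the structure maps a cocone, so
  they glue.\<close>

lemma S_direct_limit:
  assumes ds: "direct_system U C I r D" and D: "\<And>i. i \<in> I \<Longrightarrow> omap D i \<in> S" and L: "is_direct_limit C I r D L \<iota>"
  shows "L \<in> S"
proof (rule S_colimit_closed[OF direct_limit_Obj[OF L] D direct_limit_map[OF L]])
  note dir = direct_system_directed[OF ds] and t = direct_system_map[OF ds] and \<iota> = direct_limit_map[OF L]
  show "h = k" if "h \<in> Hom C L L" "k \<in> Hom C L L" "\<And>i. i \<in> I \<Longrightarrow> h \<cdot> \<iota> i = k \<cdot> \<iota> i" for h k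
    using direct_limit_eqI[OF L that dir t] .
  fix R \<epsilon> a
  assume R: "R \<in> S" and \<epsilon>: "\<epsilon> \<in> Hom C R L"
    and inj: "\<And>Y a b. Y \<in> S \<Longrightarrow> a \<in> Hom C Y R \<Longrightarrow> b \<in> Hom C Y R \<Longrightarrow> \<epsilon> \<cdot> a = \<epsilon> \<cdot> b \<Longrightarrow> a = b"
    and a: "\<And>i. i \<in> I \<Longrightarrow> a i \<in> Hom C (omap D i) R" "\<And>i. i \<in> I \<Longrightarrow> \<epsilon> \<cdot> a i = \<iota> i"
  have rI: "i \<in> I" "j \<in> I" if "(i, j) \<in> r" for i j using that directed_poset_subset[OF dir] by auto
  have "a j \<cdot> amap D (i, j) = a i" if ij: "(i, j) \<in> r" for i j
  proof (rule inj[OF D[OF rI(1)[OF ij]] comp_Hom[OF t[OF ij] a(1)[OF rI(2)[OF ij]]] a(1)[OF rI(1)[OF ij]]])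
    show "\<epsilon> \<cdot> (a j \<cdot> amap D (i, j)) = \<epsilon> \<cdot> a i"
      using comp_reduce[OF a(2)[OF rI(2)[OF ij]] a(1)[OF rI(2)[OF ij]] \<epsilon> t[OF ij]]
        direct_limit_comp[OF L ij] a(2)[OF rI(1)[OF ij]] by simp
  qed
  then have "is_limit_cocone C I r D R a" unfolding is_limit_cocone_def using S_Obj[OF R] a(1) by blast
  then obtain s where "s \<in> Hom C L R" "\<And>i. i \<in> I \<Longrightarrow> s \<cdot> \<iota> i = a i" using direct_limit_factor[OF L] by blast
  then show "\<exists>s\<in>Hom C L R. \<forall>i\<in>I. s \<cdot> \<iota> i = a i" by blast
qed

text \<open>A biproduct is a colimit of a shape without arrows, indexed here by the truth values, so
  gluing needs no compatibility.\<close>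

lemma S_biproduct:
  assumes B: "is_biproduct C X Y P i j p q" and X: "X \<in> S" and Y: "Y \<in> S"
  shows "P \<in> S"
proof (rule S_colimit_closed[where I = "UNIV :: bool set" and Y = "\<lambda>b. if b then X else Y" and \<kappa> = "\<lambda>b. if b then i else j"])
  note b = biproductD[OF B]
  show "P \<in> Obj C" using HomD(5)[OF b(1)] .
  show "h = k" if "h \<in> Hom C P P" "k \<in> Hom C P P"
    "\<And>c. c \<in> UNIV \<Longrightarrow> h \<cdot> (if c then i else j) = k \<cdot> (if c then i else j)" for h k
    using biproduct_eqI[OF B that(1,2)] that(3)[of True] that(3)[of False] by simp
  fix R \<epsilon> a
  assume a: "\<And>c. c \<in> UNIV \<Longrightarrow> a c \<in> Hom C (if c then X else Y) R"
  obtain u where "u \<in> Hom C P R" "u \<cdot> i = a True" "u \<cdot> j = a False"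
    using biproduct_factor[OF B, of "a True" R "a False"] a[of True] a[of False] by auto
  then show "\<exists>s\<in>Hom C P R. \<forall>c\<in>UNIV. s \<cdot> (if c then i else j) = a c"
    by (intro bexI[of _ u]) (auto split: if_splits)
qed (use X Y biproductD[OF B] in auto)

text \<open>A zero object is the coproduct of the empty family.\<close>

lemma fp_zero_object:
  assumes Z: "zero_object C Z" shows "Z \<in> fp U C"
proof (rule fp_finite_coproduct)
  have "\<exists>!h. h \<in> Hom C Z Q" if "Q \<in> Obj C" for Q using Z that by (simp add: zero_object_def)
  then show "is_coproduct C ({} :: nat set) (\<lambda>_. Z) Z (\<lambda>_. Ide C Z)"
    using Z by (simp add: is_coproduct_def zero_object_def)
qed simp_all

section \<open>The subcategory as an additive category and its direct limits\<close>

lemma preadditive_B: "preadditive_category U B"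
  unfolding preadditive_category_def
proof (intro conjI)
  show "Defs.category B"
    unfolding category_def using S_Obj Ide_Hom by (auto simp: Hom_full_subcategory_iff Hom_def)
  show "locally_small U B"
    using small_Hom S_Obj by (simp add: locally_small_def Hom_full_subcategory)
  show "\<forall>X\<in>Obj B. \<forall>Y\<in>Obj B. comm_group (hom_group B X Y)"
    using hom_comm_group S_Obj by (simp add: hom_group_def Hom_full_subcategory)
  show "\<forall>X\<in>Obj B. \<forall>Y\<in>Obj B. \<forall>Z\<in>Obj B.
      (\<forall>f\<in>Hom B X Y. \<forall>g\<in>Hom B Y Z. \<forall>g'\<in>Hom B Y Z. (g \<boxplus>\<^bsub>B\<^esub> g') \<cdot>\<^bsub>B\<^esub> f = g \<cdot>\<^bsub>B\<^esub> f \<boxplus>\<^bsub>B\<^esub> g' \<cdot>\<^bsub>B\<^esub> f) \<and>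
      (\<forall>f\<in>Hom B X Y. \<forall>f'\<in>Hom B X Y. \<forall>g\<in>Hom B Y Z. g \<cdot>\<^bsub>B\<^esub> (f \<boxplus>\<^bsub>B\<^esub> f') = g \<cdot>\<^bsub>B\<^esub> f \<boxplus>\<^bsub>B\<^esub> g \<cdot>\<^bsub>B\<^esub> f')"
    by (simp add: Hom_full_subcategory Add_comp comp_Add)
qed

sublocale B: preadditive U B
  by (rule preadditive.intro[OF universe_axioms preadditive_axioms.intro[OF preadditive_B]])

lemma additive_B: "additive_category U B"
proof -
  obtain Z where Z: "zero_object C Z" using zero_object_exists by blast
  have "Z \<in> S" using fp_zero_object[OF Z] fp_subset_direct_limits by blast
  then have "zero_object B Z"
    using Z S_Obj by (simp add: zero_object_def Hom_full_subcategory)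
  moreover have "\<exists>P i j p q. is_biproduct B X Y P i j p q" if X: "X \<in> S" and Y: "Y \<in> S" for X Y
  proof -
    obtain P i j p q where P: "is_biproduct C X Y P i j p q" using biproduct_exists[OF S_Obj[OF X] S_Obj[OF Y]] by blast
    have "P \<in> S" using S_biproduct[OF P X Y] .
    then have "is_biproduct B X Y P i j p q" using P X Y by (simp add: is_biproduct_def Hom_full_subcategory)
    then show ?thesis by blast
  qed
  ultimately show ?thesis unfolding additive_category_def using preadditive_B by auto
qed

lemma direct_system_B: "direct_system U B I r D \<longleftrightarrow> direct_system U C I r D \<and> (\<forall>i\<in>I. omap D i \<in> S)"
proof
  assume ds: "direct_system U B I r D"
  have "direct_system U C I r D"
    by (rule direct_systemI[OF direct_system_directed[OF ds]])
      (use direct_system_Obj[OF ds] S_Obj direct_system_map[OF ds] direct_system_Ide[OF ds] direct_system_comp[OF ds]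
        in \<open>auto simp: Hom_full_subcategory_iff\<close>)
  then show "direct_system U C I r D \<and> (\<forall>i\<in>I. omap D i \<in> S)" using direct_system_Obj[OF ds] by simp
next
  assume ds: "direct_system U C I r D \<and> (\<forall>i\<in>I. omap D i \<in> S)"
  then have d: "direct_system U C I r D" by blast
  note rI = directed_poset_subset[OF direct_system_directed[OF d]]
  have "amap D (i, j) \<in> Hom B (omap D i) (omap D j)" if ij: "(i, j) \<in> r" for i j
    using direct_system_map[OF d ij] ds rI ij by (auto simp: Hom_full_subcategory_iff)
  then show "direct_system U B I r D"
    by (intro direct_systemI direct_system_directed[OF d])
      (use ds direct_system_Ide[OF d] direct_system_comp[OF d] in auto)
qed

lemma limit_cocone_B:
  assumes "\<forall>i\<in>I. omap D i \<in> S"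
  shows "is_limit_cocone B I r D M \<mu> \<longleftrightarrow> is_limit_cocone C I r D M \<mu> \<and> M \<in> S"
  using assms S_Obj by (auto simp: is_limit_cocone_def Hom_full_subcategory_iff)

lemma direct_limit_BI:
  assumes ds: "direct_system U C I r D" and D: "\<forall>i\<in>I. omap D i \<in> S" and L: "is_direct_limit C I r D L \<iota>"
  shows "is_direct_limit B I r D L \<iota>"
proof -
  have LS: "L \<in> S" using S_direct_limit[OF ds _ L] D by blast
  show ?thesis
  proof (rule direct_limitI)
    show "is_limit_cocone B I r D L \<iota>" using direct_limit_cocone[OF L] LS limit_cocone_B[OF D] by simp
  next
    fix M \<mu> assume "is_limit_cocone B I r D M \<mu>"
    then have M: "is_limit_cocone C I r D M \<mu>" "M \<in> S" using limit_cocone_B[OF D] by auto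
    obtain h where "h \<in> Hom C L M" "\<And>i. i \<in> I \<Longrightarrow> h \<cdot> \<iota> i = \<mu> i" using direct_limit_factor[OF L M(1)] by blast
    then show "\<exists>h. h \<in> Hom B L M \<and> (\<forall>i\<in>I. h \<cdot>\<^bsub>B\<^esub> \<iota> i = \<mu> i)"
      using LS M(2) by (auto simp: Hom_full_subcategory_iff)
  next
    fix M h k assume hk: "h \<in> Hom B L M" "k \<in> Hom B L M" and eq: "\<And>i. i \<in> I \<Longrightarrow> h \<cdot>\<^bsub>B\<^esub> \<iota> i = k \<cdot>\<^bsub>B\<^esub> \<iota> i"
    show "h = k"
      by (rule direct_limit_eqI[OF L _ _ _ direct_system_directed[OF ds] direct_system_map[OF ds]])
        (use hk eq in \<open>auto simp: Hom_full_subcategory_iff\<close>)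
  qed
qed

text \<open>The ambient limit \<open>M\<close> is also a limit in the subcategory, hence isomorphic
  to \<open>L\<close> over the diagram, and the ambient universal property is carried along that
  isomorphism.\<close>

lemma direct_limit_BD:
  assumes ds: "direct_system U B I r D" and L: "is_direct_limit B I r D L \<iota>"
  shows "is_direct_limit C I r D L \<iota>"
proof -
  have dsC: "direct_system U C I r D" and D: "\<forall>i\<in>I. omap D i \<in> S" using ds direct_system_B by auto
  obtain M \<kappa> where M: "is_direct_limit C I r D M \<kappa>" using direct_limit_exists[OF dsC] by blast
  obtain f g where f: "f \<in> Hom B M L" "g \<in> Hom B L M" "g \<cdot>\<^bsub>B\<^esub> f = Ide B M" "f \<cdot>\<^bsub>B\<^esub> g = Ide B L"
    and \<iota>: "\<And>i. i \<in> I \<Longrightarrow> f \<cdot>\<^bsub>B\<^esub> \<kappa> i = \<iota> i"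
    using B.direct_limit_unique[OF ds direct_limit_BI[OF dsC D M] L] by metis
  have "is_direct_limit C I r D L (\<lambda>i. f \<cdot> \<kappa> i)"
    by (rule direct_limit_iso[OF dsC M]) (use f in \<open>auto simp: Hom_full_subcategory_iff\<close>)
  moreover have "is_limit_cocone C I r D L \<iota>"
    using direct_limit_cocone[OF L] limit_cocone_B[OF D] by blast
  ultimately show ?thesis
    using \<iota> unfolding is_direct_limit_def is_colimit_def is_cocone_poset by (simp add: poset_category_def)
qed

text \<open>Since direct limits agree, finite presentation passes down to the subcategory.
  Conversely, an object of \<open>S\<close> is a direct limit of finitely presented ones; if it is
  finitely presented in the subcategory, its identity factors through a stage and exhibits it as a
  retract of that stage.\<close>

lemma fp_B: "fp U B = fp U C"
proof
  show "fp U C \<subseteq> fp U B"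
  proof
    fix F assume F: "F \<in> fp U C"
    then have FS: "F \<in> S" using fp_subset_direct_limits by blast
    show "F \<in> fp U B"
    proof (rule B.fpI)
      show "F \<in> Obj B" using FS by simp
      fix I r D L \<iota> assume ds: "direct_system U B I r D" and L: "is_direct_limit B I r D L \<iota>"
      have dsC: "direct_system U C I r D" and D: "\<forall>i\<in>I. omap D i \<in> S" using ds direct_system_B by auto
      note LC = direct_limit_BD[OF ds L]
      have LS: "L \<in> S" using direct_limit_Obj[OF L] by simp
      show "\<exists>i\<in>I. \<exists>x\<in>Hom B F (omap D i). f = \<iota> i \<cdot>\<^bsub>B\<^esub> x" if "f \<in> Hom B F L" for f
      proof -
        have "f \<in> Hom C F L" using that by (simp add: Hom_full_subcategory_iff)
        then obtain i x where i: "i \<in> I" and x: "x \<in> Hom C F (omap D i)" "f = \<iota> i \<cdot> x"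
          using fp_factor[OF F dsC LC] by blast
        have "x \<in> Hom B F (omap D i)" using x(1) FS D i by (simp add: Hom_full_subcategory_iff)
        then show ?thesis using i x(2) by (intro bexI[of _ i] bexI[of _ x]) simp_all
      qed
      show "\<exists>j. (i, j) \<in> r \<and> amap D (i, j) \<cdot>\<^bsub>B\<^esub> x = Zero B F (omap D j)"
        if i: "i \<in> I" and x: "x \<in> Hom B F (omap D i)" and z: "\<iota> i \<cdot>\<^bsub>B\<^esub> x = Zero B F L" for i x
      proof -
        have "x \<in> Hom C F (omap D i)" "\<iota> i \<cdot> x = Zero C F L" using x z by (simp_all add: Hom_full_subcategory_iff)
        then show ?thesis using fp_vanish[OF F dsC LC i] by (metis full_subcategory_simps(5) full_subcategory_add_simps(2))
      qed
    qed
  qed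
  show "fp U B \<subseteq> fp U C"
  proof
    fix F assume F: "F \<in> fp U B"
    then have FS: "F \<in> S" using B.fp_Obj by simp
    obtain I r D \<iota> where ds: "direct_system U C I r D" and Dfp: "\<And>i. i \<in> I \<Longrightarrow> omap D i \<in> fp U C"
      and L: "is_direct_limit C I r D F \<iota>" using direct_limits_ofE[OF FS] by blast
    have D: "\<forall>i\<in>I. omap D i \<in> S" using Dfp fp_subset_direct_limits by blast
    have dsB: "direct_system U B I r D" using ds D direct_system_B by simp
    have "Ide B F \<in> Hom B F F" using B.Ide_Hom FS by simp
    then obtain i x where i: "i \<in> I" and x: "x \<in> Hom B F (omap D i)" and id: "Ide B F = \<iota> i \<cdot>\<^bsub>B\<^esub> x"
      using B.fp_factor[OF F dsB direct_limit_BI[OF ds D L]] by blast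
    have "x \<in> Hom C F (omap D i)" using x by (simp add: Hom_full_subcategory_iff)
    then show "F \<in> fp U C"
      using fp_retract[OF Dfp[OF i] _ direct_limit_map[OF L i]] id by simp
  qed
qed

lemma finitely_accessible_B: "finitely_accessible U B"
proof -
  have "has_direct_limits U B"
    unfolding has_direct_limits_def using direct_system_B direct_limit_exists direct_limit_BI by metis
  moreover have "skeletally_small U B (fp U B)"
  proof -
    have iso: "isomorphic B X Y \<longleftrightarrow> isomorphic C X Y" if "X \<in> fp U C" "Y \<in> fp U C" for X Y
      using subsetD[OF fp_subset_direct_limits that(1)] subsetD[OF fp_subset_direct_limits that(2)] S_Obj
      by (simp add: isomorphic_def Hom_full_subcategory)
    obtain T where T: "T \<subseteq> fp U C" "T \<prec> U" "\<forall>X\<in>fp U C. \<exists>Y\<in>T. isomorphic C X Y"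
      using skeletally_small unfolding skeletally_small_def by blast
    then have "\<forall>X\<in>fp U C. \<exists>Y\<in>T. isomorphic B X Y" using iso by (meson subsetD)
    then show ?thesis unfolding skeletally_small_def fp_B using T by blast
  qed
  moreover have "X \<in> direct_limits_of U B (fp U B)" if X: "X \<in> S" for X
  proof -
    obtain I r D \<iota> where ds: "direct_system U C I r D" and Dfp: "\<And>i. i \<in> I \<Longrightarrow> omap D i \<in> fp U C"
      and L: "is_direct_limit C I r D X \<iota>" using direct_limits_ofE[OF X] by blast
    have D: "\<forall>i\<in>I. omap D i \<in> S" using Dfp fp_subset_direct_limits by blast
    have "direct_system U B I r D" using ds D direct_system_B by simp
    then show ?thesis using B.direct_limits_ofI direct_limit_BI[OF ds D L] Dfp fp_B by metis
  qed
  ultimately show ?thesis unfolding finitely_accessible_def using additive_B by auto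
qed

end

theorem proposition9p17:
  fixes U :: "'u set" and A :: "('o, 'm) addcat"
  assumes "inaccessible U" and "AB5_abelian U A"
  shows
    "(closed_under_cokernels A (fp U A) \<and>
      (grothendieck_category U A \<longrightarrow>
         skeletally_small U A (fp U A) \<and> closed_under_extensions A (fp U A))) \<and>
     Pres U A (fp U A) = direct_limits_of U A (fp U A) \<and>
     (grothendieck_category U A \<longrightarrow>
        coreflective A (direct_limits_of U A (fp U A)) \<and>
        finitely_accessible U (full_subcategory A (direct_limits_of U A (fp U A))))"
proof -
  interpret cocomplete_abelian U A
    by unfold_locales (use assms in \<open>simp_all add: AB5_abelian_def\<close>)
  have "closed_under_cokernels A (fp U A)"
    unfolding closed_under_cokernels_def
  proof (intro allI impI)
    fix f c assume h: "is_cokernel A c f \<and> Dom A f \<in> fp U A \<and> Cod A f \<in> fp U A"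
    then have "f \<in> Hom A (Dom A f) (Cod A f)" by (auto simp: is_cokernel_def Hom_def)
    then show "Cod A c \<in> fp U A" using fp_cokernel h by blast
  qed
  moreover have "closed_under_extensions A (fp U A)"
    unfolding closed_under_extensions_def
  proof (intro allI impI)
    fix f g assume h: "short_exact A f g \<and> Dom A f \<in> fp U A \<and> Cod A g \<in> fp U A"
    then have "f \<in> Hom A (Dom A f) (Cod A f)" "g \<in> Hom A (Cod A f) (Cod A g)"
      by (auto simp: short_exact_def is_kernel_def Hom_def)
    then show "Cod A f \<in> fp U A" using fp_extension h by blast
  qed
  moreover have sk: "skeletally_small U A (fp U A)" if "grothendieck_category U A"
    using fp_skeletally_small that by (auto simp: grothendieck_category_def AB5_abelian_def)
  moreover have "coreflective A (direct_limits_of U A (fp U A)) \<and>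
      finitely_accessible U (full_subcategory A (direct_limits_of U A (fp U A)))" if "grothendieck_category U A"
  proof -
    \<comment> \<open>The generator enters the third claim through skeletal smallness.\<close>
    interpret coreflective_direct_limits U A
      by unfold_locales (rule sk[OF that])
    show ?thesis using coreflective finitely_accessible_B by blast
  qed
  ultimately show ?thesis using Pres_fp_eq by blast
qed

end
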